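(* Let $\mu\in\mathbb{R}$. The kernel $K(\mu,\lambda,x,y)$ of the resolvent $(L^\mu-\lambda^2)^{-1}$, $\operatorname{Im}\lambda>0$, has, as a function of $\lambda$, a meromorphic continuation to the whole complex plane, and the operator $L^\mu$ has either a single eigenvalue or a single resonance. More precisely: (i) if $\mu<0$, then $L^\mu$ has exactly one eigenvalue, namely $-\mu^2$, its eigenspace is spanned by $v_\mu(x)=\frac{e^{\mu|x|}}{|x|}$, and $L^\mu$ has no resonance; (ii) if $\mu\ge 0$, then $L^\mu$ has no eigenvalue and has exactly one resonance, namely $\lambda=-i\mu$.
   Context: All functions are complex-valued. Let $L=-\sum_{i=1}^3\partial^2/\partial x_i^2$ in $L^2(\mathbb{R}^3)$ with domain $C_c^\infty(\mathbb{R}^3\setminus\{0\})$. For $\mu\in\mathbb{R}$, $L^\mu$ is the self-adjoint extension of $L$ (a restriction of the adjoint $L^*$) with domain \[D(L^\mu)=\Big\{\chi\beta\Big(\frac{1}{|x|}+\mu\Big)+\varphi':\ \varphi'\in W^{2,2}(\mathbb{R}^3),\ \varphi'(0)=0,\ \beta\in\mathbb{C}\Big\},\] where $\chi\in C_c^\infty(\mathbb{R}^3)$ is a fixed function with $\chi\equiv1$ near $0$ (and $\varphi'$ is just a name, not a derivative). The operators $L^\mu$, $\mu\in\mathbb{R}$, are exactly the self-adjoint extensions of $L$ other than the Friedrichs extension (the Laplacian with domain $W^{2,2}(\mathbb{R}^3)$). For $\operatorname{Im}\lambda>0$ with $\lambda^2$ in the resolvent set of $L^\mu$, $K(\mu,\lambda,x,y)$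 denotes the integral kernel of $(L^\mu-\lambda^2)^{-1}$, i.e. $\big((L^\mu-\lambda^2)^{-1}f\big)(x)=\int_{\mathbb{R}^3}K(\mu,\lambda,x,y)f(y)\,dy$; it is continuous in $(x,y)$ for $x,y\ne0$, $x\neq y$, and its meromorphic continuation in $\lambda$ is taken for fixed such $x,y$. A resonance of $L^\mu$ is a pole $\lambda$ of this continuation that does not lie in the open upper (physical) half-plane, i.e. a pole with $\operatorname{Im}\lambda\le0$. *)

theory Defs
  imports "HOL-Complex_Analysis.Complex_Analysis"
begin

type_synonym R3 = "real ^ 3"

section \<open>Smooth functions and test functions\<close>

definition partial :: "3 \<Rightarrow> (R3 \<Rightarrow> complex) \<Rightarrow> R3 \<Rightarrow> complex" where
  "partial i f x = vector_derivative (\<lambda>t. f (x + t *\<^sub>R axis i 1)) (at 0)"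

text \<open>Multi-indices are given as lists of coordinate indices.\<close>

definition partials :: "3 list \<Rightarrow> (R3 \<Rightarrow> complex) \<Rightarrow> R3 \<Rightarrow> complex" where
  "partials is f = foldr partial is f"

definition smooth :: "(R3 \<Rightarrow> complex) \<Rightarrow> bool" where
  "smooth f \<longleftrightarrow> (\<forall>is x. partials is f differentiable (at x))"

text \<open>\<open>C\<^sub>c\<^sup>\<infinity>(\<Omega>)\<close>, its elements being extended by zero to the whole space.\<close>

definition test_functions :: "R3 set \<Rightarrow> (R3 \<Rightarrow> complex) set" where
  "test_functions \<Omega> = {f. smooth f \<and> compact (closure {x. f x \<noteq> 0}) \<and> closure {x. f x \<noteq> 0} \<subseteq> \<Omega>}"

section \<open>The Hilbert space of square integrable functions\<close>

text \<open>Elements of \<open>L\<^sup>2(\<real>\<^sup>3)\<close> are represented by Borel measurable square integrable functions;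
  equality in \<open>L\<^sup>2\<close> is equality almost everywhere.\<close>

definition L2 :: "(R3 \<Rightarrow> complex) set" where
  "L2 = {f \<in> borel_measurable lborel. integrable lborel (\<lambda>x. (cmod (f x))\<^sup>2)}"

definition ae_eq :: "(R3 \<Rightarrow> complex) \<Rightarrow> (R3 \<Rightarrow> complex) \<Rightarrow> bool" where
  "ae_eq f g \<longleftrightarrow> (AE x in lborel. f x = g x)"

definition L2_inner :: "(R3 \<Rightarrow> complex) \<Rightarrow> (R3 \<Rightarrow> complex) \<Rightarrow> complex" where
  "L2_inner f g = (LINT x|lborel. f x * cnj (g x))"

definition L2_norm :: "(R3 \<Rightarrow> complex) \<Rightarrow> real" where
  "L2_norm f = sqrt (LINT x|lborel. (cmod (f x))\<^sup>2)"

definition weak_partials :: "3 list \<Rightarrow> (R3 \<Rightarrow> complex) \<Rightarrow> (R3 \<Rightarrow> complex) \<Rightarrow> bool" where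
  "weak_partials is u w \<longleftrightarrow> (\<forall>\<phi>\<in>test_functions UNIV.
     (LINT x|lborel. u x * partials is \<phi> x) = (-1) ^ length is * (LINT x|lborel. w x * \<phi> x))"

definition W22 :: "(R3 \<Rightarrow> complex) set" where
  "W22 = {u \<in> L2. \<forall>is. length is \<le> 2 \<longrightarrow> (\<exists>w\<in>L2. weak_partials is u w)}"

section \<open>Operators\<close>

text \<open>An operator in \<open>L\<^sup>2\<close> is given by its graph, a set of pairs of representatives.\<close>

type_synonym operator = "((R3 \<Rightarrow> complex) \<times> (R3 \<Rightarrow> complex)) set"

definition adjoint :: "operator \<Rightarrow> operator" where
  "adjoint A = {(u, w). u \<in> L2 \<and> w \<in> L2 \<and> (\<forall>(\<phi>, \<psi>)\<in>A. L2_inner \<psi> u = L2_inner \<phi> w)}"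

definition eigenspace :: "operator \<Rightarrow> complex \<Rightarrow> (R3 \<Rightarrow> complex) set" where
  "eigenspace A z = {u. (u, \<lambda>x. z * u x) \<in> A}"

definition is_eigenvalue :: "operator \<Rightarrow> complex \<Rightarrow> bool" where
  "is_eigenvalue A z \<longleftrightarrow> (\<exists>u\<in>eigenspace A z. \<not> ae_eq u (\<lambda>_. 0))"

text \<open>The relation \<open>u = (A - z)\<^sup>-\<^sup>1 f\<close>, as a set of pairs \<open>(f, u)\<close>.\<close>

definition inverse_graph :: "operator \<Rightarrow> complex \<Rightarrow> operator" where
  "inverse_graph A z = {(f, u). f \<in> L2 \<and> (\<exists>w. (u, w) \<in> A \<and> ae_eq (\<lambda>x. w x - z * u x) f)}"

definition resolvent_set :: "operator \<Rightarrow> complex set" where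
  "resolvent_set A = {z.
     (\<forall>f\<in>L2. \<exists>u. (f, u) \<in> inverse_graph A z) \<and>
     (\<forall>f u u'. (f, u) \<in> inverse_graph A z \<and> (f, u') \<in> inverse_graph A z \<longrightarrow> ae_eq u u') \<and>
     (\<exists>C. \<forall>(f, u)\<in>inverse_graph A z. L2_norm u \<le> C * L2_norm f)}"

text \<open>Continuity off the singular set determines the kernel at every point of
  \<open>regular_pairs\<close>; its values elsewhere are irrelevant.\<close>

definition regular_pairs :: "(R3 \<times> R3) set" where
  "regular_pairs = {(x, y). x \<noteq> 0 \<and> y \<noteq> 0 \<and> x \<noteq> y}"

definition is_resolvent_kernel :: "operator \<Rightarrow> complex \<Rightarrow> (R3 \<Rightarrow> R3 \<Rightarrow> complex) \<Rightarrow> bool" where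
  "is_resolvent_kernel A z k \<longleftrightarrow>
     continuous_on regular_pairs (\<lambda>(x, y). k x y) \<and>
     (\<forall>(f, u)\<in>inverse_graph A z. AE x in lborel.
        integrable lborel (\<lambda>y. k x y * f y) \<and> u x = (LINT y|lborel. k x y * f y))"

definition resolvent_kernel :: "operator \<Rightarrow> complex \<Rightarrow> R3 \<Rightarrow> R3 \<Rightarrow> complex" where
  "resolvent_kernel A z = (SOME k. is_resolvent_kernel A z k)"

section \<open>The point interactions\<close>

definition L_min :: operator where
  "L_min = {(\<phi>, \<lambda>x. - (\<Sum>i\<in>UNIV. partial i (partial i \<phi>) x)) | \<phi>. \<phi> \<in> test_functions (- {0})}"

text \<open>\<open>\<theta>\<close> is the cut-off function. The value of \<open>\<phi>' \<in> W\<^sup>2\<^sup>,\<^sup>2\<close> at the origin is that of its continuous representative.\<close>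

definition dom_L :: "(R3 \<Rightarrow> complex) \<Rightarrow> real \<Rightarrow> (R3 \<Rightarrow> complex) set" where
  "dom_L \<theta> \<mu> = {u \<in> L2. \<exists>\<beta> \<phi>'. \<phi>' \<in> W22 \<and> continuous_on UNIV \<phi>' \<and> \<phi>' 0 = 0 \<and>
     ae_eq u (\<lambda>x. \<theta> x * \<beta> * of_real (1 / norm x + \<mu>) + \<phi>' x)}"

definition L_op :: "(R3 \<Rightarrow> complex) \<Rightarrow> real \<Rightarrow> operator" where
  "L_op \<theta> \<mu> = {(u, w) \<in> adjoint L_min. u \<in> dom_L \<theta> \<mu>}"

definition K :: "(R3 \<Rightarrow> complex) \<Rightarrow> real \<Rightarrow> complex \<Rightarrow> R3 \<Rightarrow> R3 \<Rightarrow> complex" where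
  "K \<theta> \<mu> \<kappa> = resolvent_kernel (L_op \<theta> \<mu>) (\<kappa>\<^sup>2)"

definition K_continuation ::
  "(R3 \<Rightarrow> complex) \<Rightarrow> real \<Rightarrow> R3 \<Rightarrow> R3 \<Rightarrow> (complex \<Rightarrow> complex) \<Rightarrow> bool" where
  "K_continuation \<theta> \<mu> x y F \<longleftrightarrow> F meromorphic_on UNIV \<and>
     (\<forall>\<kappa>. Im \<kappa> > 0 \<and> \<kappa>\<^sup>2 \<in> resolvent_set (L_op \<theta> \<mu>) \<longrightarrow> F \<kappa> = K \<theta> \<mu> \<kappa> x y)"

definition is_resonance :: "(R3 \<Rightarrow> complex) \<Rightarrow> real \<Rightarrow> complex \<Rightarrow> bool" where
  "is_resonance \<theta> \<mu> \<kappa> \<longleftrightarrow> Im \<kappa> \<le> 0 \<and>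
     (\<exists>(x, y)\<in>regular_pairs. \<exists>F. K_continuation \<theta> \<mu> x y F \<and> is_pole F \<kappa>)"

definition v :: "real \<Rightarrow> R3 \<Rightarrow> complex" where
  "v \<mu> x = of_real (exp (\<mu> * norm x) / norm x)"

end

theory Submission
  imports Defs
begin

text \<open>
  Write \<open>e\<^sub>\<kappa>(x) = exp(\<i>\<kappa>|x|)/|x|\<close>, so that \<open>(- \<Delta> - \<kappa>\<^sup>2) e\<^sub>\<kappa>\<close> is a multiple of the delta function at the origin. A function
  in the domain of \<open>L\<^sup>\<mu>\<close> with singular coefficient \<open>\<beta>\<close> satisfies \<open>(- \<Delta> - \<kappa>\<^sup>2) u = f + c \<beta> \<delta>\<^sub>0\<close> on all of
  \<open>\<real>\<^sup>3\<close>, where \<open>f = (L\<^sup>\<mu> - \<kappa>\<^sup>2) u\<close>. If \<open>f = 0\<close> and \<open>Im \<kappa> \<ge> 0\<close>, testing with cut-off outgoing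
  waves gives \<open>u = \<beta> e\<^sub>\<kappa>\<close>; this is square integrable only for \<open>Im \<kappa> > 0\<close>, and the boundary
  condition at the origin then forces \<open>\<i> \<kappa> = \<mu>\<close>. For \<open>Im \<kappa> > 0\<close> and \<open>\<i> \<kappa> \<noteq> \<mu>\<close>, adding a multiple of \<open>e\<^sub>\<kappa>\<close> to the
  free resolvent so as to meet the boundary condition yields the kernel
  \<open>e\<^sub>\<kappa>(x - y)/4\<pi> + e\<^sub>\<kappa>(x) e\<^sub>\<kappa>(y)/(4\<pi>(\<mu> - \<i>\<kappa>))\<close>, which is meromorphic in \<open>\<kappa>\<close> with the single pole \<open>-\<i>\<mu>\<close>.
  That the free resolvent maps into \<open>W\<^sup>2\<^sup>,\<^sup>2\<close> follows from \<open>\<Sum>\<^sub>i\<^sub>j \<parallel>\<partial>\<^sub>i \<partial>\<^sub>j h\<parallel>\<^sup>2 = \<parallel>\<Delta> h\<parallel>\<^sup>2\<close> and the density of test functions.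
  All test functions needed (cut-offs and mollifiers) are built from the given \<open>\<theta>\<close>.
\<close>

section \<open>Calculus of smooth functions\<close>

text \<open>Every complex number is \<open>\<kappa>\<^sup>2\<close> with
  \<open>Im \<kappa> \<ge> 0\<close>, so the single uniqueness lemma
  \<open>helmholtz_point_source_unique\<close> covers the whole plane: it yields the eigenfunctions,
  the injectivity behind the resolvent set and, with coefficient 0, the regularity of
  \<open>outgoing \<kappa> x - singular_part \<mu> x\<close>. The delicate points are those of [0,
  \<infinity>): there the outgoing wave decays only like 1/|x| and lies outside L2, so it can be
  used only locally. Two further obstacles come from the definitions. The boundary condition speaks
  of a value at the origin, while all equations hold almost everywhere; the value is recovered as a
  limit, because potentials of L2 functions are continuous. And \<open>K\<close> is an arbitrary
  choice among kernels, while a continuation is an arbitrary meromorphic function prescribed on part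
  of the half-plane; the explicit formula determines them only through the uniqueness of continuous
  kernels off the singular set and the identity theorem.\<close>

definition laplacian :: "(R3 \<Rightarrow> complex) \<Rightarrow> R3 \<Rightarrow> complex" where
  "laplacian f x = (\<Sum>i\<in>UNIV. partial i (partial i f) x)"

section \<open>Directional derivatives and closure properties of smooth functions\<close>

lemma partials_Nil [simp]: "partials [] f = f"
  and partials_Cons [simp]: "partials (i # is) f = partial i (partials is f)"
  and partials_append: "partials (is @ js) f = partials is (partials js f)"
  by (simp_all add: partials_def)

text \<open>Smoothness quantifies over all iterated partials, so it suffices to exhibit a class of
  differentiable functions that is closed under \<open>partial\<close>. The closure lemmas below
  take for \<open>S\<close> the functions of the shape in question.\<close>

lemma smooth_coinduct:
  assumes "f \<in> S" and "\<And>f x. f \<in> S \<Longrightarrow> f differentiable (at x)" and "\<And>f i. f \<in> S \<Longrightarrow> partial i f \<in> S"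
  shows "smooth f"
proof -
  have "partials is f \<in> S" for "is"
    by (induction "is") (auto simp: assms(1,3))
  then show ?thesis
    using assms(2) by (auto simp: smooth_def)
qed

lemma smooth_partials: "smooth f \<Longrightarrow> smooth (partials is f)"
  unfolding smooth_def partials_append[symmetric] by blast

lemma smooth_partial: "smooth f \<Longrightarrow> smooth (partial i f)"
  using smooth_partials[of f "[i]"] by simp

lemma smooth_differentiable: "smooth f \<Longrightarrow> f differentiable (at x)"
  unfolding smooth_def using partials_Nil by metis

lemma partial_eqI:
  "((\<lambda>t. f (x + t *\<^sub>R axis i 1)) has_vector_derivative d) (at 0) \<Longrightarrow> partial i f x = d"
  unfolding partial_def by (rule vector_derivative_at)

lemma has_derivative_line:
  assumes "(f has_derivative D) (at (x + s *\<^sub>R e))"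
  shows "((\<lambda>t. f (x + t *\<^sub>R e)) has_vector_derivative D e) (at s)"
proof -
  have "((\<lambda>t. x + t *\<^sub>R e) has_derivative (\<lambda>t. t *\<^sub>R e)) (at s)"
    by (auto intro!: derivative_eq_intros)
  then have "(f \<circ> (\<lambda>t. x + t *\<^sub>R e) has_derivative D \<circ> (\<lambda>t. t *\<^sub>R e)) (at s)"
    by (rule diff_chain_at) (use assms in simp)
  moreover have "linear D"
    using assms has_derivative_linear by blast
  ultimately show ?thesis
    by (simp add: has_vector_derivative_def o_def linear_cmul)
qed

lemma partial_frechet: "(f has_derivative D) (at x) \<Longrightarrow> partial i f x = D (axis i 1)"
  by (rule partial_eqI, rule has_derivative_line) simp

lemma partial_line:
  assumes "f differentiable (at (x + s *\<^sub>R axis i 1))"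
  shows "((\<lambda>t. f (x + t *\<^sub>R axis i 1)) has_vector_derivative partial i f (x + s *\<^sub>R axis i 1)) (at s)"
  using assms has_derivative_line partial_frechet unfolding differentiable_def by metis

lemma partial_line0:
  assumes "f differentiable (at x)"
  shows "((\<lambda>t. f (x + t *\<^sub>R axis i 1)) has_vector_derivative partial i f x) (at 0)"
  using partial_line[of f x 0 i] assms by simp

lemma vec3_expansion: "h = (\<Sum>i\<in>UNIV. (h $ i) *\<^sub>R axis i 1)" for h :: R3
  using basis_expansion[of h] by (simp add: scalar_mult_eq_scaleR)

text \<open>The derivative exists by assumption and is linear, so its values on the coordinate axes
  determine it.\<close>

lemma differentiable_has_derivative:
  fixes f :: "R3 \<Rightarrow> complex"
  assumes "f differentiable (at x)"
  shows "(f has_derivative (\<lambda>h. \<Sum>i\<in>UNIV. (h $ i) *\<^sub>R partial i f x)) (at x)"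
proof -
  obtain D where D: "(f has_derivative D) (at x)"
    using assms unfolding differentiable_def by blast
  then have lin: "linear D"
    using has_derivative_linear by blast
  have "D h = (\<Sum>i\<in>UNIV. (h $ i) *\<^sub>R partial i f x)" for h
    by (subst vec3_expansion[of h]) (simp add: linear_sum[OF lin] linear_cmul[OF lin] partial_frechet[OF D])
  then have "D = (\<lambda>h. \<Sum>i\<in>UNIV. (h $ i) *\<^sub>R partial i f x)"
    by blast
  then show ?thesis
    using D by simp
qed

lemma smooth_continuous_on: "smooth f \<Longrightarrow> continuous_on A f"
  by (meson continuous_at_imp_continuous_on differentiable_imp_continuous_within smooth_differentiable)

lemma smooth_measurable: "smooth f \<Longrightarrow> f \<in> borel_measurable borel"
  by (rule borel_measurable_continuous_onI, rule smooth_continuous_on)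

lemma partial_add:
  assumes "f differentiable (at x)" and "g differentiable (at x)"
  shows "partial i (\<lambda>x. f x + g x) x = partial i f x + partial i g x"
  by (rule partial_eqI) (auto intro!: has_vector_derivative_add partial_line0 assms)

lemma partial_mult:
  assumes "f differentiable (at x)" and "g differentiable (at x)"
  shows "partial i (\<lambda>x. f x * g x) x = f x * partial i g x + partial i f x * g x"
  using has_vector_derivative_mult[OF partial_line0[OF assms(1)] partial_line0[OF assms(2)], of i i]
  by (intro partial_eqI) simp

lemma partial_cnj:
  assumes "f differentiable (at x)"
  shows "partial i (\<lambda>x. cnj (f x)) x = cnj (partial i f x)"
  by (rule partial_eqI) (auto intro!: has_vector_derivative_cnj partial_line0 assms)

lemma differentiable_affine:
  fixes f :: "R3 \<Rightarrow> complex" and a :: R3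
  assumes "f differentiable (at (c *\<^sub>R x + a))"
  shows "(\<lambda>x. f (c *\<^sub>R x + a)) differentiable (at x)"
    and "partial i (\<lambda>x. f (c *\<^sub>R x + a)) x = c *\<^sub>R partial i f (c *\<^sub>R x + a)"
proof -
  obtain D where D: "(f has_derivative D) (at (c *\<^sub>R x + a))"
    using assms unfolding differentiable_def by blast
  have "((\<lambda>x. c *\<^sub>R x + a) has_derivative (\<lambda>h. c *\<^sub>R h)) (at x)"
    by (auto intro!: derivative_eq_intros)
  from diff_chain_at[OF this D]
  have *: "((\<lambda>x. f (c *\<^sub>R x + a)) has_derivative (\<lambda>h. D (c *\<^sub>R h))) (at x)"
    by (simp add: o_def)
  then show "(\<lambda>x. f (c *\<^sub>R x + a)) differentiable (at x)"
    by (auto simp: differentiable_def)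
  show "partial i (\<lambda>x. f (c *\<^sub>R x + a)) x = c *\<^sub>R partial i f (c *\<^sub>R x + a)"
    using partial_frechet[OF *] partial_frechet[OF D] linear_cmul[OF has_derivative_linear[OF D]] by simp
qed

lemma partial_const [simp]: "partial i (\<lambda>_. c) = (\<lambda>_. 0)"
  by (rule ext, rule partial_eqI) simp

lemma smooth_const: "smooth (\<lambda>_. c)"
  by (rule smooth_coinduct[of _ "range (\<lambda>c _. c)"]) auto

lemma smooth_add:
  assumes "smooth f" and "smooth g" shows "smooth (\<lambda>x. f x + g x)"
proof (rule smooth_coinduct[of _ "{\<lambda>x. f x + g x | f g. smooth f \<and> smooth g}"])
  fix h i assume "h \<in> {\<lambda>x. f x + g x | f g. smooth f \<and> smooth g}"
  then obtain f g where h: "h = (\<lambda>x. f x + g x)" and fg: "smooth f" "smooth g"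
    by blast
  have "partial i h = (\<lambda>x. partial i f x + partial i g x)"
    unfolding h by (intro ext partial_add smooth_differentiable fg)
  then show "partial i h \<in> {\<lambda>x. f x + g x | f g. smooth f \<and> smooth g}"
    using fg smooth_partial by blast
next
  fix h x assume "h \<in> {\<lambda>x. f x + g x | f g. smooth f \<and> smooth g}"
  then obtain f g where h: "h = (\<lambda>x. f x + g x)" and fg: "smooth f" "smooth g"
    by blast
  show "h differentiable at x"
    unfolding h by (intro differentiable_add smooth_differentiable fg)
qed (use assms in auto)

text \<open>The product rule turns one product into a sum of two, so single products are not closed
  under \<open>partial\<close>; finite sums of products are.\<close>

inductive_set smooth_products :: "(R3 \<Rightarrow> complex) set" where
  prod: "smooth f \<Longrightarrow> smooth g \<Longrightarrow> (\<lambda>x. f x * g x) \<in> smooth_products"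
| sum: "a \<in> smooth_products \<Longrightarrow> b \<in> smooth_products \<Longrightarrow> (\<lambda>x. a x + b x) \<in> smooth_products"

lemma smooth_products_differentiable: "f \<in> smooth_products \<Longrightarrow> f differentiable (at x)"
  by (induction rule: smooth_products.induct)
     (simp_all add: differentiable_add differentiable_mult smooth_differentiable)

lemma smooth_products_partial: "f \<in> smooth_products \<Longrightarrow> partial i f \<in> smooth_products"
proof (induction rule: smooth_products.induct)
  case (prod f g)
  have "partial i (\<lambda>x. f x * g x) = (\<lambda>x. f x * partial i g x + partial i f x * g x)"
    by (intro ext partial_mult smooth_differentiable prod)
  then show ?case
    using prod smooth_products.intros smooth_partial by simp
next
  case (sum a b)
  have "partial i (\<lambda>x. a x + b x) = (\<lambda>x. partial i a x + partial i b x)"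
    by (intro ext partial_add smooth_products_differentiable sum)
  then show ?case
    using sum smooth_products.intros by simp
qed

lemma smooth_mult:
  assumes "smooth f" and "smooth g" shows "smooth (\<lambda>x. f x * g x)"
  by (rule smooth_coinduct[of _ smooth_products])
     (auto intro: assms smooth_products.prod smooth_products_differentiable smooth_products_partial)

lemma smooth_sum:
  "(\<And>i. i \<in> A \<Longrightarrow> smooth (f i)) \<Longrightarrow> smooth (\<lambda>x. \<Sum>i\<in>A. f i x)"
  by (induction A rule: infinite_finite_induct) (simp_all add: smooth_const smooth_add)

lemma smooth_cnj:
  assumes "smooth f" shows "smooth (\<lambda>x. cnj (f x))"
proof (rule smooth_coinduct[of _ "{\<lambda>x. cnj (f x) | f. smooth f}"])
  fix h i assume "h \<in> {\<lambda>x. cnj (f x) | f. smooth f}"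
  then obtain f where h: "h = (\<lambda>x. cnj (f x))" and f: "smooth f"
    by blast
  have "partial i h = (\<lambda>x. cnj (partial i f x))"
    unfolding h by (intro ext partial_cnj smooth_differentiable f)
  then show "partial i h \<in> {\<lambda>x. cnj (f x) | f. smooth f}"
    using f smooth_partial by blast
next
  fix h x assume "h \<in> {\<lambda>x. cnj (f x) | f. smooth f}"
  then obtain f where h: "h = (\<lambda>x. cnj (f x))" and f: "smooth f"
    by blast
  show "h differentiable at x"
    using smooth_differentiable[OF f, of x] has_derivative_cnj unfolding h differentiable_def by blast
qed (use assms in auto)

lemma smooth_affine:
  assumes "smooth f" shows "smooth (\<lambda>x. f (c *\<^sub>R x + a))"
proof (rule smooth_coinduct[of _ "{\<lambda>x. f (c *\<^sub>R x + a) | f. smooth f}"])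
  fix h i assume "h \<in> {\<lambda>x. f (c *\<^sub>R x + a) | f. smooth f}"
  then obtain f where h: "h = (\<lambda>x. f (c *\<^sub>R x + a))" and f: "smooth f"
    by blast
  have "partial i h = (\<lambda>x. of_real c * partial i f (c *\<^sub>R x + a))"
    unfolding h using differentiable_affine(2)[OF smooth_differentiable[OF f]]
    by (simp add: fun_eq_iff flip: scaleR_conv_of_real)
  moreover have "smooth (\<lambda>x. of_real c * partial i f x)"
    by (intro smooth_mult smooth_const smooth_partial f)
  ultimately show "partial i h \<in> {\<lambda>x. f (c *\<^sub>R x + a) | f. smooth f}"
    by (intro CollectI exI[of _ "\<lambda>x. of_real c * partial i f x"]) simp
next
  fix h x assume "h \<in> {\<lambda>x. f (c *\<^sub>R x + a) | f. smooth f}"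
  then obtain f where h: "h = (\<lambda>x. f (c *\<^sub>R x + a))" and f: "smooth f"
    by blast
  show "h differentiable at x"
    unfolding h by (intro differentiable_affine smooth_differentiable f)
qed (use assms in auto)

text \<open>The pointwise rules again, now as equations between functions: in this form they rewrite
  below a further \<open>partial\<close>, as second derivatives require.\<close>

lemma smooth_cmult_partial:
  assumes "smooth f" shows "partial i (\<lambda>x. c * f x) = (\<lambda>x. c * partial i f x)"
  using partial_mult[OF _ smooth_differentiable[OF assms], of "\<lambda>_. c" _ i] by (auto simp: fun_eq_iff)

lemma smooth_add_partial:
  assumes "smooth f" and "smooth g" shows "partial i (\<lambda>x. f x + g x) = (\<lambda>x. partial i f x + partial i g x)"
  by (intro ext partial_add smooth_differentiable assms)

lemma smooth_uminus_partial:
  assumes "smooth f" shows "partial i (\<lambda>x. - f x) = (\<lambda>x. - partial i f x)"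
  using smooth_cmult_partial[OF assms, of i "-1"] by simp

lemma smooth_mult_partial:
  assumes "smooth f" and "smooth g"
  shows "partial i (\<lambda>x. f x * g x) = (\<lambda>x. f x * partial i g x + partial i f x * g x)"
  by (intro ext partial_mult smooth_differentiable assms)

lemma smooth_cnj_partial:
  assumes "smooth f" shows "partial i (\<lambda>x. cnj (f x)) = (\<lambda>x. cnj (partial i f x))"
  by (intro ext partial_cnj smooth_differentiable assms)

lemma smooth_affine_partial:
  assumes "smooth f" shows "partial i (\<lambda>x. f (c *\<^sub>R x + a)) = (\<lambda>x. of_real c * partial i f (c *\<^sub>R x + a))"
  using differentiable_affine(2)[OF smooth_differentiable[OF assms]]
  by (simp add: fun_eq_iff flip: scaleR_conv_of_real)

lemma smooth_laplacian: "smooth f \<Longrightarrow> smooth (laplacian f)"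
  unfolding laplacian_def by (intro smooth_sum smooth_partial)

lemma laplacian_mult:
  assumes "smooth f" and "smooth g"
  shows "laplacian (\<lambda>x. f x * g x) x =
    f x * laplacian g x + 2 * (\<Sum>i\<in>UNIV. partial i f x * partial i g x) + laplacian f x * g x"
  unfolding laplacian_def
  by (simp add: smooth_mult_partial smooth_add_partial assms smooth_partial smooth_mult
      sum.distrib sum_distrib_left sum_distrib_right algebra_simps)

lemma laplacian_cnj: "smooth f \<Longrightarrow> laplacian (\<lambda>x. cnj (f x)) x = cnj (laplacian f x)"
  unfolding laplacian_def by (simp add: smooth_cnj_partial smooth_partial)

section \<open>Locality of derivatives\<close>

lemma partial_cong_open:
  assumes "open U" and "x \<in> U" and "\<And>y. y \<in> U \<Longrightarrow> f y = g y"
  shows "partial i f x = partial i g x"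
proof -
  have "eventually (\<lambda>y. y \<in> U) (nhds x)"
    using assms by (simp add: eventually_nhds_in_open)
  moreover have "filterlim (\<lambda>t::real. x + t *\<^sub>R axis i 1) (nhds x) (nhds 0)"
    by (rule tendsto_eq_intros refl filterlim_ident | simp)+
  ultimately have "eventually (\<lambda>t. x + t *\<^sub>R axis i 1 \<in> U) (nhds (0::real))"
    unfolding filterlim_iff by blast
  then have "eventually (\<lambda>t. f (x + t *\<^sub>R axis i 1) = g (x + t *\<^sub>R axis i 1)) (nhds (0::real))"
    by eventually_elim (simp add: assms)
  then show ?thesis
    unfolding partial_def by (intro vector_derivative_cong_eq) (auto simp: eventually_nhds_conv_at)
qed

lemma partials_cong_open:
  assumes "open U" and "x \<in> U" and "\<And>y. y \<in> U \<Longrightarrow> f y = g y"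
  shows "partials is f x = partials is g x"
  using assms(2)
proof (induction "is" arbitrary: x)
  case (Cons i "is")
  then show ?case
    using partial_cong_open[OF assms(1), of x "partials is f" "partials is g" i] by simp
qed (use assms in simp)

section \<open>Test functions and their supports\<close>

lemma test_function_smooth: "f \<in> test_functions \<Omega> \<Longrightarrow> smooth f"
  by (simp add: test_functions_def)

lemma test_functions_mono: "\<Omega> \<subseteq> \<Omega>' \<Longrightarrow> test_functions \<Omega> \<subseteq> test_functions \<Omega>'"
  by (auto simp: test_functions_def)

lemma test_function_support:
  assumes "f \<in> test_functions \<Omega>"
  obtains R where "R > 0" and "\<And>x. norm x \<ge> R \<Longrightarrow> f x = 0"
proof -
  have "bounded (closure {x. f x \<noteq> 0})"
    using assms by (simp add: test_functions_def compact_imp_bounded)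
  then obtain R where R: "\<And>x. x \<in> closure {x. f x \<noteq> 0} \<Longrightarrow> norm x \<le> R"
    unfolding bounded_iff by blast
  have "f x = 0" if "norm x \<ge> max 1 (R + 1)" for x
  proof (rule ccontr)
    assume "f x \<noteq> 0"
    then have "x \<in> closure {x. f x \<noteq> 0}"
      using closure_subset[of "{x. f x \<noteq> 0}"] by auto
    then show False
      using R[of x] that by simp
  qed
  then show ?thesis
    using that[of "max 1 (R + 1)"] by simp
qed

lemma test_functionI:
  assumes "smooth f" and "\<And>x. norm x \<ge> R \<Longrightarrow> f x = 0"
  shows "f \<in> test_functions UNIV"
proof -
  have "{x. f x \<noteq> 0} \<subseteq> cball 0 R"
    using assms(2) by force
  then have "closure {x. f x \<noteq> 0} \<subseteq> cball 0 R"
    by (simp add: closure_minimal)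
  then show ?thesis
    using assms(1) bounded_subset[OF bounded_cball, of "closure {x. f x \<noteq> 0}" 0 R]
    unfolding test_functions_def compact_eq_bounded_closed by simp
qed

lemma test_functionI0:
  assumes f: "f \<in> test_functions UNIV" and "open U" and "0 \<in> U" and "\<And>x. x \<in> U \<Longrightarrow> f x = 0"
  shows "f \<in> test_functions (- {0})"
proof -
  have "{x. f x \<noteq> 0} \<subseteq> - U"
    using assms(4) by auto
  then have "closure {x. f x \<noteq> 0} \<subseteq> - U"
    using assms(2) by (intro closure_minimal) auto
  then show ?thesis
    using f assms(3) by (auto simp: test_functions_def)
qed

text \<open>The inequality is strict in the conclusion because derivatives are local:
  \<open>f\<close> agrees with 0 in a neighbourhood of \<open>x\<close> only when \<open>x\<close>
  lies in the open exterior of the ball.\<close>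

lemma partials_support:
  assumes "\<And>x. norm x \<ge> R \<Longrightarrow> f x = 0" and "norm x > R"
  shows "partials is f x = 0"
proof -
  have "partials is f x = partials is (\<lambda>_. 0) x"
    by (rule partials_cong_open[of "- cball 0 R"]) (use assms in auto)
  also have "partials is (\<lambda>_. 0) = (\<lambda>_. 0)"
    by (induction "is") auto
  finally show ?thesis by simp
qed

lemma partial_support:
  "(\<And>x. norm x \<ge> R \<Longrightarrow> f x = 0) \<Longrightarrow> norm x > R \<Longrightarrow> partial i f x = 0"
  using partials_support[of R f x "[i]"] by simp

lemma test_function_partials:
  assumes "f \<in> test_functions UNIV" shows "partials is f \<in> test_functions UNIV"
proof -
  obtain R where "\<And>x. norm x \<ge> R \<Longrightarrow> f x = 0"
    using test_function_support[OF assms] by blast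
  \<comment> \<open>Passing to \<open>R + 1\<close> absorbs the strict inequality of
    \<open>partials_support\<close>.\<close>
  then have "\<And>x. norm x \<ge> R + 1 \<Longrightarrow> partials is f x = 0"
    using partials_support[of R f] by fastforce
  then show ?thesis
    using test_functionI[OF smooth_partials[OF test_function_smooth[OF assms]]] by blast
qed

lemma test_function_partial: "f \<in> test_functions UNIV \<Longrightarrow> partial i f \<in> test_functions UNIV"
  using test_function_partials[of f "[i]"] by simp

lemma test_function_bounded:
  assumes "f \<in> test_functions UNIV" obtains B where "B > 0" and "\<And>x. cmod (f x) \<le> B"
proof -
  obtain R where R: "\<And>x. norm x \<ge> R \<Longrightarrow> f x = 0"
    using test_function_support[OF assms] by blast
  have "compact (f ` cball 0 R)"
    by (intro compact_continuous_image smooth_continuous_on test_function_smooth[OF assms]) simp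
  then obtain B where B: "\<And>x. norm x \<le> R \<Longrightarrow> cmod (f x) \<le> B"
    using compact_imp_bounded[of "f ` cball 0 R"] unfolding bounded_iff by fastforce
  have "cmod (f x) \<le> max 1 B" for x
    using B[of x] R[of x] by (cases "norm x \<le> R") auto
  then show ?thesis
    using that[of "max 1 B"] by simp
qed

lemma test_function_mult_smooth:
  assumes "f \<in> test_functions UNIV" and "smooth g"
  shows "(\<lambda>x. f x * g x) \<in> test_functions UNIV"
  using test_function_support[OF assms(1)] test_functionI[OF smooth_mult[OF test_function_smooth[OF assms(1)] assms(2)]]
  by (metis mult_zero_left)

lemma test_function_add:
  assumes "f \<in> test_functions UNIV" and "g \<in> test_functions UNIV"
  shows "(\<lambda>x. f x + g x) \<in> test_functions UNIV"
proof -
  obtain R S where "\<And>x. norm x \<ge> R \<Longrightarrow> f x = 0" "\<And>x. norm x \<ge> S \<Longrightarrow> g x = 0"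
    using test_function_support assms by metis
  then show ?thesis
    by (intro test_functionI[where R="max R S"] smooth_add test_function_smooth[OF assms(1)] test_function_smooth[OF assms(2)]) auto
qed

lemma test_function_cmult: "f \<in> test_functions UNIV \<Longrightarrow> (\<lambda>x. c * f x) \<in> test_functions UNIV"
  using test_function_mult_smooth[of f "\<lambda>_. c"] by (simp add: mult.commute smooth_const)

lemma test_function_sum:
  assumes "finite A" and "\<And>i. i \<in> A \<Longrightarrow> f i \<in> test_functions UNIV"
  shows "(\<lambda>x. \<Sum>i\<in>A. f i x) \<in> test_functions UNIV"
  using assms
proof (induction A rule: finite_induct)
  case empty
  then show ?case
    using test_functionI[of "\<lambda>_. 0" 0] by (simp add: smooth_const)
qed (simp add: test_function_add)

lemma test_function_laplacian: "f \<in> test_functions UNIV \<Longrightarrow> laplacian f \<in> test_functions UNIV"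
  unfolding laplacian_def by (intro test_function_sum test_function_partial) auto

lemma test_function_cnj:
  assumes "f \<in> test_functions \<Omega>" shows "(\<lambda>x. cnj (f x)) \<in> test_functions \<Omega>"
  using assms by (auto simp: test_functions_def smooth_cnj)

lemma test_function_affine:
  assumes "f \<in> test_functions UNIV" and "c \<noteq> 0"
  shows "(\<lambda>x. f (c *\<^sub>R x + a)) \<in> test_functions UNIV"
proof -
  obtain R where R: "\<And>x. norm x \<ge> R \<Longrightarrow> f x = 0"
    using test_function_support[OF assms(1)] by blast
  show ?thesis
  proof (rule test_functionI[where R="(R + norm a) / \<bar>c\<bar>"])
    show "smooth (\<lambda>x. f (c *\<^sub>R x + a))"
      by (intro smooth_affine test_function_smooth[OF assms(1)])
    fix x :: R3 assume "norm x \<ge> (R + norm a) / \<bar>c\<bar>"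
    then have "R + norm a \<le> norm (c *\<^sub>R x)"
      using assms(2) by (simp add: field_simps)
    then show "f (c *\<^sub>R x + a) = 0"
      using norm_triangle_ineq2[of "c *\<^sub>R x" "-a"] by (intro R) simp
  qed
qed

section \<open>Affine substitutions and integration by parts\<close>

lemma integral_lborel_affine:
  fixes f :: "R3 \<Rightarrow> 'b :: {banach, second_countable_topology}"
  assumes c: "c \<noteq> 0" and [measurable]: "f \<in> borel_measurable borel"
  shows "(LINT x|lborel. f x) = \<bar>c\<bar> ^ 3 *\<^sub>R (LINT x|lborel. f (a + c *\<^sub>R x))"
  by (subst lborel_affine[OF c, of a]) (simp add: integral_density integral_distr)

lemma integrable_lborel_affine:
  fixes f :: "R3 \<Rightarrow> 'b :: {banach, second_countable_topology}"
  assumes c: "c \<noteq> 0" and f: "integrable lborel f"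
  shows "integrable lborel (\<lambda>x. f (a + c *\<^sub>R x))"
proof -
  have [measurable]: "f \<in> borel_measurable borel"
    using f by auto
  have "integrable (density (distr lborel borel (\<lambda>x. a + c *\<^sub>R x)) (\<lambda>_. \<bar>c\<bar> ^ 3)) f"
    using f lborel_affine[OF c, of a] by simp
  then have "integrable (distr lborel borel (\<lambda>x. a + c *\<^sub>R x)) (\<lambda>x. \<bar>c\<bar> ^ 3 *\<^sub>R f x)"
    by (subst (asm) integrable_density) auto
  then have "integrable lborel (\<lambda>x. \<bar>c\<bar> ^ 3 *\<^sub>R f (a + c *\<^sub>R x))"
    by (subst (asm) integrable_distr_eq) auto
  then have "integrable lborel (\<lambda>x. inverse (\<bar>c\<bar> ^ 3) *\<^sub>R \<bar>c\<bar> ^ 3 *\<^sub>R f (a + c *\<^sub>R x))"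
    by (rule integrable_scaleR_right)
  then show ?thesis
    using c by simp
qed

lemma integral_lborel_shift:
  fixes f :: "R3 \<Rightarrow> 'b :: {banach, second_countable_topology}"
  assumes "f \<in> borel_measurable borel"
  shows "(LINT x|lborel. f (x + a)) = (LINT x|lborel. f x)"
  using integral_lborel_affine[of 1 f a] assms by (simp add: add.commute)

lemma integral_lborel_reflect:
  fixes f :: "R3 \<Rightarrow> 'b :: {banach, second_countable_topology}"
  assumes "f \<in> borel_measurable borel"
  shows "(LINT x|lborel. f (a - x)) = (LINT x|lborel. f x)"
  using integral_lborel_affine[of "-1" f a] assms by (simp add: add.commute)

lemma integrable_lborel_reflect:
  fixes f :: "R3 \<Rightarrow> 'b :: {banach, second_countable_topology}"
  shows "integrable lborel f \<Longrightarrow> integrable lborel (\<lambda>x. f (a - x))"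
  using integrable_lborel_affine[of "-1" f a] by simp

lemma integrable_indicator_ball: "integrable lborel (\<lambda>x. indicator (ball a r) x :: real)" for a :: R3
  using emeasure_lborel_ball_finite[of a r] by (intro integrable_real_indicator) auto

lemma integrable_bounded_support:
  fixes F :: "R3 \<Rightarrow> complex"
  assumes "F \<in> borel_measurable borel" and "\<And>x. cmod (F x) \<le> B" and "\<And>x. norm x \<ge> R \<Longrightarrow> F x = 0"
  shows "integrable lborel F"
proof (rule Bochner_Integration.integrable_bound)
  show "integrable lborel (\<lambda>x. B * indicator (ball (0::R3) R) x :: real)"
    by (intro integrable_mult_right integrable_indicator_ball)
  show "AE x in lborel. cmod (F x) \<le> norm (B * indicator (ball 0 R) x)"
    using assms(2,3) order_trans[OF norm_ge_zero assms(2)]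
    by (intro AE_I2) (auto simp: indicator_def)
qed (use assms in simp)

text \<open>By translation invariance the difference quotients of \<open>F\<close> have integral zero.\<close>
lemma integral_partial_eq_0:
  fixes F F' :: "R3 \<Rightarrow> complex"
  assumes F: "\<And>x. ((\<lambda>t. F (x + t *\<^sub>R axis i 1)) has_vector_derivative F' x) (at 0)"
    and F': "continuous_on UNIV F'" and cont: "continuous_on UNIV F"
    and supp: "\<And>x. norm x \<ge> R \<Longrightarrow> F x = 0"
  shows "integrable lborel F'" and "(LINT x|lborel. F' x) = 0"
proof -
  define e :: R3 where "e = axis i 1"
  have e: "norm e = 1"
    by (simp add: e_def)
  have [measurable]: "F \<in> borel_measurable borel" "F' \<in> borel_measurable borel"
    by (rule borel_measurable_continuous_onI[OF cont], rule borel_measurable_continuous_onI[OF F'])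
  \<comment> \<open>The hypothesis gives the derivative at parameter 0 only; starting from a
    translated point extends it to the whole line, where the mean value inequality applies.\<close>
  have line: "((\<lambda>t. F (x + t *\<^sub>R e)) has_vector_derivative F' (x + s *\<^sub>R e)) (at s)" for x s
  proof -
    have "((\<lambda>t. F (x + s *\<^sub>R e + t *\<^sub>R e)) has_vector_derivative F' (x + s *\<^sub>R e)) (at (s - s))"
      using F[of "x + s *\<^sub>R e"] by (simp add: e_def)
    from vector_diff_chain_at[of "\<lambda>t. t - s" 1 s, OF _ this]
    show ?thesis
      by (simp add: o_def algebra_simps has_vector_derivative_diff_const)
  qed
  have F'0: "F' x = 0" if "norm x > R" for x
  proof -
    have "F' x = partial i F x"
      using partial_eqI[OF F] by simp
    then show ?thesis
      using partial_support[OF supp] that by simp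
  qed
  have "bounded (F' ` cball 0 R)" "bounded (F ` cball 0 R)"
    by (meson compact_continuous_image compact_cball compact_imp_bounded continuous_on_subset F' cont subset_UNIV)+
  then obtain B0 C0 where B0: "\<And>x. norm x \<le> R \<Longrightarrow> cmod (F' x) \<le> B0"
      and C0: "\<And>x. norm x \<le> R \<Longrightarrow> cmod (F x) \<le> C0"
    unfolding bounded_iff by fastforce
  define B where "B = max B0 0"
  have B: "cmod (F' x) \<le> B" for x
    using B0[of x] F'0[of x] by (cases "norm x \<le> R") (auto simp: B_def)
  have C: "cmod (F x) \<le> max C0 0" for x
    using C0[of x] supp[of x] by (cases "norm x \<le> R") auto
  have int: "integrable lborel F"
    by (rule integrable_bounded_support[where B="max C0 0" and R=R]) (use C supp in auto)
  have Lip: "cmod (F (x + t *\<^sub>R e) - F x) \<le> B * \<bar>t\<bar>" for x t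
  proof -
    have "norm (F (x + t *\<^sub>R e) - F (x + 0 *\<^sub>R e)) \<le> B * norm (t - 0)"
    proof (rule differentiable_bound[of UNIV _ "\<lambda>s h. h *\<^sub>R F' (x + s *\<^sub>R e)"])
      show "onorm (\<lambda>h. h *\<^sub>R F' (x + s *\<^sub>R e)) \<le> B" for s
        using B[of "x + s *\<^sub>R e"] by (intro onorm_bound) (auto simp: B_def mult.commute[of "max B0 0"] intro!: mult_left_mono)
    qed (use line in \<open>auto simp: has_vector_derivative_def\<close>)
    then show ?thesis by simp
  qed
  define \<tau> where "\<tau> n = 1 / real (Suc n)" for n
  have \<tau>: "\<tau> n > 0" "\<tau> n \<le> 1" for n
    by (auto simp: \<tau>_def)
  define g where "g n x = (F (x + \<tau> n *\<^sub>R e) - F x) /\<^sub>R \<tau> n" for n x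
  have [measurable]: "g n \<in> borel_measurable borel" for n
    unfolding g_def by measurable
  have shift: "integrable lborel (\<lambda>x. F (x + a))" for a
    using integrable_lborel_affine[of 1 F a] int by (simp add: add.commute)
  have g0: "(LINT x|lborel. g n x) = 0" for n
    unfolding g_def using shift int by (simp add: integral_lborel_shift)
  \<comment> \<open>The shifts have length at most 1, so beyond radius R + 2 both values in the
    quotient vanish. Inside, the Lipschitz bound makes the quotients uniformly bounded.\<close>
  have gB: "cmod (g n x) \<le> B * indicator (ball 0 (R + 2)) x" for n x
  proof (cases "norm x < R + 2")
    case True
    have "cmod (g n x) = cmod (F (x + \<tau> n *\<^sub>R e) - F x) / \<tau> n"
      using \<tau>[of n] by (simp add: g_def divide_inverse mult.commute)
    also have "\<dots> \<le> B"
      using Lip[of x "\<tau> n"] \<tau>[of n] by (simp add: field_simps)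
    finally show ?thesis
      using True by (simp add: indicator_def)
  next
    case False
    have "norm x - norm (\<tau> n *\<^sub>R e) \<le> norm (x + \<tau> n *\<^sub>R e)"
      by (metis add_diff_cancel norm_triangle_ineq4 diff_le_eq)
    then have "norm (x + \<tau> n *\<^sub>R e) \<ge> R"
      using False e \<tau>[of n] by simp
    then show ?thesis
      using False supp by (simp add: g_def indicator_def)
  qed
  have lim: "(\<lambda>n. g n x) \<longlonglongrightarrow> F' x" for x
  proof -
    have "((\<lambda>t. norm (F (x + t *\<^sub>R e) - F x - t *\<^sub>R F' x) / norm t) \<longlongrightarrow> 0) (at 0)"
      using F[of x] by (simp add: has_vector_derivative_def has_derivative_at flip: e_def)
    then have "((\<lambda>t. norm ((F (x + t *\<^sub>R e) - F x) /\<^sub>R t - F' x)) \<longlongrightarrow> 0) (at 0)"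
    proof (rule Lim_transform_eventually)
      show "\<forall>\<^sub>F t in at 0. norm (F (x + t *\<^sub>R e) - F x - t *\<^sub>R F' x) / norm t
          = norm ((F (x + t *\<^sub>R e) - F x) /\<^sub>R t - F' x)"
      proof (rule eventually_at_ball'[OF zero_less_one, THEN eventually_mono])
        fix t :: real assume "t \<in> ball 0 1 \<and> t \<noteq> 0 \<and> t \<in> UNIV"
        then have "(F (x + t *\<^sub>R e) - F x) /\<^sub>R t - F' x = (F (x + t *\<^sub>R e) - F x - t *\<^sub>R F' x) /\<^sub>R t"
          by (simp add: algebra_simps)
        then show "norm (F (x + t *\<^sub>R e) - F x - t *\<^sub>R F' x) / norm t
            = norm ((F (x + t *\<^sub>R e) - F x) /\<^sub>R t - F' x)"
          by (simp add: divide_inverse mult.commute)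
      qed
    qed
    then have "((\<lambda>t. (F (x + t *\<^sub>R e) - F x) /\<^sub>R t) \<longlongrightarrow> F' x) (at 0)"
      by - (rule LIM_zero_cancel, rule tendsto_norm_zero_cancel)
    moreover have "filterlim \<tau> (at 0) sequentially"
    proof (rule filterlim_atI)
      show "\<tau> \<longlonglongrightarrow> 0"
        using LIMSEQ_inverse_real_of_nat by (simp add: \<tau>_def[abs_def] inverse_eq_divide)
      show "\<forall>\<^sub>F n in sequentially. \<tau> n \<noteq> 0"
        by (intro always_eventually allI) (metis \<tau>(1) less_irrefl)
    qed
    ultimately show ?thesis
      unfolding g_def by (rule filterlim_compose)
  qed
  have w: "integrable lborel (\<lambda>x. B * indicator (ball (0::R3) (R + 2)) x :: real)"
    by (intro integrable_mult_right integrable_indicator_ball)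
  have "(\<lambda>n. LINT x|lborel. g n x) \<longlonglongrightarrow> (LINT x|lborel. F' x)"
    by (rule integral_dominated_convergence[OF _ _ w]) (use lim gB in auto)
  then show "(LINT x|lborel. F' x) = 0"
    by (simp add: g0 LIMSEQ_const_iff)
  show "integrable lborel F'"
    by (rule integrable_dominated_convergence[OF _ _ w, where s=g]) (use lim gB in auto)
qed

lemma continuous_mult_test_integrable:
  assumes h: "continuous_on UNIV h" and \<psi>: "\<psi> \<in> test_functions UNIV"
  shows "integrable lborel (\<lambda>x. h x * \<psi> x)"
proof -
  obtain R where R: "\<And>x. norm x \<ge> R \<Longrightarrow> \<psi> x = 0"
    using test_function_support[OF \<psi>] by blast
  have c: "continuous_on UNIV (\<lambda>x. h x * \<psi> x)"
    by (intro continuous_intros h smooth_continuous_on test_function_smooth[OF \<psi>])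
  have "bounded ((\<lambda>x. h x * \<psi> x) ` cball 0 R)"
    by (intro compact_imp_bounded compact_continuous_image compact_cball continuous_on_subset[OF c subset_UNIV])
  then obtain B where B: "\<And>x. norm x \<le> R \<Longrightarrow> cmod (h x * \<psi> x) \<le> B"
    unfolding bounded_iff by fastforce
  have "cmod (h x * \<psi> x) \<le> max B 0" for x
    using B[of x] R[of x] by (cases "norm x \<le> R") auto
  then show ?thesis
    using R by (intro integrable_bounded_support[where R=R and B="max B 0"] borel_measurable_continuous_onI[OF c]) auto
qed

text \<open>The product \<open>A x * \<phi> x\<close> has compact support, so its derivative
  integrates to zero. Only one continuous directional derivative of \<open>A\<close> enters, which
  lets the lemma be applied to the regularized waves directly.\<close>

lemma integral_by_parts:
  fixes A A' \<phi> :: "R3 \<Rightarrow> complex"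
  assumes A: "\<And>x. ((\<lambda>t. A (x + t *\<^sub>R axis i 1)) has_vector_derivative A' x) (at 0)"
    and A': "continuous_on UNIV A'" and cont: "continuous_on UNIV A"
    and \<phi>: "\<phi> \<in> test_functions UNIV"
  shows "(LINT x|lborel. A x * partial i \<phi> x) = - (LINT x|lborel. A' x * \<phi> x)"
proof -
  obtain R where R: "\<And>x. norm x \<ge> R \<Longrightarrow> \<phi> x = 0"
    using test_function_support[OF \<phi>] by blast
  have sm: "smooth \<phi>" "smooth (partial i \<phi>)"
    using test_function_smooth[OF \<phi>] smooth_partial by blast+
  have c\<phi>: "continuous_on UNIV \<phi>" "continuous_on UNIV (partial i \<phi>)"
    using sm smooth_continuous_on by blast+
  have der: "((\<lambda>t. A (x + t *\<^sub>R axis i 1) * \<phi> (x + t *\<^sub>R axis i 1))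
      has_vector_derivative (A x * partial i \<phi> x + A' x * \<phi> x)) (at 0)" for x
    using has_vector_derivative_mult[OF A[of x] partial_line0[OF smooth_differentiable[OF sm(1)], of x i]] by simp
  have zero: "(LINT x|lborel. A x * partial i \<phi> x + A' x * \<phi> x) = 0"
    by (rule integral_partial_eq_0(2)[where F="\<lambda>x. A x * \<phi> x" and R=R, OF der])
       (use A' cont c\<phi> R in \<open>auto intro!: continuous_intros\<close>)
  show ?thesis
    using zero continuous_mult_test_integrable[OF cont test_function_partial[OF \<phi>]] continuous_mult_test_integrable[OF A' \<phi>]
    by (simp add: eq_neg_iff_add_eq_0)
qed

section \<open>Radial integrals\<close>

text \<open>The half-line up to \<open>a\<close> pulls back to a ball of volume
  \<open>unit_ball_vol 3 * a ^ 3\<close>, and the derivative of this volume is the density.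
  Half-lines form an intersection-stable generator, so comparing the measures on them is
  enough.\<close>

lemma distr_lborel_norm:
  "distr lborel borel (norm :: R3 \<Rightarrow> real) =
    density lborel (\<lambda>r. ennreal (3 * unit_ball_vol 3 * r\<^sup>2 * indicator {0..} r))" (is "?M = ?N")
proof (rule measure_eqI_generator_eq[where E="range atMost" and \<Omega>=UNIV and A="\<lambda>n. {..real n}"])
  show "Int_stable (range (atMost :: real \<Rightarrow> _))"
    unfolding Int_stable_def by (force simp: set_eq_iff image_iff intro: exI[of _ "min _ _"])
  show "sets ?M = sigma_sets UNIV (range atMost)"
    by (subst sets_distr, subst borel_eq_atMost, subst sets_measure_of) auto
  show "sets ?N = sigma_sets UNIV (range atMost)"
    by (subst sets_density, subst sets_lborel, subst borel_eq_atMost, subst sets_measure_of) auto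
  show "(\<Union>n. {..real n}) = UNIV"
    using real_arch_simple by auto
  have M: "emeasure ?M {..a} = ennreal (if a \<ge> 0 then unit_ball_vol 3 * a ^ 3 else 0)" for a :: real
  proof -
    have "emeasure ?M {..a} = emeasure lborel (cball (0 :: R3) a)"
      by (subst emeasure_distr) (auto intro!: arg_cong[where f="emeasure lborel"])
    then show ?thesis
      by (simp add: emeasure_cball)
  qed
  then show "emeasure ?M {..real n} \<noteq> \<infinity>" for n
    by simp
  fix X :: "real set" assume "X \<in> range atMost"
  then obtain a where X: "X = {..a}" by blast
  show "emeasure ?M X = emeasure ?N X"
  proof (cases "a \<ge> 0")
    case True
    have "emeasure ?N X = (\<integral>\<^sup>+r. ennreal (3 * unit_ball_vol 3 * r\<^sup>2) * indicator {0..a} r \<partial>lborel)"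
      unfolding X by (subst emeasure_density) (auto intro!: nn_integral_cong simp: indicator_def)
    also have "\<dots> = ennreal (unit_ball_vol 3 * a ^ 3 - unit_ball_vol 3 * 0 ^ 3)"
      using True by (intro nn_integral_FTC_Icc[where F="\<lambda>r. unit_ball_vol 3 * r ^ 3"])
        (auto intro!: derivative_eq_intros mult_nonneg_nonneg)
    finally show ?thesis
      using M[of a] True X by simp
  next
    case False
    have "emeasure ?N X = (\<integral>\<^sup>+r. 0 \<partial>(lborel :: real measure))"
      unfolding X using False
      by (subst emeasure_density, simp, simp, intro nn_integral_cong) (auto split: split_indicator)
    then show ?thesis
      using M[of a] False X by simp
  qed
qed auto

lemma integrable_radial_iff:
  fixes h :: "real \<Rightarrow> real"
  assumes [measurable]: "h \<in> borel_measurable borel"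
  shows "integrable lborel (\<lambda>x :: R3. h (norm x)) \<longleftrightarrow> integrable lborel (\<lambda>r. indicator {0..} r * (r\<^sup>2 * h r))"
proof -
  have c: "3 * unit_ball_vol 3 \<noteq> (0 :: real)"
    using unit_ball_vol_pos[of "3 :: real"] by linarith
  have "integrable lborel (\<lambda>x :: R3. h (norm x)) \<longleftrightarrow> integrable (distr lborel borel (norm :: R3 \<Rightarrow> real)) h"
    by (subst integrable_distr_eq) auto
  also have "\<dots> \<longleftrightarrow> integrable lborel (\<lambda>r. (3 * unit_ball_vol 3 * r\<^sup>2 * indicator {0..} r) *\<^sub>R h r)"
    unfolding distr_lborel_norm by (subst integrable_density) (auto intro!: mult_nonneg_nonneg)
  also have "\<dots> \<longleftrightarrow> integrable lborel (\<lambda>r. (3 * unit_ball_vol 3) * (indicator {0..} r * (r\<^sup>2 * h r)))"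
    by (simp add: mult_ac)
  also have "\<dots> \<longleftrightarrow> integrable lborel (\<lambda>r. indicator {0..} r * (r\<^sup>2 * h r))"
    by (simp only: integrable_mult_left_iff integrable_mult_right_iff c simp_thms)
  finally show ?thesis .
qed

text \<open>The factor \<open>r\<^sup>2\<close> is the Jacobian of polar coordinates. It annihilates
  whatever value \<open>h\<close> takes at 0, so at that point only the sign of \<open>k\<close>
  matters.\<close>

lemma integrable_radialI:
  fixes h k :: "real \<Rightarrow> real"
  assumes "h \<in> borel_measurable borel" and k: "integrable lborel (\<lambda>r. k r * indicator {0..} r)"
    and bound: "\<And>r. r > 0 \<Longrightarrow> \<bar>r\<^sup>2 * h r\<bar> \<le> k r" and "0 \<le> k 0"
  shows "integrable lborel (\<lambda>x :: R3. h (norm x))"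
proof -
  note [measurable] = assms(1)
  have *: "\<bar>r\<^sup>2 * h r\<bar> \<le> k r" if "r \<ge> 0" for r
    using bound[of r] assms(4) that by (cases "r = 0") auto
  have "integrable lborel (\<lambda>r. indicator {0..} r * (r\<^sup>2 * h r))"
  proof (rule Bochner_Integration.integrable_bound[OF k])
    show "AE r in lborel. norm (indicator {0..} r * (r\<^sup>2 * h r)) \<le> norm (k r * indicator {0..} r)"
      using * by (intro AE_I2) (force simp: indicator_def)
  qed measurable
  then show ?thesis
    by (simp add: integrable_radial_iff)
qed

lemma integrable_const_Icc: "integrable lborel (\<lambda>r. c * indicator {a..b} r)" for a b c :: real
  using borel_integrable_compact[of "{a..b}" "\<lambda>_. c"] by (simp add: mult.commute)

lemma integrable_const_Icc': "integrable lborel (\<lambda>r. c * indicator {0..b} r * indicator {0..} r)" for b c :: real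
proof -
  have "(\<lambda>r. c * indicator {0..b} r * indicator {0..} r) = (\<lambda>r. c * indicator {0..b} r)"
    by (auto simp: indicator_def)
  then show ?thesis
    using integrable_const_Icc by metis
qed

lemma integrable_FTC_atLeast:
  fixes f F :: "real \<Rightarrow> real"
  assumes "f \<in> borel_measurable borel" and "\<And>x. a \<le> x \<Longrightarrow> DERIV F x :> f x"
    and "\<And>x. a \<le> x \<Longrightarrow> 0 \<le> f x" and "(F \<longlongrightarrow> T) at_top"
  shows "integrable lborel (\<lambda>x. f x * indicator {a..} x)"
proof (rule integrableI_nonneg)
  have "(\<integral>\<^sup>+x. ennreal (f x * indicator {a..} x) \<partial>lborel) = (\<integral>\<^sup>+x. ennreal (f x) * indicator {a..} x \<partial>lborel)"
    by (intro nn_integral_cong) (simp split: split_indicator)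
  also have "\<dots> < \<infinity>"
    using nn_integral_FTC_atLeast[OF assms] by simp
  finally show "(\<integral>\<^sup>+x. ennreal (f x * indicator {a..} x) \<partial>lborel) < \<infinity>" .
  show "AE x in lborel. 0 \<le> f x * indicator {a..} x"
    using assms(3) by (simp split: split_indicator)
qed (use assms(1) in measurable)

lemma integrable_exp_neg:
  assumes "b > (0 :: real)" shows "integrable lborel (\<lambda>r. exp (- b * r) * indicator {0..} r)"
proof (rule integrable_FTC_atLeast[where F="\<lambda>r. - exp (- b * r) / b"])
  have "filterlim (\<lambda>r. - b * r) at_bot at_top"
    using assms by (intro filterlim_tendsto_neg_mult_at_bot[OF tendsto_const] filterlim_ident) auto
  then have "((\<lambda>r. exp (- b * r)) \<longlongrightarrow> 0) at_top"
    by (rule filterlim_compose[OF exp_at_bot])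
  then have "((\<lambda>r. - exp (- b * r) / b) \<longlongrightarrow> - 0 / b) at_top"
    using assms by (intro tendsto_intros) auto
  then show "((\<lambda>r. - exp (- b * r) / b) \<longlongrightarrow> 0) at_top"
    by simp
  show "DERIV (\<lambda>r. - exp (- b * r) / b) x :> exp (- b * x)" for x
    using assms by (auto intro!: derivative_eq_intros)
qed auto

lemma integrable_inverse_square_plus:
  "integrable lborel (\<lambda>r :: real. 1 / (1 + r\<^sup>2) * indicator {0..} r)"
proof (rule integrable_FTC_atLeast[where F=arctan, OF _ _ _ tendsto_arctan_at_top])
  show "DERIV arctan x :> 1 / (1 + x\<^sup>2)" for x :: real
    using DERIV_arctan[of x] by (simp add: divide_inverse)
qed auto

lemma integrable_inverse_norm_square_ball:
  "integrable lborel (\<lambda>x :: R3. indicator {..R} (norm x) / (norm x)\<^sup>2)"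
proof (rule integrable_radialI[where h="\<lambda>r. indicator {..R} r / r\<^sup>2"])
  show "integrable lborel (\<lambda>r. 1 * indicator {0..R} r * indicator {0..} r :: real)"
    by (rule integrable_const_Icc')
  fix r :: real assume "r > 0"
  then show "\<bar>r\<^sup>2 * (indicator {..R} r / r\<^sup>2)\<bar> \<le> 1 * indicator {0..R} r"
    by (cases "r \<le> R") auto
qed auto

lemma integrable_inverse_norm_ball:
  "integrable lborel (\<lambda>x :: R3. indicator {..R} (norm x) / norm x)"
proof (rule integrable_radialI[where h="\<lambda>r. indicator {..R} r / r"])
  show "integrable lborel (\<lambda>r. \<bar>R\<bar> * indicator {0..R} r * indicator {0..} r)"
    by (rule integrable_const_Icc')
  fix r :: real assume "r > 0"
  then show "\<bar>r\<^sup>2 * (indicator {..R} r / r)\<bar> \<le> \<bar>R\<bar> * indicator {0..R} r"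
    by (cases "r \<le> R") (auto simp: power2_eq_square)
qed auto

lemma integrable_exp_norm_square:
  assumes "b > 0" shows "integrable lborel (\<lambda>x :: R3. (exp (- b * norm x) / norm x)\<^sup>2)"
  by (rule integrable_radialI[where k="\<lambda>r. exp (- (2 * b) * r)" and h="\<lambda>r. (exp (- b * r) / r)\<^sup>2"])
     (use integrable_exp_neg[of "2 * b"] assms in
      \<open>auto simp: power_divide power2_eq_square mult_exp_exp algebra_simps\<close>)

text \<open>The Jacobian leaves one factor r, which half of the exponential decay absorbs: r is at
  most 2/b times exp(b r/2).\<close>

lemma integrable_exp_norm:
  assumes "b > 0" shows "integrable lborel (\<lambda>x :: R3. exp (- b * norm x) / norm x)"
proof (rule integrable_radialI[where k="\<lambda>r. 2 / b * exp (- (b / 2) * r)" and h="\<lambda>r. exp (- b * r) / r"])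
  have "integrable lborel (\<lambda>r. 2 / b * (exp (- (b / 2) * r) * indicator {0..} r))"
    by (intro integrable_mult_right integrable_exp_neg) (use assms in simp)
  then show "integrable lborel (\<lambda>r. 2 / b * exp (- (b / 2) * r) * indicator {0..} r)"
    by (simp add: mult.assoc)
  fix r :: real assume r: "r > 0"
  have "b / 2 * r \<le> exp (b / 2 * r)"
    using exp_ge_add_one_self[of "b / 2 * r"] by linarith
  then have "r \<le> 2 / b * exp (b / 2 * r)"
    using assms by (simp add: field_simps)
  then have "r * exp (- b * r) \<le> 2 / b * exp (b / 2 * r) * exp (- b * r)"
    by (intro mult_right_mono) auto
  also have "\<dots> = 2 / b * exp (- (b / 2) * r)"
    by (simp add: mult.assoc mult_exp_exp)
  finally show "\<bar>r\<^sup>2 * (exp (- b * r) / r)\<bar> \<le> 2 / b * exp (- (b / 2) * r)"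
    using r by (simp add: power2_eq_square abs_mult)
qed (use assms in auto)

text \<open>Majorant both for the rescaled wave defect and for the integrand of
  \<open>delta_mass\<close>.\<close>

lemma integrable_inverse_quartic: "integrable lborel (\<lambda>x :: R3. 1 / (1 + (norm x)\<^sup>2)\<^sup>2)"
proof (rule integrable_radialI[where k="\<lambda>r. 1 / (1 + r\<^sup>2)" and h="\<lambda>r. 1 / (1 + r\<^sup>2)\<^sup>2"])
  fix r :: real
  have "r\<^sup>2 / (1 + r\<^sup>2)\<^sup>2 \<le> (1 + r\<^sup>2) / (1 + r\<^sup>2)\<^sup>2"
    by (intro divide_right_mono) auto
  also have "\<dots> = 1 / (1 + r\<^sup>2)"
    by (simp add: power2_eq_square)
  finally show "\<bar>r\<^sup>2 * (1 / (1 + r\<^sup>2)\<^sup>2)\<bar> \<le> 1 / (1 + r\<^sup>2)"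
    by simp
qed (use integrable_inverse_square_plus in auto)

text \<open>In polar coordinates the integrand becomes constant on the half-line. Through
  \<open>outgoing_not_L2\<close> this excludes eigenfunctions for real \<kappa>.\<close>

lemma not_integrable_inverse_norm_square: "\<not> integrable lborel (\<lambda>x :: R3. 1 / (norm x)\<^sup>2)"
proof
  assume "integrable lborel (\<lambda>x :: R3. 1 / (norm x)\<^sup>2)"
  then have I: "integrable lborel (\<lambda>r :: real. indicator {0..} r * (r\<^sup>2 * (1 / r\<^sup>2)) :: real)"
    by (subst (asm) integrable_radial_iff[of "\<lambda>r. 1 / r\<^sup>2"]) auto
  \<comment> \<open>At r = 0 the expression is 0 by the convention for division by zero, hence the
    passage to the open half-line, up to a null set.\<close>
  then have "integrable lborel (\<lambda>r :: real. indicator {0<..} r :: real)"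
    by (rule integrable_cong_AE_imp)
       (auto intro!: AE_I[of _ _ "{0}"] simp: indicator_def)
  then have "emeasure lborel {0::real<..} < \<infinity>"
    by (simp add: integrable_indicator_iff)
  moreover have "emeasure lborel {0::real<..} \<ge> ennreal (real n)" for n
  proof -
    have "ennreal (real n) = emeasure lborel {0<..real n}" by simp
    also have "\<dots> \<le> emeasure lborel {0::real<..}"
      by (intro emeasure_mono) auto
    finally show ?thesis .
  qed
  moreover obtain n where "emeasure lborel {0::real<..} < of_nat n"
    using ennreal_Ex_less_of_nat \<open>emeasure lborel {0::real<..} < \<infinity>\<close> by fastforce
  ultimately show False
    by (metis ennreal_of_nat_eq_real_of_nat linorder_not_less)
qed

section \<open>Square integrable functions\<close>

text \<open>Squared norms keep the estimates free of square roots; the role of the triangle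
  inequality is taken by \<open>sqnorm_add_le\<close>, at the price of a factor 2 on each
  term.\<close>

definition sqnorm :: "(R3 \<Rightarrow> complex) \<Rightarrow> real" where
  "sqnorm f = (LINT x|lborel. (cmod (f x))\<^sup>2)"

lemma L2D:
  assumes "f \<in> L2"
  shows "f \<in> borel_measurable borel" and "integrable lborel (\<lambda>x. (cmod (f x))\<^sup>2)"
  using assms by (auto simp: L2_def)

lemma L2I: "f \<in> borel_measurable borel \<Longrightarrow> integrable lborel (\<lambda>x. (cmod (f x))\<^sup>2) \<Longrightarrow> f \<in> L2"
  by (simp add: L2_def)

lemma L2_bound:
  assumes "g \<in> L2" and "f \<in> borel_measurable borel" and "AE x in lborel. cmod (f x) \<le> C * cmod (g x)"
  shows "f \<in> L2"
proof (rule L2I)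
  have "integrable lborel (\<lambda>x. C\<^sup>2 * (cmod (g x))\<^sup>2)"
    using L2D[OF assms(1)] by simp
  then show "integrable lborel (\<lambda>x. (cmod (f x))\<^sup>2)"
  proof (rule Bochner_Integration.integrable_bound)
    show "AE x in lborel. norm ((cmod (f x))\<^sup>2) \<le> norm (C\<^sup>2 * (cmod (g x))\<^sup>2)"
      using assms(3)
    proof eventually_elim
      case (elim x)
      then have "(cmod (f x))\<^sup>2 \<le> (C * cmod (g x))\<^sup>2"
        by (intro power_mono) auto
      then show ?case
        by (simp add: power_mult_distrib)
    qed
  qed (use assms in measurable)
qed (use assms in auto)

lemma sum_square_le: "(cmod (a + b))\<^sup>2 \<le> 2 * (cmod a)\<^sup>2 + 2 * (cmod b)\<^sup>2"
proof -
  have "(cmod (a + b))\<^sup>2 \<le> (cmod a + cmod b)\<^sup>2"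
    by (intro power_mono norm_triangle_ineq) auto
  also have "\<dots> \<le> 2 * (cmod a)\<^sup>2 + 2 * (cmod b)\<^sup>2"
    using zero_le_power2[of "cmod a - cmod b"] by (simp add: power2_eq_square algebra_simps)
  finally show ?thesis .
qed

lemma
  assumes f: "f \<in> L2" and g: "g \<in> L2"
  shows L2_add: "(\<lambda>x. f x + g x) \<in> L2"
    and sqnorm_add_le: "sqnorm (\<lambda>x. f x + g x) \<le> 2 * sqnorm f + 2 * sqnorm g"
proof -
  note [measurable] = L2D(1)[OF f] L2D(1)[OF g] and [simp] = L2D(2)[OF f] L2D(2)[OF g]
  have int: "integrable lborel (\<lambda>x. 2 * (cmod (f x))\<^sup>2 + 2 * (cmod (g x))\<^sup>2)"
    by simp
  have int': "integrable lborel (\<lambda>x. (cmod (f x + g x))\<^sup>2)"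
    by (rule Bochner_Integration.integrable_bound[OF int]) (auto simp: sum_square_le)
  then show "(\<lambda>x. f x + g x) \<in> L2"
    by (intro L2I) auto
  have "sqnorm (\<lambda>x. f x + g x) \<le> (LINT x|lborel. 2 * (cmod (f x))\<^sup>2 + 2 * (cmod (g x))\<^sup>2)"
    unfolding sqnorm_def by (intro integral_mono int int') (simp add: sum_square_le)
  then show "sqnorm (\<lambda>x. f x + g x) \<le> 2 * sqnorm f + 2 * sqnorm g"
    by (simp add: sqnorm_def)
qed

lemma
  assumes f: "f \<in> L2"
  shows L2_cmult: "(\<lambda>x. c * f x) \<in> L2"
    and sqnorm_cmult: "sqnorm (\<lambda>x. c * f x) = (cmod c)\<^sup>2 * sqnorm f"
proof -
  show "(\<lambda>x. c * f x) \<in> L2"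
    by (rule L2_bound[OF f, where C="cmod c"]) (use L2D[OF f] in \<open>auto simp: norm_mult\<close>)
  show "sqnorm (\<lambda>x. c * f x) = (cmod c)\<^sup>2 * sqnorm f"
    by (simp add: sqnorm_def norm_mult power_mult_distrib)
qed

lemma L2_zero: "(\<lambda>_. 0) \<in> L2"
  by (auto simp: L2_def)

lemma L2_uminus: "f \<in> L2 \<Longrightarrow> (\<lambda>x. - f x) \<in> L2"
  using L2_cmult[of f "-1"] by simp

lemma L2_diff: "f \<in> L2 \<Longrightarrow> g \<in> L2 \<Longrightarrow> (\<lambda>x. f x - g x) \<in> L2"
  using L2_add[of f "\<lambda>x. - g x"] L2_uminus[of g] by simp

lemma measurable_cnj [measurable]: "cnj \<in> borel_measurable borel"
  by (intro borel_measurable_continuous_onI continuous_intros)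

lemma L2_cnj: "f \<in> L2 \<Longrightarrow> (\<lambda>x. cnj (f x)) \<in> L2"
  using L2D[of f] by (intro L2I) auto

lemma sqnorm_nonneg: "sqnorm f \<ge> 0"
  by (simp add: sqnorm_def)

lemma sqnorm_diff_commute: "sqnorm (\<lambda>x. f x - g x) = sqnorm (\<lambda>x. g x - f x)"
  by (simp add: sqnorm_def norm_minus_commute)

lemma L2_mult_integrable:
  assumes f: "f \<in> L2" and g: "g \<in> L2"
  shows "integrable lborel (\<lambda>x. f x * g x)" and "integrable lborel (\<lambda>x. cmod (f x) * cmod (g x))"
proof -
  note [measurable] = L2D(1)[OF f] L2D(1)[OF g] and [simp] = L2D(2)[OF f] L2D(2)[OF g]
  have int: "integrable lborel (\<lambda>x. (cmod (f x))\<^sup>2 + (cmod (g x))\<^sup>2)"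
    by simp
  have le: "a * b \<le> a\<^sup>2 + b\<^sup>2" for a b :: real
    using zero_le_power2[of "a - b"] zero_le_power2[of a] zero_le_power2[of b]
    unfolding power2_diff by linarith
  show "integrable lborel (\<lambda>x. f x * g x)"
    by (rule Bochner_Integration.integrable_bound[OF int]) (auto simp: norm_mult le)
  then show "integrable lborel (\<lambda>x. cmod (f x) * cmod (g x))"
    using integrable_norm by (fastforce simp: norm_mult)
qed

lemma L2_cauchy_schwarz:
  assumes f: "f \<in> L2" and g: "g \<in> L2"
  shows "(LINT x|lborel. cmod (f x) * cmod (g x))\<^sup>2 \<le> sqnorm f * sqnorm g"
proof -
  note [measurable] = L2D(1)[OF f] L2D(1)[OF g] and int = L2D(2)[OF f] L2D(2)[OF g]
  have "(\<integral>\<^sup>+x. ennreal (cmod (f x)) * ennreal (cmod (g x)) \<partial>lborel)\<^sup>2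
      \<le> (\<integral>\<^sup>+x. (ennreal (cmod (f x)))\<^sup>2 \<partial>lborel) * (\<integral>\<^sup>+x. (ennreal (cmod (g x)))\<^sup>2 \<partial>lborel)"
    by (rule Cauchy_Schwarz_nn_integral) measurable
  also have "(\<integral>\<^sup>+x. (ennreal (cmod (f x)))\<^sup>2 \<partial>lborel) = ennreal (sqnorm f)"
    unfolding sqnorm_def by (subst nn_integral_eq_integral[symmetric]) (use int in \<open>auto simp: ennreal_power\<close>)
  also have "(\<integral>\<^sup>+x. (ennreal (cmod (g x)))\<^sup>2 \<partial>lborel) = ennreal (sqnorm g)"
    unfolding sqnorm_def by (subst nn_integral_eq_integral[symmetric]) (use int in \<open>auto simp: ennreal_power\<close>)
  also have "(\<integral>\<^sup>+x. ennreal (cmod (f x)) * ennreal (cmod (g x)) \<partial>lborel)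
      = ennreal (LINT x|lborel. cmod (f x) * cmod (g x))"
    by (subst nn_integral_eq_integral[symmetric]) (use L2_mult_integrable(2)[OF f g] in \<open>auto simp: ennreal_mult\<close>)
  finally have "ennreal ((LINT x|lborel. cmod (f x) * cmod (g x))\<^sup>2) \<le> ennreal (sqnorm f * sqnorm g)"
    by (simp add: ennreal_power ennreal_mult sqnorm_nonneg)
  then show ?thesis
    by (simp add: sqnorm_nonneg)
qed

lemma L2_cauchy_schwarz_norm:
  assumes f: "f \<in> L2" and g: "g \<in> L2"
  shows "(cmod (LINT x|lborel. f x * g x))\<^sup>2 \<le> sqnorm f * sqnorm g"
proof -
  have "cmod (LINT x|lborel. f x * g x) \<le> (LINT x|lborel. cmod (f x * g x))"
    by (rule integral_norm_bound)
  also have "\<dots> = (LINT x|lborel. cmod (f x) * cmod (g x))"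
    by (simp add: norm_mult)
  finally have "(cmod (LINT x|lborel. f x * g x))\<^sup>2 \<le> (LINT x|lborel. cmod (f x) * cmod (g x))\<^sup>2"
    by (intro power_mono) auto
  then show ?thesis
    using L2_cauchy_schwarz[OF f g] by linarith
qed

lemma L2_integral_tendsto:
  assumes f: "\<And>n. f n \<in> L2" "f' \<in> L2" and g: "g \<in> L2"
    and lim: "(\<lambda>n. sqnorm (\<lambda>x. f n x - f' x)) \<longlonglongrightarrow> 0"
  shows "(\<lambda>n. LINT x|lborel. f n x * g x) \<longlonglongrightarrow> (LINT x|lborel. f' x * g x)"
proof -
  have "(\<lambda>n. sqnorm (\<lambda>x. f n x - f' x) * sqnorm g) \<longlonglongrightarrow> 0 * sqnorm g"
    by (intro tendsto_intros lim)
  then have lim0: "(\<lambda>n. sqnorm (\<lambda>x. f n x - f' x) * sqnorm g) \<longlonglongrightarrow> 0"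
    by simp
  have "(\<lambda>n. (cmod ((LINT x|lborel. f n x * g x) - (LINT x|lborel. f' x * g x)))\<^sup>2) \<longlonglongrightarrow> 0"
  proof (rule Lim_null_comparison[OF always_eventually[OF allI] lim0])
    fix n
    have "(LINT x|lborel. f n x * g x) - (LINT x|lborel. f' x * g x) = (LINT x|lborel. (f n x - f' x) * g x)"
      using L2_mult_integrable(1)[OF f(1) g] L2_mult_integrable(1)[OF f(2) g] by (simp add: left_diff_distrib)
    then show "norm ((cmod ((LINT x|lborel. f n x * g x) - (LINT x|lborel. f' x * g x)))\<^sup>2)
        \<le> sqnorm (\<lambda>x. f n x - f' x) * sqnorm g"
      using L2_cauchy_schwarz_norm[OF L2_diff[OF f(1)[of n] f(2)] g] by simp
  qed
  then have "(\<lambda>n. cmod ((LINT x|lborel. f n x * g x) - (LINT x|lborel. f' x * g x))) \<longlonglongrightarrow> 0"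
    using tendsto_real_sqrt by fastforce
  then show ?thesis
    using tendsto_norm_zero_iff LIM_zero_iff by blast
qed

lemma ae_eq_L2: "f \<in> L2 \<Longrightarrow> ae_eq f g \<Longrightarrow> g \<in> borel_measurable borel \<Longrightarrow> g \<in> L2"
  by (rule L2_bound[where C=1]) (auto simp: ae_eq_def)

lemma ae_eq_refl: "ae_eq f f"
  and ae_eq_sym: "ae_eq f g \<Longrightarrow> ae_eq g f"
  and ae_eq_trans: "ae_eq f g \<Longrightarrow> ae_eq g h \<Longrightarrow> ae_eq f h"
  unfolding ae_eq_def by auto

lemma test_function_integrable: "f \<in> test_functions UNIV \<Longrightarrow> integrable lborel f"
  by (metis integrable_bounded_support smooth_measurable test_function_bounded test_function_smooth test_function_support)

lemma test_function_L2:
  assumes "f \<in> test_functions UNIV" shows "f \<in> L2"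
proof (rule L2I)
  have "integrable lborel (\<lambda>x. f x * f x)"
    by (intro test_function_integrable test_function_mult_smooth test_function_smooth[OF assms] assms)
  from integrable_norm[OF this] show "integrable lborel (\<lambda>x. (cmod (f x))\<^sup>2)"
    by (simp add: norm_mult power2_eq_square)
qed (use assms smooth_measurable test_function_smooth in blast)

section \<open>Locally integrable functions and convolution\<close>

definition locally_integrable :: "(R3 \<Rightarrow> complex) \<Rightarrow> bool" where
  "locally_integrable g \<longleftrightarrow> g \<in> borel_measurable borel \<and> (\<forall>R. integrable lborel (\<lambda>x. indicator (ball 0 R) x *\<^sub>R g x))"

definition conv :: "(R3 \<Rightarrow> complex) \<Rightarrow> (R3 \<Rightarrow> complex) \<Rightarrow> R3 \<Rightarrow> complex" where
  "conv g \<phi> x = (LINT y|lborel. g y * \<phi> (x - y))"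

lemma locally_integrable_mult_bounded:
  assumes g: "locally_integrable g" and [measurable]: "\<phi> \<in> borel_measurable borel"
    and B: "\<And>x. cmod (\<phi> x) \<le> B" and R: "\<And>x. norm x \<ge> R \<Longrightarrow> \<phi> x = 0"
  shows "integrable lborel (\<lambda>x. g x * \<phi> x)"
proof -
  have [measurable]: "g \<in> borel_measurable borel"
    using g by (simp add: locally_integrable_def)
  have "integrable lborel (\<lambda>x. B * cmod (indicator (ball 0 R) x *\<^sub>R g x))"
    using g by (intro integrable_mult_right integrable_norm) (simp add: locally_integrable_def)
  then show ?thesis
  proof (rule Bochner_Integration.integrable_bound)
    have "0 \<le> B"
      using order_trans[OF norm_ge_zero B] by blast
    then have "cmod (g x * \<phi> x) \<le> norm (B * cmod (indicator (ball 0 R) x *\<^sub>R g x))" for x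
      using B[of x] R[of x] by (cases "norm x < R") (auto simp: norm_mult mult.commute intro: mult_right_mono)
    then show "AE x in lborel. cmod (g x * \<phi> x) \<le> norm (B * cmod (indicator (ball 0 R) x *\<^sub>R g x))"
      by blast
  qed measurable
qed

lemma locally_integrable_mult_test:
  assumes "locally_integrable g" and "\<phi> \<in> test_functions UNIV"
  shows "integrable lborel (\<lambda>x. g x * \<phi> x)"
proof -
  obtain R where "\<And>x. norm x \<ge> R \<Longrightarrow> \<phi> x = 0"
    using test_function_support[OF assms(2)] by blast
  moreover obtain B where "\<And>x. cmod (\<phi> x) \<le> B"
    using test_function_bounded[OF assms(2)] by blast
  ultimately show ?thesis
    by (intro locally_integrable_mult_bounded[OF assms(1)] smooth_measurable test_function_smooth[OF assms(2)])
qed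

lemma test_function_reflect:
  assumes "\<phi> \<in> test_functions UNIV" shows "(\<lambda>y. \<phi> (x - y)) \<in> test_functions UNIV"
  using test_function_affine[OF assms, of "-1" x] by simp

lemma conv_integrable:
  assumes "locally_integrable g" and "\<phi> \<in> test_functions UNIV"
  shows "integrable lborel (\<lambda>y. g y * \<phi> (x - y))"
  by (intro locally_integrable_mult_test test_function_reflect assms)

text \<open>Differentiation under the integral, with every derivative falling on \<phi> because
  \<open>g\<close> is merely locally integrable. The total derivative is produced at once, since
  \<open>smooth\<close> asks for differentiability at every order and not just for partials.\<close>

lemma conv_has_derivative:
  assumes g: "locally_integrable g" and \<phi>: "\<phi> \<in> test_functions UNIV"
  shows "(conv g \<phi> has_derivative (\<lambda>h. \<Sum>i\<in>UNIV. (h $ i) *\<^sub>R conv g (partial i \<phi>) x)) (at x)"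
proof -
  have [measurable]: "g \<in> borel_measurable borel"
    using g by (simp add: locally_integrable_def)
  have sm: "smooth \<phi>" and smp: "smooth (partial i \<phi>)" for i
    using test_function_smooth[OF \<phi>] smooth_partial by blast+
  have [measurable]: "\<phi> \<in> borel_measurable borel" "partial i \<phi> \<in> borel_measurable borel" for i
    using sm smp smooth_measurable by blast+
  obtain R where R: "\<And>x. norm x \<ge> R \<Longrightarrow> \<phi> x = 0"
    using test_function_support[OF \<phi>] by blast
  have "\<forall>i. \<exists>B. \<forall>x. cmod (partial i \<phi> x) \<le> B"
    using test_function_bounded[OF test_function_partial[OF \<phi>]] by metis
  then obtain b where b: "\<And>i x. cmod (partial i \<phi> x) \<le> b i"
    by metis
  define L where "L = (\<Sum>i\<in>UNIV. b i)"
  define D where "D z h = (\<Sum>i\<in>UNIV. (h $ i) *\<^sub>R partial i \<phi> z)" for z h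
  have D: "(\<phi> has_derivative D z) (at z)" for z
    unfolding D_def[abs_def] by (rule differentiable_has_derivative[OF smooth_differentiable[OF sm]])
  have Dle: "cmod (D z h) \<le> L * norm h" for z h
  proof -
    have "cmod (D z h) \<le> (\<Sum>i\<in>UNIV. \<bar>h $ i\<bar> * cmod (partial i \<phi> z))"
      unfolding D_def by (rule order_trans[OF norm_sum]) simp
    also have "\<dots> \<le> (\<Sum>i\<in>UNIV. norm h * b i)"
      by (intro sum_mono mult_mono component_le_norm_cart b) auto
    finally show ?thesis
      by (simp add: L_def sum_distrib_left mult.commute)
  qed
  have Lip: "cmod (\<phi> (z + h) - \<phi> z) \<le> L * norm h" for z h
  proof -
    have "norm (\<phi> (z + h) - \<phi> z) \<le> L * norm (z + h - z)"
      by (rule differentiable_bound[of UNIV]) (use D Dle in \<open>auto intro!: onorm_bound onorm_le\<close>)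
    then show ?thesis by simp
  qed
  have cD: "conv g \<phi> (x + h) - conv g \<phi> x - (\<Sum>i\<in>UNIV. (h $ i) *\<^sub>R conv g (partial i \<phi>) x)
      = (LINT y|lborel. g y * (\<phi> (x + h - y) - \<phi> (x - y) - D (x - y) h))" for h
  proof -
    have "integrable lborel (\<lambda>y. (h $ i) *\<^sub>R (g y * partial i \<phi> (x - y)))" for i
      by (intro integrable_scaleR_right conv_integrable[OF g] test_function_partial[OF \<phi>])
    then show ?thesis
      unfolding conv_def D_def right_diff_distrib sum_distrib_left mult_scaleR_right
      using conv_integrable[OF g \<phi>] by (simp add: Bochner_Integration.integral_diff Bochner_Integration.integrable_diff)
  qed
  \<comment> \<open>The limit is tested along arbitrary sequences tending to 0, which puts it into
    the form of dominated convergence.\<close>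
  have "(\<lambda>h. norm (conv g \<phi> (x + h) - conv g \<phi> x - (\<Sum>i\<in>UNIV. (h $ i) *\<^sub>R conv g (partial i \<phi>) x)) / norm h) \<midarrow>0\<rightarrow> 0"
    unfolding tendsto_at_iff_sequentially
  proof (intro allI impI)
    fix X :: "nat \<Rightarrow> R3" assume X: "\<forall>n. X n \<in> UNIV - {0}" and X0: "X \<longlonglongrightarrow> 0"
    obtain M where M: "\<And>n. norm (X n) \<le> M"
      using Bseq_def convergent_def convergent_imp_Bseq X0 by metis
    define s where "s n y = g y * ((\<phi> (x + X n - y) - \<phi> (x - y) - D (x - y) (X n)) /\<^sub>R norm (X n))" for n y
    \<comment> \<open>One \<open>L\<close> bounds the increment and one the linear part. Outside the
      ball both \<open>x - y\<close> and \<open>x + X n - y\<close> have norm larger than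
      \<open>R\<close>, the summand 1 making the inequality strict, so the integrand vanishes
      there.\<close>
    define w where "w y = 2 * L * cmod (indicator (ball 0 (R + norm x + M + 1)) y *\<^sub>R g y)" for y
    have L0: "L \<ge> 0"
      using order_trans[OF norm_ge_zero b] by (auto simp: L_def intro: sum_nonneg)
    have w: "integrable lborel w"
      unfolding w_def using g by (intro integrable_mult_right integrable_norm) (simp add: locally_integrable_def)
    have bnd: "cmod (s n y) \<le> w y" for n y
    proof (cases "norm y < R + norm x + M + 1")
      case True
      have "cmod (\<phi> (x + X n - y) - \<phi> (x - y) - D (x - y) (X n)) \<le> L * norm (X n) + L * norm (X n)"
        using norm_triangle_le_diff[OF add_mono[OF Lip[of "x - y" "X n"] Dle[of "x - y" "X n"]]]
        by (simp add: algebra_simps)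
      then have "cmod ((\<phi> (x + X n - y) - \<phi> (x - y) - D (x - y) (X n)) /\<^sub>R norm (X n)) \<le> 2 * L"
        using X by (simp add: inverse_eq_divide pos_divide_le_eq mult_ac flip: mult_2)
      then have "cmod (s n y) \<le> cmod (g y) * (2 * L)"
        unfolding s_def norm_mult by (intro mult_left_mono) auto
      then show ?thesis
        using True by (simp add: w_def mult.commute)
    next
      case False
      have 1: "norm (x - y) > R"
        using False norm_triangle_ineq2[of y x] order_trans[OF norm_ge_zero M[of n]] by (simp add: norm_minus_commute)
      have 2: "norm (x + X n - y) > R"
        using False norm_triangle_ineq2[of y "x + X n"] norm_triangle_ineq[of x "X n"] M[of n] by (simp add: norm_minus_commute)
      have "D (x - y) (X n) = 0"
        unfolding D_def using partial_support[OF R 1] by simp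
      then show ?thesis
        using 1 2 R L0 by (simp add: s_def w_def)
    qed
    have lim: "(\<lambda>n. s n y) \<longlonglongrightarrow> 0" for y
    proof -
      have "(\<lambda>h. norm (\<phi> (x - y + h) - \<phi> (x - y) - D (x - y) h) / norm h) \<midarrow>0\<rightarrow> 0"
        using D[of "x - y"] by (simp add: has_derivative_at)
      then have "(\<lambda>n. norm (\<phi> (x - y + X n) - \<phi> (x - y) - D (x - y) (X n)) / norm (X n)) \<longlonglongrightarrow> 0"
        using X X0 unfolding tendsto_at_iff_sequentially o_def by blast
      then have "(\<lambda>n. cmod (g y) * (norm (\<phi> (x - y + X n) - \<phi> (x - y) - D (x - y) (X n)) / norm (X n))) \<longlonglongrightarrow> cmod (g y) * 0"
        by (intro tendsto_intros)
      then have "(\<lambda>n. norm (s n y)) \<longlonglongrightarrow> 0"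
        by (simp add: s_def norm_mult divide_inverse diff_add_eq mult_ac)
      then show ?thesis
        by (rule tendsto_norm_zero_cancel)
    qed
    have [measurable]: "s n \<in> borel_measurable borel" for n
      unfolding s_def D_def by measurable
    have "(\<lambda>n. LINT y|lborel. s n y) \<longlonglongrightarrow> (LINT y|(lborel :: R3 measure). 0)"
      by (rule integral_dominated_convergence[OF _ _ w]) (use lim bnd in auto)
    then have "(\<lambda>n. norm (LINT y|lborel. s n y)) \<longlonglongrightarrow> 0"
      by (simp add: tendsto_norm_zero)
    moreover have "norm (LINT y|lborel. s n y) = norm (LINT y|lborel. g y * (\<phi> (x + X n - y) - \<phi> (x - y) - D (x - y) (X n))) / norm (X n)" for n
      unfolding s_def mult_scaleR_right by (simp add: divide_inverse mult.commute)
    ultimately show "((\<lambda>h. norm (conv g \<phi> (x + h) - conv g \<phi> x - (\<Sum>i\<in>UNIV. (h $ i) *\<^sub>R conv g (partial i \<phi>) x)) / norm h) \<circ> X) \<longlonglongrightarrow> 0"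
      by (simp add: cD o_def)
  qed
  then show ?thesis
    unfolding has_derivative_at
    by (auto intro!: bounded_linear_sum bounded_linear_scaleR_const bounded_linear_vec_nth)
qed

lemma partial_conv:
  assumes "locally_integrable g" and "\<phi> \<in> test_functions UNIV"
  shows "partial i (conv g \<phi>) = conv g (partial i \<phi>)"
proof
  fix x
  have "(\<Sum>j\<in>UNIV. (axis i (1 :: real) $ j) *\<^sub>R conv g (partial j \<phi>) x) = (\<Sum>j\<in>UNIV. if j = i then conv g (partial j \<phi>) x else 0)"
    by (intro sum.cong) (auto simp: axis_def)
  then show "partial i (conv g \<phi>) x = conv g (partial i \<phi>) x"
    using partial_frechet[OF conv_has_derivative[OF assms, of x], of i] by simp
qed

lemma smooth_conv:
  assumes "locally_integrable g" and "\<phi> \<in> test_functions UNIV"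
  shows "smooth (conv g \<phi>)"
proof (rule smooth_coinduct[of _ "conv g ` test_functions UNIV"])
  fix f x assume "f \<in> conv g ` test_functions UNIV"
  then show "f differentiable (at x)"
    using conv_has_derivative[OF assms(1)] unfolding differentiable_def by blast
next
  fix f i assume "f \<in> conv g ` test_functions UNIV"
  then show "partial i f \<in> conv g ` test_functions UNIV"
    using partial_conv[OF assms(1)] test_function_partial by blast
qed (use assms in blast)

lemma laplacian_conv:
  assumes "locally_integrable g" and "\<phi> \<in> test_functions UNIV"
  shows "laplacian (conv g \<phi>) x = conv g (laplacian \<phi>) x"
proof -
  have "laplacian (conv g \<phi>) x = (\<Sum>i\<in>UNIV. conv g (partial i (partial i \<phi>)) x)"
    unfolding laplacian_def by (simp add: partial_conv assms test_function_partial)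
  also have "\<dots> = conv g (laplacian \<phi>) x"
    unfolding laplacian_def conv_def sum_distrib_left
    by (subst Bochner_Integration.integral_sum) (auto intro!: conv_integrable assms test_function_partial)
  finally show ?thesis .
qed

section \<open>The fundamental solution\<close>

text \<open>The function written with the letter e in the overview. At the origin it has the value 0
  by the convention for division by zero.\<close>

definition outgoing :: "complex \<Rightarrow> R3 \<Rightarrow> complex" where
  "outgoing \<kappa> x = exp (\<i> * \<kappa> * of_real (norm x)) / of_real (norm x)"

text \<open>The value is \<open>4 \<pi>\<close>, but only its positivity matters: it cancels in the resolvent.\<close>
definition delta_mass :: real where
  "delta_mass = 3 * (LINT x|(lborel :: R3 measure). 1 / sqrt (1 + (norm x)\<^sup>2) ^ 5)"

text \<open>A positive smoothing of the norm. Composed with it, the wave has no singularity and can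
  be integrated by parts classically; the norm returns in the limit \<delta> = 0.\<close>

definition regdist :: "real \<Rightarrow> R3 \<Rightarrow> real" where
  "regdist \<delta> x = sqrt ((norm x)\<^sup>2 + \<delta>\<^sup>2)"

lemma regdist_pos: "\<delta> > 0 \<Longrightarrow> regdist \<delta> x > 0"
  unfolding regdist_def by (intro real_sqrt_gt_zero add_nonneg_pos) auto

lemma regdist_ge: "norm x \<le> regdist \<delta> x"
  unfolding regdist_def by (rule real_le_rsqrt) simp

lemma regdist_le: "\<delta> \<ge> 0 \<Longrightarrow> regdist \<delta> x \<le> norm x + \<delta>"
  unfolding regdist_def by (rule real_le_lsqrt) (auto simp: power2_sum)

lemma regdist_square: "(regdist \<delta> x)\<^sup>2 = (norm x)\<^sup>2 + \<delta>\<^sup>2"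
  by (simp add: regdist_def)

lemma continuous_regdist [continuous_intros]: "continuous_on A (regdist \<delta>)"
  unfolding regdist_def by (intro continuous_intros)

lemma measurable_regdist [measurable]: "regdist \<delta> \<in> borel_measurable borel"
  by (rule borel_measurable_continuous_onI[OF continuous_regdist])

lemma measurable_outgoing [measurable]: "outgoing \<kappa> \<in> borel_measurable borel"
  unfolding outgoing_def by measurable

lemma regdist_line:
  assumes "\<delta> > 0"
  shows "((\<lambda>t. regdist \<delta> (x + t *\<^sub>R axis i 1)) has_vector_derivative (x $ i / regdist \<delta> x)) (at 0)"
proof -
  have eq: "(norm (x + t *\<^sub>R axis i 1))\<^sup>2 = (norm x)\<^sup>2 + 2 * t * (x $ i) + t\<^sup>2" for t
  proof -
    have "inner (x + t *\<^sub>R axis i 1) (x + t *\<^sub>R axis i 1) = inner x x + 2 * t * inner x (axis i 1) + t * t * inner (axis i 1) (axis i (1 :: real))"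
      by (simp only: inner_add_left inner_add_right inner_scaleR_left inner_scaleR_right inner_commute[of "axis i 1" x])
        (simp add: algebra_simps)
    also have "inner x (axis i 1) = x $ i"
      by (simp add: inner_axis)
    also have "inner (axis i 1) (axis i (1 :: real) :: R3) = 1"
      by (simp add: inner_axis_axis)
    finally show ?thesis
      unfolding power2_norm_eq_inner[symmetric] by (simp only: power2_eq_square[of t] mult_1_right)
  qed
  have "(norm x)\<^sup>2 + \<delta>\<^sup>2 > 0"
    using assms by (intro add_nonneg_pos) auto
  then have "DERIV sqrt ((norm x)\<^sup>2 + 2 * 0 * (x $ i) + 0\<^sup>2 + \<delta>\<^sup>2) :> inverse (regdist \<delta> x) / 2"
    using DERIV_real_sqrt[of "(norm x)\<^sup>2 + \<delta>\<^sup>2"] by (simp add: regdist_def)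
  moreover have "((\<lambda>t. (norm x)\<^sup>2 + 2 * t * (x $ i) + t\<^sup>2 + \<delta>\<^sup>2) has_real_derivative (2 * (x $ i))) (at 0)"
    by (auto intro!: derivative_eq_intros)
  ultimately have "((\<lambda>t. sqrt ((norm x)\<^sup>2 + 2 * t * (x $ i) + t\<^sup>2 + \<delta>\<^sup>2)) has_real_derivative
      (inverse (regdist \<delta> x) / 2 * (2 * (x $ i)))) (at 0)"
    by (rule DERIV_chain2)
  moreover have "inverse (regdist \<delta> x) / 2 * (2 * (x $ i)) = x $ i / regdist \<delta> x"
    by (simp add: field_simps)
  ultimately show ?thesis
    by (simp add: has_real_derivative_iff_has_vector_derivative regdist_def eq)
qed

lemma radial_line:
  fixes F :: "real \<Rightarrow> complex"
  assumes "\<delta> > 0" and "(F has_vector_derivative F') (at (regdist \<delta> x))"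
  shows "((\<lambda>t. F (regdist \<delta> (x + t *\<^sub>R axis i 1))) has_vector_derivative (x $ i / regdist \<delta> x) *\<^sub>R F') (at 0)"
  using vector_diff_chain_at[OF regdist_line[OF assms(1)], of F F' x i] assms(2) by (simp add: o_def)

section \<open>Regularized waves and their limit\<close>

context
  fixes \<kappa> :: complex
begin

definition wave :: "real \<Rightarrow> complex" where
  "wave s = exp (\<i> * \<kappa> * of_real s) / of_real s"

text \<open>\<open>wave1 s\<close> is \<open>wave' s / s\<close> and \<open>wave2\<close> is the derivative of \<open>wave1\<close>, so that differentiating \<open>wave \<circ> regdist \<delta>\<close>
  along axis \<open>i\<close> gives \<open>x\<^sub>i wave1\<close> and then \<open>wave1 + x\<^sub>i\<^sup>2 wave2 / regdist \<delta> x\<close>.\<close>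
definition wave1 :: "real \<Rightarrow> complex" where
  "wave1 s = exp (\<i> * \<kappa> * of_real s) * (\<i> * \<kappa> / of_real s ^ 2 - 1 / of_real s ^ 3)"

definition wave2 :: "real \<Rightarrow> complex" where
  "wave2 s = exp (\<i> * \<kappa> * of_real s) * (- \<kappa>\<^sup>2 / of_real s ^ 2 - 3 * \<i> * \<kappa> / of_real s ^ 3 + 3 / of_real s ^ 4)"

lemma wave_derivative:
  assumes "s > 0" shows "(wave has_vector_derivative (s *\<^sub>R wave1 s)) (at s)"
  unfolding wave_def[abs_def] wave1_def
  by (rule has_vector_derivative_real_field)
     (use assms in \<open>auto intro!: derivative_eq_intros simp: field_simps power2_eq_square power3_eq_cube scaleR_conv_of_real\<close>)

lemma wave1_derivative:
  assumes "s > 0" shows "(wave1 has_vector_derivative (wave2 s)) (at s)"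
  unfolding wave1_def[abs_def] wave2_def
  by (rule has_vector_derivative_real_field)
     (use assms in \<open>auto intro!: derivative_eq_intros simp: field_simps power2_eq_square power3_eq_cube power4_eq_xxxx\<close>)

text \<open>The result of applying \<open>\<Delta> + \<kappa>\<^sup>2\<close> to \<open>wave \<circ> regdist \<delta>\<close>: an approximate delta function as \<open>\<delta> \<rightarrow> 0\<close>.\<close>
definition wave_defect :: "real \<Rightarrow> real \<Rightarrow> complex" where
  "wave_defect \<delta> s = of_real (\<delta>\<^sup>2) * exp (\<i> * \<kappa> * of_real s)
     * (\<kappa>\<^sup>2 / of_real s ^ 3 + 3 * \<i> * \<kappa> / of_real s ^ 4 - 3 / of_real s ^ 5)"

lemma continuous_wave:
  "continuous_on {0<..} wave" "continuous_on {0<..} wave1" "continuous_on {0<..} wave2"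
  unfolding wave_def[abs_def] wave1_def[abs_def] wave2_def[abs_def]
  by (auto intro!: continuous_intros)

lemma continuous_wave_regdist:
  assumes "\<delta> > 0"
  shows "continuous_on A (\<lambda>x. wave (regdist \<delta> x))" "continuous_on A (\<lambda>x. wave1 (regdist \<delta> x))"
    "continuous_on A (\<lambda>x. wave2 (regdist \<delta> x))"
  by (rule continuous_on_compose2[OF continuous_wave(1) continuous_regdist]
      continuous_on_compose2[OF continuous_wave(2) continuous_regdist]
      continuous_on_compose2[OF continuous_wave(3) continuous_regdist]; use regdist_pos[OF assms] in auto)+

lemma wave_regdist_parts:
  assumes \<delta>: "\<delta> > 0" and \<phi>: "\<phi> \<in> test_functions UNIV"
  shows "(LINT x|lborel. wave (regdist \<delta> x) * partial i \<phi> x)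
    = - (LINT x|lborel. (of_real (x $ i) * wave1 (regdist \<delta> x)) * \<phi> x)"
proof (rule integral_by_parts[OF _ _ _ \<phi>])
  fix x
  show "((\<lambda>t. wave (regdist \<delta> (x + t *\<^sub>R axis i 1))) has_vector_derivative of_real (x $ i) * wave1 (regdist \<delta> x)) (at 0)"
    using radial_line[OF \<delta> wave_derivative[OF regdist_pos[OF \<delta>]], of x i] regdist_pos[OF \<delta>, of x]
    by (simp add: scaleR_conv_of_real)
qed (auto intro!: continuous_intros continuous_wave_regdist \<delta>)

lemma wave1_regdist_parts:
  assumes \<delta>: "\<delta> > 0" and \<phi>: "\<phi> \<in> test_functions UNIV"
  shows "(LINT x|lborel. (of_real (x $ i) * wave1 (regdist \<delta> x)) * partial i \<phi> x)
    = - (LINT x|lborel. (wave1 (regdist \<delta> x) + of_real ((x $ i)\<^sup>2 / regdist \<delta> x) * wave2 (regdist \<delta> x)) * \<phi> x)"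
proof (rule integral_by_parts[OF _ _ _ \<phi>])
  fix x
  have "((\<lambda>t. of_real ((x + t *\<^sub>R axis i 1) $ i)) has_vector_derivative (1 :: complex)) (at 0)"
    by (auto intro!: derivative_eq_intros simp: axis_def)
  from has_vector_derivative_mult[OF this radial_line[OF \<delta> wave1_derivative[OF regdist_pos[OF \<delta>]], of x i]]
  show "((\<lambda>t. of_real ((x + t *\<^sub>R axis i 1) $ i) * wave1 (regdist \<delta> (x + t *\<^sub>R axis i 1))) has_vector_derivative
      wave1 (regdist \<delta> x) + of_real ((x $ i)\<^sup>2 / regdist \<delta> x) * wave2 (regdist \<delta> x)) (at 0)"
    by (simp add: scaleR_conv_of_real power2_eq_square add.commute mult.assoc)
qed (auto intro!: continuous_intros continuous_wave_regdist \<delta> simp: less_imp_neq[OF regdist_pos[OF \<delta>], symmetric])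

text \<open>Summing over \<open>i\<close> replaces the squared coordinates by
  \<open>s\<^sup>2 - \<delta>\<^sup>2\<close>. The part with \<open>s\<^sup>2\<close> is the exact
  Helmholtz identity of the wave, and the remainder \<open>- \<delta>\<^sup>2 / s * wave2 s\<close>
  is the defect.\<close>

lemma wave_defect_eq:
  assumes \<delta>: "\<delta> > 0"
  shows "(\<Sum>i\<in>UNIV. wave1 (regdist \<delta> x) + of_real ((x $ i)\<^sup>2 / regdist \<delta> x) * wave2 (regdist \<delta> x))
    = wave_defect \<delta> (regdist \<delta> x) - \<kappa>\<^sup>2 * wave (regdist \<delta> x)"
proof -
  define s where "s = regdist \<delta> x"
  have s: "s > 0"
    using regdist_pos[OF \<delta>] by (simp add: s_def)
  define S :: complex where "S = of_real s"
  have S: "S \<noteq> 0"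
    using s by (simp add: S_def)
  have "(\<Sum>i\<in>UNIV. (x $ i)\<^sup>2) = s\<^sup>2 - \<delta>\<^sup>2"
    unfolding s_def regdist_square by (simp add: norm_vec_def L2_set_def sum_nonneg)
  then have "(\<Sum>i\<in>UNIV. of_real ((x $ i)\<^sup>2 / s) * wave2 s) = of_real ((s\<^sup>2 - \<delta>\<^sup>2) / s) * wave2 s"
    by (simp only: sum_distrib_right[symmetric] of_real_sum[symmetric] sum_divide_distrib[symmetric])
  then have "(\<Sum>i\<in>UNIV. wave1 s + of_real ((x $ i)\<^sup>2 / s) * wave2 s)
      = 3 * wave1 s + of_real ((s\<^sup>2 - \<delta>\<^sup>2) / s) * wave2 s"
    by (simp add: sum.distrib)
  also have "\<dots> = wave_defect \<delta> s - \<kappa>\<^sup>2 * wave s"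
  proof -
    define E where "E = exp (\<i> * \<kappa> * S)"
    have "3 * (E * (\<i> * \<kappa> / S ^ 2 - 1 / S ^ 3)) + (S\<^sup>2 - of_real \<delta> ^ 2) / S
          * (E * (- \<kappa>\<^sup>2 / S ^ 2 - 3 * \<i> * \<kappa> / S ^ 3 + 3 / S ^ 4))
        = of_real \<delta> ^ 2 * E * (\<kappa>\<^sup>2 / S ^ 3 + 3 * \<i> * \<kappa> / S ^ 4 - 3 / S ^ 5) - \<kappa>\<^sup>2 * (E / S)"
      using S by (simp add: divide_simps) (simp add: algebra_simps eval_nat_numeral)
    then show ?thesis
      unfolding wave1_def wave2_def wave_def wave_defect_def by (simp add: S_def E_def)
  qed
  finally show ?thesis
    unfolding s_def .
qed

lemma integral_wave_regdist:
  assumes \<delta>: "\<delta> > 0" and \<phi>: "\<phi> \<in> test_functions UNIV"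
  shows "(LINT x|lborel. wave (regdist \<delta> x) * (laplacian \<phi> x + \<kappa>\<^sup>2 * \<phi> x))
    = (LINT x|lborel. wave_defect \<delta> (regdist \<delta> x) * \<phi> x)"
proof -
  note \<phi>i = test_function_partial[OF \<phi>]
  define W where "W i x = wave1 (regdist \<delta> x) + of_real ((x $ i)\<^sup>2 / regdist \<delta> x) * wave2 (regdist \<delta> x)" for i x
  have cW: "continuous_on UNIV (W i)" for i
    unfolding W_def by (auto intro!: continuous_intros continuous_wave_regdist \<delta> simp: less_imp_neq[OF regdist_pos[OF \<delta>], symmetric])
  note cw = continuous_wave_regdist(1)[OF \<delta>, of UNIV]
  have int1: "integrable lborel (\<lambda>x. wave (regdist \<delta> x) * partial i (partial i \<phi>) x)" for i
    by (intro continuous_mult_test_integrable cw test_function_partial \<phi>)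
  have int2: "integrable lborel (\<lambda>x. W i x * \<phi> x)" for i
    by (intro continuous_mult_test_integrable cW \<phi>)
  have int3: "integrable lborel (\<lambda>x. wave (regdist \<delta> x) * (\<kappa>\<^sup>2 * \<phi> x))"
    by (intro continuous_mult_test_integrable cw test_function_cmult \<phi>)
  have "(LINT x|lborel. wave (regdist \<delta> x) * partial i (partial i \<phi>) x) = (LINT x|lborel. W i x * \<phi> x)" for i
    unfolding W_def using wave_regdist_parts[OF \<delta> \<phi>i] wave1_regdist_parts[OF \<delta> \<phi>] by simp
  then have "(LINT x|lborel. wave (regdist \<delta> x) * (laplacian \<phi> x + \<kappa>\<^sup>2 * \<phi> x))
      = (\<Sum>i\<in>UNIV. LINT x|lborel. W i x * \<phi> x) + (LINT x|lborel. wave (regdist \<delta> x) * (\<kappa>\<^sup>2 * \<phi> x))"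
    unfolding laplacian_def distrib_left sum_distrib_left using int1 int3 by simp
  also have "\<dots> = (LINT x|lborel. (\<Sum>i\<in>UNIV. W i x) * \<phi> x + wave (regdist \<delta> x) * (\<kappa>\<^sup>2 * \<phi> x))"
    using int2 int3 by (simp add: sum_distrib_right)
  also have "\<dots> = (LINT x|lborel. wave_defect \<delta> (regdist \<delta> x) * \<phi> x)"
    unfolding W_def wave_defect_eq[OF \<delta>] by (simp add: algebra_simps)
  finally show ?thesis .
qed

lemma wave_eq_outgoing: "wave (norm x) = outgoing \<kappa> x"
  by (simp add: wave_def outgoing_def)

lemma measurable_wave [measurable]: "wave \<in> borel_measurable borel" "wave_defect \<delta> \<in> borel_measurable borel"
  unfolding wave_def[abs_def] wave_defect_def[abs_def] by measurable

lemma tendsto_wave_regdist: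
  assumes "x \<noteq> 0" and d: "d \<longlonglongrightarrow> 0"
  shows "(\<lambda>n. wave (regdist (d n) x)) \<longlonglongrightarrow> outgoing \<kappa> x"
proof -
  have "(\<lambda>n. regdist (d n) x) \<longlonglongrightarrow> sqrt ((norm x)\<^sup>2 + 0\<^sup>2)"
    unfolding regdist_def by (intro tendsto_intros d)
  then have "(\<lambda>n. regdist (d n) x) \<longlonglongrightarrow> norm x"
    by simp
  moreover have "isCont wave (norm x)"
    using continuous_wave(1) assms(1) by (simp add: continuous_on_eq_continuous_at)
  ultimately show ?thesis
    unfolding wave_eq_outgoing[symmetric] by (rule isCont_tendsto_compose[rotated])
qed

lemma norm_exp_wave: "cmod (exp (\<i> * \<kappa> * of_real s)) \<le> exp (cmod \<kappa> * \<bar>s\<bar>)"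
  using norm_exp[of "\<i> * \<kappa> * of_real s"] by (simp add: norm_mult)

lemma tendsto_integral_wave_regdist:
  assumes \<psi>: "\<psi> \<in> test_functions UNIV" and d: "d \<longlonglongrightarrow> 0" "\<And>n. d n > 0" "\<And>n. d n \<le> 1"
  shows "(\<lambda>n. LINT x|lborel. wave (regdist (d n) x) * \<psi> x) \<longlonglongrightarrow> (LINT x|lborel. outgoing \<kappa> x * \<psi> x)"
proof -
  obtain R where R: "R > 0" "\<And>x. norm x \<ge> R \<Longrightarrow> \<psi> x = 0"
    using test_function_support[OF \<psi>] by blast
  obtain B where B: "B > 0" "\<And>x. cmod (\<psi> x) \<le> B"
    using test_function_bounded[OF \<psi>] by blast
  have [measurable]: "\<psi> \<in> borel_measurable borel"
    using smooth_measurable test_function_smooth[OF \<psi>] by blast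
  \<comment> \<open>For parameters at most 1 and points of norm below \<open>R\<close> the
    regularized distance lies between \<open>norm x\<close> and \<open>R + 1\<close>.\<close>
  define C where "C = exp (cmod \<kappa> * (R + 1)) * B"
  have w: "integrable lborel (\<lambda>x :: R3. C * (indicator {..R} (norm x) / norm x))"
    by (intro integrable_mult_right integrable_inverse_norm_ball)
  have bnd: "cmod (wave (regdist (d n) x) * \<psi> x) \<le> C * (indicator {..R} (norm x) / norm x)" if "x \<noteq> 0" for n x
  proof (cases "norm x < R")
    case True
    define s where "s = regdist (d n) x"
    have s: "s \<ge> norm x" "s \<le> R + 1" "s > 0"
      using regdist_ge[of x "d n"] regdist_le[of "d n" x] regdist_pos[of "d n" x] d(2,3)[of n] True
      by (auto simp: s_def)
    have "cmod (wave s) = cmod (exp (\<i> * \<kappa> * of_real s)) / s"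
      using s by (simp add: wave_def norm_divide)
    also have "\<dots> \<le> exp (cmod \<kappa> * (R + 1)) / norm x"
    proof (intro frac_le)
      show "cmod (exp (\<i> * \<kappa> * of_real s)) \<le> exp (cmod \<kappa> * (R + 1))"
        using s by (intro order_trans[OF norm_exp_wave]) (auto intro!: mult_left_mono)
    qed (use s that in auto)
    finally have "cmod (wave s) * cmod (\<psi> x) \<le> exp (cmod \<kappa> * (R + 1)) / norm x * B"
      using B by (intro mult_mono) auto
    then show ?thesis
      using True by (simp add: s_def norm_mult C_def)
  next
    case False
    then show ?thesis
      using R B by (simp add: C_def)
  qed
  have ae: "AE x in lborel. x \<noteq> (0 :: R3)"
    by (rule AE_lborel_singleton)
  show ?thesis
  proof (rule integral_dominated_convergence[OF _ _ w])
    show "AE x in lborel. (\<lambda>n. wave (regdist (d n) x) * \<psi> x) \<longlonglongrightarrow> outgoing \<kappa> x * \<psi> x"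
      using ae by eventually_elim (intro tendsto_intros tendsto_wave_regdist d)
    show "AE x in lborel. cmod (wave (regdist (d n) x) * \<psi> x) \<le> C * (indicator {..R} (norm x) / norm x)" for n
      using ae by eventually_elim (rule bnd)
  qed auto
qed

text \<open>Substituting x = \<delta> y, the volume factor and the prefactor give the fifth power of
  \<delta>, while the inverse powers 3, 4, 5 of the regularized distance take away as many. The
  three terms keep the powers 2, 1, 0 of \<delta>, so only \<open>- 3 / q y ^ 5\<close> survives,
  and its integral is minus \<open>delta_mass\<close>.\<close>

lemma tendsto_integral_wave_defect:
  assumes \<phi>: "\<phi> \<in> test_functions UNIV" and d: "d \<longlonglongrightarrow> 0" "\<And>n. d n > 0" "\<And>n. d n \<le> 1"
  shows "(\<lambda>n. LINT x|lborel. wave_defect (d n) (regdist (d n) x) * \<phi> x) \<longlonglongrightarrow> - of_real delta_mass * \<phi> 0"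
proof -
  obtain R where R: "R > 0" "\<And>x. norm x \<ge> R \<Longrightarrow> \<phi> x = 0"
    using test_function_support[OF \<phi>] by blast
  obtain B where B: "B > 0" "\<And>x. cmod (\<phi> x) \<le> B"
    using test_function_bounded[OF \<phi>] by blast
  have [measurable]: "\<phi> \<in> borel_measurable borel"
    using smooth_measurable test_function_smooth[OF \<phi>] by blast
  define q where "q y = regdist 1 y" for y
  have q: "q y \<ge> 1" "q y > 0" "q y \<le> norm y + 1" for y
    using regdist_le[of 1 y] regdist_pos[of 1 y] unfolding q_def by (auto simp: regdist_def)
  have [measurable]: "q \<in> borel_measurable borel"
    unfolding q_def by measurable
  have scale: "regdist \<delta> (\<delta> *\<^sub>R y) = \<delta> * q y" if "\<delta> > 0" for \<delta> y
  proof -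
    have "regdist \<delta> (\<delta> *\<^sub>R y) = sqrt (\<delta>\<^sup>2 * ((norm y)\<^sup>2 + 1))"
      unfolding regdist_def by (simp add: power_mult_distrib algebra_simps)
    also have "\<dots> = \<delta> * q y"
      using that by (simp add: real_sqrt_mult q_def regdist_def)
    finally show ?thesis .
  qed
  define s where "s n y = exp (\<i> * \<kappa> * of_real (d n * q y)) * (\<kappa>\<^sup>2 * of_real (d n) ^ 2 / of_real (q y) ^ 3
      + 3 * \<i> * \<kappa> * of_real (d n) / of_real (q y) ^ 4 - 3 / of_real (q y) ^ 5) * \<phi> (d n *\<^sub>R y)" for n y
  have eq: "(LINT x|lborel. wave_defect (d n) (regdist (d n) x) * \<phi> x) = (LINT y|lborel. s n y)" for n
  proof -
    have "(LINT x|lborel. wave_defect (d n) (regdist (d n) x) * \<phi> x)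
        = \<bar>d n\<bar> ^ 3 *\<^sub>R (LINT y|lborel. wave_defect (d n) (regdist (d n) (0 + d n *\<^sub>R y)) * \<phi> (0 + d n *\<^sub>R y))"
      using d(2)[of n] by (intro integral_lborel_affine) auto
    also have "\<dots> = (LINT y|lborel. \<bar>d n\<bar> ^ 3 *\<^sub>R (wave_defect (d n) (d n * q y) * \<phi> (d n *\<^sub>R y)))"
      using d(2)[of n] by (simp add: scale)
    also have "\<dots> = (LINT y|lborel. s n y)"
    proof (rule Bochner_Integration.integral_cong[OF refl])
      fix y
      define D S where "D = complex_of_real (d n)" and "S = complex_of_real (q y)"
      have DS: "D \<noteq> 0" "S \<noteq> 0"
        using d(2)[of n] q(2)[of y] by (auto simp: D_def S_def)
      have "D ^ 3 * (D\<^sup>2 * E * (\<kappa>\<^sup>2 / (D * S) ^ 3 + 3 * \<i> * \<kappa> / (D * S) ^ 4 - 3 / (D * S) ^ 5))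
          = E * (\<kappa>\<^sup>2 * D ^ 2 / S ^ 3 + 3 * \<i> * \<kappa> * D / S ^ 4 - 3 / S ^ 5)" for E
        using DS by (simp add: divide_simps power_mult_distrib) (simp add: algebra_simps eval_nat_numeral)
      then show "\<bar>d n\<bar> ^ 3 *\<^sub>R (wave_defect (d n) (d n * q y) * \<phi> (d n *\<^sub>R y)) = s n y"
        using d(2)[of n] by (simp add: wave_defect_def s_def D_def S_def scaleR_conv_of_real)
    qed
    finally show ?thesis .
  qed
  define C where "C = exp (cmod \<kappa> * (R + 1)) * ((cmod \<kappa>)\<^sup>2 * (R + 1) + 3 * cmod \<kappa> + 3) * B"
  have C0: "C \<ge> 0"
    using R B by (simp add: C_def)
  have w: "integrable lborel (\<lambda>y :: R3. C * (1 / (1 + (norm y)\<^sup>2)\<^sup>2))"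
    by (intro integrable_mult_right integrable_inverse_quartic)
  have q4: "q y ^ 4 = (1 + (norm y)\<^sup>2)\<^sup>2" for y
  proof -
    have "q y ^ 4 = ((q y)\<^sup>2)\<^sup>2"
      by (simp flip: power_mult)
    then show ?thesis
      by (simp add: q_def regdist_square add.commute)
  qed
  have bnd: "cmod (s n y) \<le> C * (1 / (1 + (norm y)\<^sup>2)\<^sup>2)" for n y
  proof (cases "d n * norm y < R")
    case True
    have dq: "d n * q y \<le> R + 1"
    proof -
      have "d n * q y \<le> d n * (norm y + 1)"
        using q(3)[of y] d(2)[of n] by (intro mult_left_mono) auto
      also have "\<dots> \<le> R + 1"
        using True d(3)[of n] by (simp add: distrib_left)
      finally show ?thesis .
    qed
    \<comment> \<open>Inverse cubic decay is not integrable in dimension three. On the support of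
      the rescaled \<phi> the product \<open>d n * q y\<close> is bounded, and this supplies the
      missing power.\<close>
    have t1: "(d n)\<^sup>2 / q y ^ 3 \<le> (R + 1) / q y ^ 4"
    proof -
      have "(d n)\<^sup>2 * q y = d n * (d n * q y)"
        by (simp add: power2_eq_square)
      also have "\<dots> \<le> 1 * (R + 1)"
        using d(2,3)[of n] dq q(2)[of y] by (intro mult_mono) (auto intro: mult_nonneg_nonneg less_imp_le)
      finally have "(d n)\<^sup>2 * q y / q y ^ 4 \<le> (R + 1) / q y ^ 4"
        using q(2)[of y] by (intro divide_right_mono) auto
      then show ?thesis
        using q(2)[of y] by (simp add: eval_nat_numeral)
    qed
    have t2: "d n / q y ^ 4 \<le> 1 / q y ^ 4"
      using d(3)[of n] q(2)[of y] by (intro divide_right_mono) auto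
    have t3: "1 / q y ^ 5 \<le> 1 / q y ^ 4"
      using q(1,2)[of y] by (intro divide_left_mono power_increasing) auto
    define P where "P = \<kappa>\<^sup>2 * of_real (d n) ^ 2 / of_real (q y) ^ 3 + 3 * \<i> * \<kappa> * of_real (d n) / of_real (q y) ^ 4 - 3 / of_real (q y) ^ 5"
    have "cmod P \<le> cmod (\<kappa>\<^sup>2 * of_real (d n) ^ 2 / of_real (q y) ^ 3) + cmod (3 * \<i> * \<kappa> * of_real (d n) / of_real (q y) ^ 4)
        + cmod (3 / of_real (q y) ^ 5)"
      unfolding P_def by (intro order_trans[OF norm_triangle_ineq4] add_right_mono norm_triangle_ineq)
    also have "\<dots> = (cmod \<kappa>)\<^sup>2 * ((d n)\<^sup>2 / q y ^ 3) + 3 * cmod \<kappa> * (d n / q y ^ 4) + 3 * (1 / q y ^ 5)"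
      using d(2)[of n] q(2)[of y] by (simp add: norm_mult norm_divide norm_power)
    also have "\<dots> \<le> (cmod \<kappa>)\<^sup>2 * ((R + 1) / q y ^ 4) + 3 * cmod \<kappa> * (1 / q y ^ 4) + 3 * (1 / q y ^ 4)"
      by (intro add_mono mult_left_mono t1 t2 t3) auto
    also have "\<dots> = ((cmod \<kappa>)\<^sup>2 * (R + 1) + 3 * cmod \<kappa> + 3) * (1 / q y ^ 4)"
      by (simp add: algebra_simps add_divide_distrib)
    finally have P: "cmod P \<le> ((cmod \<kappa>)\<^sup>2 * (R + 1) + 3 * cmod \<kappa> + 3) * (1 / q y ^ 4)" .
    have "cmod (exp (\<i> * \<kappa> * of_real (d n * q y))) \<le> exp (cmod \<kappa> * (R + 1))"
      using dq d(2)[of n] q(2)[of y] by (intro order_trans[OF norm_exp_wave]) (auto intro!: mult_left_mono)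
    then have "cmod (s n y) \<le> exp (cmod \<kappa> * (R + 1)) * (((cmod \<kappa>)\<^sup>2 * (R + 1) + 3 * cmod \<kappa> + 3) * (1 / q y ^ 4)) * B"
      unfolding s_def P_def[symmetric] norm_mult using P B R q(2)[of y] by (intro mult_mono) auto
    then show ?thesis
      by (simp add: C_def q4 mult_ac)
  next
    case False
    then have "\<phi> (d n *\<^sub>R y) = 0"
      using d(2)[of n] by (intro R) simp
    then show ?thesis
      using C0 by (simp add: s_def)
  qed
  have lim: "(\<lambda>n. s n y) \<longlonglongrightarrow> - 3 / of_real (q y) ^ 5 * \<phi> 0" for y
  proof -
    have q0: "complex_of_real (q y) \<noteq> 0"
      using q(2)[of y] by simp
    have "isCont \<phi> 0"
      using smooth_continuous_on[OF test_function_smooth[OF \<phi>], of UNIV] by (simp add: continuous_on_eq_continuous_at)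
    moreover have "(\<lambda>n. d n *\<^sub>R y) \<longlonglongrightarrow> 0 *\<^sub>R y"
      by (intro tendsto_intros d)
    ultimately have "(\<lambda>n. \<phi> (d n *\<^sub>R y)) \<longlonglongrightarrow> \<phi> 0"
      using isCont_tendsto_compose[of 0 \<phi>] by simp
    then have "(\<lambda>n. s n y) \<longlonglongrightarrow> exp (\<i> * \<kappa> * of_real (0 * q y)) * (\<kappa>\<^sup>2 * of_real 0 ^ 2 / of_real (q y) ^ 3
        + 3 * \<i> * \<kappa> * of_real 0 / of_real (q y) ^ 4 - 3 / of_real (q y) ^ 5) * \<phi> 0"
      unfolding s_def using q0 by (intro tendsto_intros d) auto
    then show ?thesis
      by simp
  qed
  have [measurable]: "s n \<in> borel_measurable borel" for n
    unfolding s_def by measurable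
  have "(\<lambda>n. LINT y|lborel. s n y) \<longlonglongrightarrow> (LINT y|lborel. - 3 / of_real (q y) ^ 5 * \<phi> 0)"
    by (rule integral_dominated_convergence[OF _ _ w]) (use lim bnd in auto)
  also have "(LINT y|lborel. - 3 / of_real (q y) ^ 5 * \<phi> 0) = (LINT y|lborel. complex_of_real (1 / q y ^ 5) * (- 3 * \<phi> 0))"
    by (intro Bochner_Integration.integral_cong) auto
  also have "\<dots> = of_real (LINT y|lborel. 1 / q y ^ 5) * (- 3 * \<phi> 0)"
    by (simp only: integral_mult_left_zero integral_complex_of_real)
  also have "\<dots> = - of_real delta_mass * \<phi> 0"
    by (simp add: delta_mass_def q_def regdist_def add.commute)
  finally show ?thesis
    by (simp add: eq)
qed

text \<open>Holds for every complex \<kappa>, since \<phi> has compact support. The case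
  \<open>\<kappa> = 0\<close> treats the Coulomb singularity 1/|x| in the domain of the
  operator.\<close>

lemma fundamental_solution:
  assumes \<phi>: "\<phi> \<in> test_functions UNIV"
  shows "(LINT x|lborel. outgoing \<kappa> x * (laplacian \<phi> x + \<kappa>\<^sup>2 * \<phi> x)) = - of_real delta_mass * \<phi> 0"
proof -
  define d where "d n = 1 / real (Suc n)" for n
  have d: "d \<longlonglongrightarrow> 0" "\<And>n. d n > 0" "\<And>n. d n \<le> 1"
    using LIMSEQ_inverse_real_of_nat by (auto simp: d_def[abs_def] inverse_eq_divide)
  have "(\<lambda>x. laplacian \<phi> x + \<kappa>\<^sup>2 * \<phi> x) \<in> test_functions UNIV"
    by (intro test_function_add test_function_laplacian test_function_cmult \<phi>)
  from tendsto_integral_wave_regdist[OF this d]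
  have "(\<lambda>n. LINT x|lborel. wave_defect (d n) (regdist (d n) x) * \<phi> x)
      \<longlonglongrightarrow> (LINT x|lborel. outgoing \<kappa> x * (laplacian \<phi> x + \<kappa>\<^sup>2 * \<phi> x))"
    by (simp add: integral_wave_regdist[OF d(2) \<phi>])
  then show ?thesis
    using tendsto_integral_wave_defect[OF \<phi> d] LIMSEQ_unique by blast
qed

end

lemma delta_mass_pos: "delta_mass > 0"
proof -
  have int: "integrable lborel (\<lambda>x :: R3. 1 / sqrt (1 + (norm x)\<^sup>2) ^ 5)"
  proof (rule Bochner_Integration.integrable_bound[OF integrable_inverse_quartic])
    have "1 / sqrt (1 + (norm x)\<^sup>2) ^ 5 \<le> 1 / (1 + (norm x)\<^sup>2)\<^sup>2" for x :: R3
    proof -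
      have "1 / sqrt (1 + (norm x)\<^sup>2) ^ 5 \<le> 1 / sqrt (1 + (norm x)\<^sup>2) ^ 4"
        by (intro divide_left_mono power_increasing) (auto simp: add_pos_nonneg)
      also have "sqrt (1 + (norm x)\<^sup>2) ^ 4 = (sqrt (1 + (norm x)\<^sup>2) ^ 2) ^ 2"
        by (simp only: power4_eq_xxxx power2_eq_square mult.assoc)
      finally show ?thesis by simp
    qed
    then show "AE x :: R3 in lborel. norm (1 / sqrt (1 + (norm x)\<^sup>2) ^ 5) \<le> norm (1 / (1 + (norm x)\<^sup>2)\<^sup>2)"
      by (intro AE_I2) simp
  qed auto
  have "(LINT x|(lborel :: R3 measure). 1 / sqrt (1 + (norm x)\<^sup>2) ^ 5) \<noteq> 0"
  proof
    assume "(LINT x|(lborel :: R3 measure). 1 / sqrt (1 + (norm x)\<^sup>2) ^ 5) = 0"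
    then have "AE x in (lborel :: R3 measure). 1 / sqrt (1 + (norm x)\<^sup>2) ^ 5 = 0"
      by (subst (asm) integral_nonneg_eq_0_iff_AE[OF int]) auto
    moreover have "1 / sqrt (1 + (norm x)\<^sup>2) ^ 5 \<noteq> 0" for x :: R3
      by (simp add: add_pos_nonneg less_imp_neq[symmetric])
    ultimately have "AE x in (lborel :: R3 measure). False"
      by simp
    then show False
      by (simp add: eventually_False ae_filter_eq_bot_iff)
  qed
  moreover have "(LINT x|(lborel :: R3 measure). 1 / sqrt (1 + (norm x)\<^sup>2) ^ 5) \<ge> 0"
    by (intro integral_nonneg_AE) auto
  ultimately show ?thesis
    unfolding delta_mass_def by linarith
qed

text \<open>The regularization for \<open>\<kappa> = 0\<close>, stopped after one integration by
  parts: the weak gradient of 1/|x| has no point mass, because its size, the inverse square of the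
  norm, is locally integrable. It enters when a Laplacian is moved across the cut-off.\<close>

lemma integral_inverse_norm_partial:
  assumes \<phi>: "\<phi> \<in> test_functions UNIV"
  shows "(LINT x|lborel. of_real (1 / norm x) * partial i \<phi> x) = (LINT x|lborel. of_real (x $ i / norm x ^ 3) * \<phi> x)"
proof -
  define d where "d n = 1 / real (Suc n)" for n
  have d: "d \<longlonglongrightarrow> 0" "\<And>n. d n > 0" "\<And>n. d n \<le> 1"
    using LIMSEQ_inverse_real_of_nat by (auto simp: d_def[abs_def] inverse_eq_divide)
  obtain R where R: "R > 0" "\<And>x. norm x \<ge> R \<Longrightarrow> \<phi> x = 0"
    using test_function_support[OF \<phi>] by blast
  obtain B where B: "B > 0" "\<And>x. cmod (\<phi> x) \<le> B"
    using test_function_bounded[OF \<phi>] by blast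
  have [measurable]: "\<phi> \<in> borel_measurable borel"
    using smooth_measurable test_function_smooth[OF \<phi>] by blast
  have "(\<lambda>n. LINT x|lborel. wave 0 (regdist (d n) x) * partial i \<phi> x) \<longlonglongrightarrow> (LINT x|lborel. outgoing 0 x * partial i \<phi> x)"
    by (rule tendsto_integral_wave_regdist[OF test_function_partial[OF \<phi>] d])
  moreover have "(LINT x|lborel. wave 0 (regdist (d n) x) * partial i \<phi> x)
      = (LINT x|lborel. of_real (x $ i / regdist (d n) x ^ 3) * \<phi> x)" for n
    unfolding wave_regdist_parts[OF d(2) \<phi>] by (simp add: wave1_def flip: integral_minus)
  moreover have "(\<lambda>n. LINT x|lborel. of_real (x $ i / regdist (d n) x ^ 3) * \<phi> x)
      \<longlonglongrightarrow> (LINT x|lborel. of_real (x $ i / norm x ^ 3) * \<phi> x)"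
  proof (rule integral_dominated_convergence)
    show "integrable lborel (\<lambda>x :: R3. B * (indicator {..R} (norm x) / (norm x)\<^sup>2))"
      by (intro integrable_mult_right integrable_inverse_norm_square_ball)
    have ae: "AE x in lborel. x \<noteq> (0 :: R3)"
      by (rule AE_lborel_singleton)
    then show "AE x in lborel. (\<lambda>n. of_real (x $ i / regdist (d n) x ^ 3) * \<phi> x) \<longlonglongrightarrow> of_real (x $ i / norm x ^ 3) * \<phi> x"
    proof eventually_elim
      case (elim x)
      have "(\<lambda>n. regdist (d n) x) \<longlonglongrightarrow> sqrt ((norm x)\<^sup>2 + 0\<^sup>2)"
        unfolding regdist_def by (intro tendsto_intros d)
      then show ?case
        using elim by (intro tendsto_intros) auto
    qed
    show "AE x in lborel. norm (of_real (x $ i / regdist (d n) x ^ 3) * \<phi> x) \<le> B * (indicator {..R} (norm x) / (norm x)\<^sup>2)" for n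
      using ae
    proof eventually_elim
      case (elim x)
      show ?case
      proof (cases "norm x < R")
        case True
        have "\<bar>x $ i\<bar> / regdist (d n) x ^ 3 \<le> norm x / norm x ^ 3"
          using elim by (intro frac_le component_le_norm_cart power_mono regdist_ge) auto
        also have "\<dots> = 1 / (norm x)\<^sup>2"
          using elim by (simp add: eval_nat_numeral)
        finally have "\<bar>x $ i\<bar> / regdist (d n) x ^ 3 * cmod (\<phi> x) \<le> 1 / (norm x)\<^sup>2 * B"
          using B by (intro mult_mono) auto
        then show ?thesis
          using True regdist_pos[OF d(2), of n x] by (simp add: norm_mult norm_divide norm_power)
      next
        case False
        then show ?thesis
          using R B by simp
      qed
    qed
  qed measurable
  ultimately have "(LINT x|lborel. outgoing 0 x * partial i \<phi> x) = (LINT x|lborel. of_real (x $ i / norm x ^ 3) * \<phi> x)"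
    using LIMSEQ_unique by simp
  then show ?thesis
    by (simp add: outgoing_def)
qed

section \<open>Density of test functions\<close>

lemma sqnorm_tendsto_0:
  assumes [measurable]: "\<And>n. s n \<in> borel_measurable borel" "f \<in> borel_measurable borel"
    and lim: "AE x in lborel. (\<lambda>n. s n x) \<longlonglongrightarrow> f x"
    and w: "integrable lborel (\<lambda>x. (w x)\<^sup>2)"
    and bound: "\<And>n. AE x in lborel. cmod (s n x) \<le> w x" "AE x in lborel. cmod (f x) \<le> w x"
  shows "(\<lambda>n. sqnorm (\<lambda>x. s n x - f x)) \<longlonglongrightarrow> 0"
proof -
  have "(\<lambda>n. LINT x|lborel. (cmod (s n x - f x))\<^sup>2) \<longlonglongrightarrow> (LINT x|(lborel :: R3 measure). 0)"
  proof (rule integral_dominated_convergence[where w="\<lambda>x. 4 * (w x)\<^sup>2"])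
    show "AE x in lborel. (\<lambda>n. (cmod (s n x - f x))\<^sup>2) \<longlonglongrightarrow> 0"
      using lim
    proof eventually_elim
      case (elim x)
      then have "(\<lambda>n. (cmod (s n x - f x))\<^sup>2) \<longlonglongrightarrow> (cmod (f x - f x))\<^sup>2"
        by (intro tendsto_intros)
      then show ?case by simp
    qed
    show "AE x in lborel. norm ((cmod (s n x - f x))\<^sup>2) \<le> 4 * (w x)\<^sup>2" for n
      using bound(1)[of n] bound(2)
    proof eventually_elim
      case (elim x)
      have "cmod (s n x - f x) \<le> 2 * w x"
        using norm_triangle_ineq4[of "s n x" "f x"] elim by linarith
      then have "(cmod (s n x - f x))\<^sup>2 \<le> (2 * w x)\<^sup>2"
        by (intro power_mono) auto
      then show ?case
        by (simp add: power_mult_distrib)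
    qed
  qed (use w in auto)
  then show ?thesis
    by (simp add: sqnorm_def)
qed

lemma sqnorm_eq_0D:
  assumes "f \<in> L2" and "sqnorm f = 0" shows "ae_eq f (\<lambda>_. 0)"
proof -
  have "AE x in lborel. (cmod (f x))\<^sup>2 = 0"
    using integral_nonneg_eq_0_iff_AE[OF L2D(2)[OF assms(1)]] assms(2) by (simp add: sqnorm_def)
  then show ?thesis
    by (simp add: ae_eq_def)
qed

section \<open>Cut-offs and mollifiers made from \<theta>\<close>

locale cutoff =
  fixes \<theta> :: "R3 \<Rightarrow> complex"
  assumes theta_test: "\<theta> \<in> test_functions UNIV"
    and theta_one: "eventually (\<lambda>x. \<theta> x = 1) (nhds 0)"
begin

lemma theta_one_ball: obtains a where "a > 0" and "\<And>x. norm x < a \<Longrightarrow> \<theta> x = 1"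
  using theta_one unfolding eventually_nhds_metric by (auto simp: dist_norm)

text \<open>Large \<open>R\<close> cuts off at infinity, small \<open>R\<close> isolates the origin;
  both uses occur.\<close>

definition scaled :: "real \<Rightarrow> R3 \<Rightarrow> complex" where
  "scaled R x = \<theta> ((1 / R) *\<^sub>R x)"

lemma scaled_test: "R > 0 \<Longrightarrow> scaled R \<in> test_functions UNIV"
  using test_function_affine[OF theta_test, of "1 / R" 0] by (simp add: scaled_def[abs_def])

lemma scaled_smooth: "smooth (scaled R)"
  using smooth_affine[OF test_function_smooth[OF theta_test], of "1 / R" 0] by (simp add: scaled_def[abs_def])

lemma partial_scaled: "partial i (scaled R) x = of_real (1 / R) * partial i \<theta> ((1 / R) *\<^sub>R x)"
  using fun_cong[OF smooth_affine_partial[OF test_function_smooth[OF theta_test], of i "1 / R" 0]]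
  by (simp add: scaled_def[abs_def])

lemma laplacian_scaled: "laplacian (scaled R) x = of_real (1 / R\<^sup>2) * laplacian \<theta> ((1 / R) *\<^sub>R x)"
proof -
  have "partial i (partial i (scaled R)) x = of_real (1 / R\<^sup>2) * partial i (partial i \<theta>) ((1 / R) *\<^sub>R x)" for i
  proof -
    have "partial i (scaled R) = (\<lambda>x. of_real (1 / R) * partial i \<theta> ((1 / R) *\<^sub>R x + 0))"
      by (simp add: partial_scaled fun_eq_iff)
    moreover note sm = smooth_partial[OF test_function_smooth[OF theta_test], of i]
    ultimately have "partial i (partial i (scaled R)) x = of_real (1 / R) * (of_real (1 / R) * partial i (partial i \<theta>) ((1 / R) *\<^sub>R x + 0))"
      by (simp only: smooth_cmult_partial[OF smooth_affine[OF sm]] smooth_affine_partial[OF sm])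
    then show ?thesis
      by (simp add: power2_eq_square)
  qed
  then show ?thesis
    unfolding laplacian_def by (simp add: sum_distrib_left)
qed

lemma scaled_eventually_1: "eventually (\<lambda>R. scaled R x = 1) at_top"
proof -
  obtain a where a: "a > 0" "\<And>x. norm x < a \<Longrightarrow> \<theta> x = 1"
    using theta_one_ball by blast
  have "scaled R x = 1" if "R > max 0 (norm x / a)" for R
  proof -
    have "R > 0" "norm x / a < R"
      using that by auto
    then show ?thesis
      using a(1) unfolding scaled_def by (intro a) (simp add: field_simps)
  qed
  then show ?thesis
    unfolding eventually_at_top_dense by blast
qed

text \<open>Since \<theta> is complex-valued, its squared modulus is taken: it is smooth,
  nonnegative and of total mass \<open>sqnorm \<theta>\<close>.\<close>

definition mollifier :: "R3 \<Rightarrow> complex" where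
  "mollifier x = \<theta> x * cnj (\<theta> x) / of_real (sqnorm \<theta>)"

lemma sqnorm_theta_pos: "sqnorm \<theta> > 0"
proof (rule ccontr)
  assume "\<not> sqnorm \<theta> > 0"
  then have "ae_eq \<theta> (\<lambda>_. 0)"
    using sqnorm_nonneg[of \<theta>] by (intro sqnorm_eq_0D test_function_L2 theta_test) simp
  then have ae: "AE x in lborel. \<theta> x = 0"
    by (simp add: ae_eq_def)
  obtain a where a: "a > 0" "\<And>x. norm x < a \<Longrightarrow> \<theta> x = 1"
    using theta_one_ball by blast
  have "AE x in lborel. x \<notin> ball (0 :: R3) a"
    using ae by eventually_elim (use a in auto)
  then have "emeasure lborel (ball (0 :: R3) a) = 0"
    by (subst (asm) AE_iff_measurable[of "ball 0 a"]) auto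
  moreover have "emeasure lborel (ball (0 :: R3) a) \<noteq> 0"
  proof -
    have "unit_ball_vol 3 \<noteq> (0 :: real)"
      using unit_ball_vol_pos[of "3 :: real"] by linarith
    then show ?thesis
      using a(1) by (simp add: emeasure_ball)
  qed
  ultimately show False by simp
qed

lemma mollifier_test: "mollifier \<in> test_functions UNIV"
  using test_function_cmult[OF test_function_mult_smooth[OF theta_test smooth_cnj[OF test_function_smooth[OF theta_test]]], of "1 / of_real (sqnorm \<theta>)"]
  by (simp add: mollifier_def[abs_def])

lemma mollifier_eq: "mollifier x = of_real ((cmod (\<theta> x))\<^sup>2 / sqnorm \<theta>)"
  by (simp add: mollifier_def complex_norm_square[symmetric])

lemma integral_mollifier: "(LINT x|lborel. mollifier x) = 1" "(LINT x|lborel. cmod (mollifier x)) = 1"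
proof -
  have "(LINT x|lborel. (cmod (\<theta> x))\<^sup>2 / sqnorm \<theta>) = 1"
    using sqnorm_theta_pos by (simp add: sqnorm_def)
  then show "(LINT x|lborel. mollifier x) = 1" "(LINT x|lborel. cmod (mollifier x)) = 1"
    using sqnorm_nonneg[of \<theta>] by (simp_all only: mollifier_eq integral_complex_of_real norm_of_real) simp_all
qed

section \<open>Approximation by test functions: boxes, Borel sets, square integrable
  functions\<close>

definition approximable :: "(R3 \<Rightarrow> complex) \<Rightarrow> bool" where
  "approximable f \<longleftrightarrow> f \<in> L2 \<and> (\<forall>e>0. \<exists>\<psi>\<in>test_functions UNIV. sqnorm (\<lambda>x. \<psi> x - f x) < e)"

lemma approximable_closed:
  assumes f: "f \<in> L2" and "\<And>e. e > 0 \<Longrightarrow> \<exists>g. approximable g \<and> sqnorm (\<lambda>x. g x - f x) < e"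
  shows "approximable f"
  unfolding approximable_def
proof (intro conjI f allI impI)
  fix e :: real assume e: "e > 0"
  \<comment> \<open>Each of the two errors is doubled by \<open>sqnorm_add_le\<close>, hence a
    quarter for each.\<close>
  obtain g where g: "approximable g" "sqnorm (\<lambda>x. g x - f x) < e / 4"
    using assms(2)[of "e / 4"] e by auto
  have e4: "e / 4 > 0"
    using e by simp
  obtain \<psi> where \<psi>: "\<psi> \<in> test_functions UNIV" "sqnorm (\<lambda>x. \<psi> x - g x) < e / 4"
    using g(1) e4 unfolding approximable_def by blast
  have gL: "g \<in> L2"
    using g(1) by (simp add: approximable_def)
  have "sqnorm (\<lambda>x. (\<psi> x - g x) + (g x - f x)) \<le> 2 * sqnorm (\<lambda>x. \<psi> x - g x) + 2 * sqnorm (\<lambda>x. g x - f x)"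
    by (intro sqnorm_add_le L2_diff test_function_L2 \<psi> gL f)
  then have "sqnorm (\<lambda>x. \<psi> x - f x) < e"
    using g \<psi> by simp
  then show "\<exists>\<psi>\<in>test_functions UNIV. sqnorm (\<lambda>x. \<psi> x - f x) < e"
    using \<psi> by blast
qed

lemma approximable_limit:
  assumes f: "f \<in> L2" and g: "\<And>n. approximable (g n)" and lim: "(\<lambda>n. sqnorm (\<lambda>x. g n x - f x)) \<longlonglongrightarrow> 0"
  shows "approximable f"
proof (rule approximable_closed[OF f])
  fix e :: real assume "e > 0"
  then have "eventually (\<lambda>n. sqnorm (\<lambda>x. g n x - f x) < e) sequentially"
    using order_tendstoD(2)[OF lim] by blast
  then obtain n where "sqnorm (\<lambda>x. g n x - f x) < e"
    unfolding eventually_sequentially by blast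
  then show "\<exists>g. approximable g \<and> sqnorm (\<lambda>x. g x - f x) < e"
    using g by blast
qed

lemma approximable_test: "\<psi> \<in> test_functions UNIV \<Longrightarrow> approximable \<psi>"
  unfolding approximable_def by (auto intro!: bexI[of _ \<psi>] test_function_L2 simp: sqnorm_def)

lemma approximable_add:
  assumes "approximable f" and "approximable g" shows "approximable (\<lambda>x. f x + g x)"
  unfolding approximable_def
proof (intro conjI allI impI)
  have fg: "f \<in> L2" "g \<in> L2"
    using assms by (auto simp: approximable_def)
  then show "(\<lambda>x. f x + g x) \<in> L2"
    by (rule L2_add)
  fix e :: real assume e: "e > 0"
  have e4: "e / 4 > 0"
    using e by simp
  obtain \<phi> where \<phi>: "\<phi> \<in> test_functions UNIV" "sqnorm (\<lambda>x. \<phi> x - f x) < e / 4"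
    using assms(1) e4 unfolding approximable_def by blast
  obtain \<psi> where \<psi>: "\<psi> \<in> test_functions UNIV" "sqnorm (\<lambda>x. \<psi> x - g x) < e / 4"
    using assms(2) e4 unfolding approximable_def by blast
  have "sqnorm (\<lambda>x. (\<phi> x - f x) + (\<psi> x - g x)) \<le> 2 * sqnorm (\<lambda>x. \<phi> x - f x) + 2 * sqnorm (\<lambda>x. \<psi> x - g x)"
    by (intro sqnorm_add_le L2_diff test_function_L2 \<phi> \<psi> fg)
  then have "sqnorm (\<lambda>x. (\<phi> x + \<psi> x) - (f x + g x)) < e"
    using \<phi> \<psi> by (simp add: algebra_simps)
  then show "\<exists>\<psi>\<in>test_functions UNIV. sqnorm (\<lambda>x. \<psi> x - (f x + g x)) < e"
    by (intro bexI[of _ "\<lambda>x. \<phi> x + \<psi> x"] test_function_add \<phi> \<psi>)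
qed

lemma approximable_cmult:
  assumes "approximable f" shows "approximable (\<lambda>x. c * f x)"
proof (cases "c = 0")
  case True
  then show ?thesis
    using approximable_test[OF test_function_cmult[OF theta_test, of 0]] by simp
next
  case False
  have f: "f \<in> L2"
    using assms by (simp add: approximable_def)
  show ?thesis
    unfolding approximable_def
  proof (intro conjI allI impI L2_cmult f)
    fix e :: real assume e: "e > 0"
    then have "e / (cmod c)\<^sup>2 > 0"
      using False by simp
    then obtain \<phi> where \<phi>: "\<phi> \<in> test_functions UNIV" "sqnorm (\<lambda>x. \<phi> x - f x) < e / (cmod c)\<^sup>2"
      using assms unfolding approximable_def by blast
    have "sqnorm (\<lambda>x. c * (\<phi> x - f x)) < e"
      using \<phi>(2) False by (subst sqnorm_cmult) (auto simp: field_simps intro: L2_diff test_function_L2 \<phi> f)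
    then show "\<exists>\<psi>\<in>test_functions UNIV. sqnorm (\<lambda>x. \<psi> x - c * f x) < e"
      by (intro bexI[of _ "\<lambda>x. c * \<phi> x"] test_function_cmult \<phi>) (simp add: right_diff_distrib)
  qed
qed

lemma approximable_zero: "approximable (\<lambda>_. 0)"
  using approximable_cmult[OF approximable_test[OF theta_test], of 0] by simp

lemma approximable_diff: "approximable f \<Longrightarrow> approximable g \<Longrightarrow> approximable (\<lambda>x. f x - g x)"
  using approximable_add[of f "\<lambda>x. - 1 * g x"] approximable_cmult[of g "-1"] by simp

lemma approximable_sum:
  assumes "finite A" and "\<And>i. i \<in> A \<Longrightarrow> approximable (f i)"
  shows "approximable (\<lambda>x. \<Sum>i\<in>A. f i x)"
  using assms by (induction A rule: finite_induct) (simp_all add: approximable_zero approximable_add)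

text \<open>The substitution moves the scale from the mollifier to the argument of \<open>f\<close>,
  so that the limit of large \<open>n\<close> can be taken pointwise under a fixed integrable
  weight.\<close>

lemma conv_mollifier:
  assumes f: "locally_integrable f" and n: "n > 0"
  shows "conv f (\<lambda>x. of_real (n ^ 3) * mollifier (n *\<^sub>R x)) x = (LINT y|lborel. f (x - (1 / n) *\<^sub>R y) * mollifier y)"
proof -
  have [measurable]: "f \<in> borel_measurable borel" "mollifier \<in> borel_measurable borel"
    using f smooth_measurable[OF test_function_smooth[OF mollifier_test]] by (auto simp: locally_integrable_def)
  have "conv f (\<lambda>x. of_real (n ^ 3) * mollifier (n *\<^sub>R x)) x
      = \<bar>- 1 / n\<bar> ^ 3 *\<^sub>R (LINT y|lborel. f (x + (- 1 / n) *\<^sub>R y) * (of_real (n ^ 3) * mollifier (n *\<^sub>R (x - (x + (- 1 / n) *\<^sub>R y)))))"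
    unfolding conv_def using n by (intro integral_lborel_affine) auto
  also have "\<dots> = \<bar>- 1 / n\<bar> ^ 3 *\<^sub>R (LINT y|lborel. of_real (n ^ 3) * (f (x - (1 / n) *\<^sub>R y) * mollifier y))"
    using n by (simp add: mult_ac)
  also have "\<dots> = (LINT y|lborel. f (x - (1 / n) *\<^sub>R y) * mollifier y)"
    using n by (simp add: scaleR_conv_of_real power_divide)
  finally show ?thesis .
qed

lemma locally_integrable_bounded:
  assumes [measurable]: "f \<in> borel_measurable borel" and "\<And>x. cmod (f x) \<le> B"
  shows "locally_integrable f"
  unfolding locally_integrable_def
proof (intro conjI assms allI)
  fix R
  have "0 \<le> B"
    using order_trans[OF norm_ge_zero assms(2)] by blast
  then show "integrable lborel (\<lambda>x. indicator (ball 0 R) x *\<^sub>R f x)"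
    by (intro integrable_bounded_support[where B=B and R=R]) (use assms(2) in \<open>auto simp: indicator_def\<close>)
qed

text \<open>Mollified indicators are test functions bounded by 1 on a common ball, and they converge
  off the boundary of the box, which is a null set.\<close>

lemma approximable_box: "approximable (indicator (box a b))"
proof -
  let ?f = "indicator (box a b) :: R3 \<Rightarrow> complex"
  obtain R where R: "\<And>x. x \<in> box a b \<Longrightarrow> norm x \<le> R"
    using bounded_box unfolding bounded_iff by metis
  obtain S where S: "S > 0" "\<And>x. norm x \<ge> S \<Longrightarrow> mollifier x = 0"
    using test_function_support[OF mollifier_test] by blast
  have [measurable]: "mollifier \<in> borel_measurable borel"
    using smooth_measurable[OF test_function_smooth[OF mollifier_test]] .
  have loc: "locally_integrable ?f"
    by (rule locally_integrable_bounded[where B=1]) (auto simp: indicator_def)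
  define g where "g n x = (LINT y|lborel. ?f (x - (1 / real (Suc n)) *\<^sub>R y) * mollifier y)" for n x
  have g_conv: "g n = conv ?f (\<lambda>x. of_real (real (Suc n) ^ 3) * mollifier (real (Suc n) *\<^sub>R x))" for n
    unfolding g_def by (rule ext, subst conv_mollifier[OF loc]) auto
  have mol_int: "integrable lborel (\<lambda>y. cmod (mollifier y))"
    by (intro integrable_norm test_function_integrable mollifier_test)
  have g_le: "cmod (g n x) \<le> 1" for n x
  proof -
    have "cmod (g n x) \<le> (LINT y|lborel. cmod (?f (x - (1 / real (Suc n)) *\<^sub>R y) * mollifier y))"
      unfolding g_def by (rule integral_norm_bound)
    also have "\<dots> \<le> (LINT y|lborel. cmod (mollifier y))"
      by (rule integral_mono_AE'[OF mol_int]) (auto simp: norm_mult indicator_def)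
    finally show ?thesis
      by (simp add: integral_mollifier)
  qed
  have g_supp: "g n x = 0" if "norm x \<ge> R + S + 1" for n x
  proof -
    have "?f (x - (1 / real (Suc n)) *\<^sub>R y) * mollifier y = 0" for y
    proof (rule ccontr)
      assume "?f (x - (1 / real (Suc n)) *\<^sub>R y) * mollifier y \<noteq> 0"
      then have 1: "norm (x - (1 / real (Suc n)) *\<^sub>R y) \<le> R" and 2: "norm y < S"
        using R S by (auto simp: indicator_def not_le[symmetric] split: if_splits)
      have "norm ((1 / real (Suc n)) *\<^sub>R y) \<le> norm y"
        by (simp add: field_simps)
      then show False
        using 1 2 that norm_triangle_ineq2[of x "(1 / real (Suc n)) *\<^sub>R y"] by linarith
    qed
    then show ?thesis
      unfolding g_def by (simp only: Bochner_Integration.integral_zero)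
  qed
  have test: "g n \<in> test_functions UNIV" for n
  proof (rule test_functionI[OF _ g_supp])
    have "(\<lambda>x. mollifier (real (Suc n) *\<^sub>R x)) \<in> test_functions UNIV"
      using test_function_affine[OF mollifier_test, of "real (Suc n)" 0] by simp
    then show "smooth (g n)"
      unfolding g_conv by (intro smooth_conv loc test_function_cmult)
  qed auto
  have lim: "(\<lambda>n. g n x) \<longlonglongrightarrow> ?f x" if "x \<notin> frontier (box a b)" for x
  proof -
    have "(\<lambda>n. g n x) \<longlonglongrightarrow> (LINT y|lborel. ?f x * mollifier y)"
      unfolding g_def
    proof (rule integral_dominated_convergence[OF _ _ mol_int])
      show "AE y in lborel. (\<lambda>n. ?f (x - (1 / real (Suc n)) *\<^sub>R y) * mollifier y) \<longlonglongrightarrow> ?f x * mollifier y"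
      proof (rule AE_I2)
        fix y
        have "(\<lambda>n. x - (1 / real (Suc n)) *\<^sub>R y) \<longlonglongrightarrow> x - 0 *\<^sub>R y"
          using LIMSEQ_inverse_real_of_nat by (intro tendsto_intros) (simp add: inverse_eq_divide)
        then have l: "(\<lambda>n. x - (1 / real (Suc n)) *\<^sub>R y) \<longlonglongrightarrow> x"
          by simp
        have "eventually (\<lambda>n. ?f (x - (1 / real (Suc n)) *\<^sub>R y) = ?f x) sequentially"
        proof (cases "x \<in> box a b")
          case True
          have "eventually (\<lambda>n. x - (1 / real (Suc n)) *\<^sub>R y \<in> box a b) sequentially"
            by (rule topological_tendstoD[OF l open_box True])
          then show ?thesis
            by eventually_elim (use True in simp)
        next
          case False
          then have "x \<in> - closure (box a b)"
            using that by (simp add: frontier_def interior_open[OF open_box])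
          then have "eventually (\<lambda>n. x - (1 / real (Suc n)) *\<^sub>R y \<in> - closure (box a b)) sequentially"
            by (intro topological_tendstoD[OF l]) auto
          then show ?thesis
          proof eventually_elim
            case (elim n)
            then have "x - (1 / real (Suc n)) *\<^sub>R y \<notin> box a b"
              using closure_subset[of "box a b"] by (metis ComplD subsetD)
            then show ?case
              using False by simp
          qed
        qed
        then have "(\<lambda>n. ?f (x - (1 / real (Suc n)) *\<^sub>R y)) \<longlonglongrightarrow> ?f x"
          by (rule tendsto_eventually)
        then show "(\<lambda>n. ?f (x - (1 / real (Suc n)) *\<^sub>R y) * mollifier y) \<longlonglongrightarrow> ?f x * mollifier y"
          by (intro tendsto_intros)
      qed
      show "AE y in lborel. norm (?f (x - (1 / real (Suc n)) *\<^sub>R y) * mollifier y) \<le> cmod (mollifier y)" for n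
        by (intro AE_I2) (auto simp: indicator_def)
    qed measurable
    then show ?thesis
      by (simp add: integral_mollifier)
  qed
  have "frontier (box a b) \<subseteq> cbox a b - box a b"
    by (auto simp: frontier_def interior_open[OF open_box] dest: subsetD[OF closure_minimal[OF box_subset_cbox closed_cbox]])
  then have "negligible (frontier (box a b))"
    using negligible_frontier_interval negligible_subset by blast
  then have "AE x in lebesgue. x \<notin> frontier (box a b)"
    by (simp add: negligible_iff_null_sets AE_not_in)
  then have ae: "AE x in lborel. x \<notin> frontier (box a b)"
    by (simp only: AE_completion_iff)
  have int_ball: "integrable lborel (\<lambda>x :: R3. (indicator (ball 0 (R + S + 1)) x)\<^sup>2 :: real)"
  proof -
    have eq: "(\<lambda>x :: R3. (indicator (ball 0 (R + S + 1)) x)\<^sup>2 :: real) = indicator (ball 0 (R + S + 1))"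
      by (auto simp: indicator_def)
    show ?thesis
      unfolding eq by (rule integrable_indicator_ball)
  qed
  have "(\<lambda>n. sqnorm (\<lambda>x. g n x - ?f x)) \<longlonglongrightarrow> 0"
  proof (rule sqnorm_tendsto_0[OF _ _ _ int_ball])
    show "AE x in lborel. (\<lambda>n. g n x) \<longlonglongrightarrow> ?f x"
      using ae by eventually_elim (rule lim)
    show "AE x in lborel. cmod (g n x) \<le> indicator (ball 0 (R + S + 1)) x" for n
      using g_le[of n] g_supp[of _ n] by (intro AE_I2) (auto simp: indicator_def not_less)
    show "AE x in lborel. cmod (?f x) \<le> indicator (ball 0 (R + S + 1)) x"
      using S(1) by (intro AE_I2) (auto simp: indicator_def dest!: R)
    show "g n \<in> borel_measurable borel" for n
      by (intro smooth_measurable test_function_smooth[OF test])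
  qed auto
  moreover have "?f \<in> L2"
  proof (rule L2I)
    have "integrable lborel (indicator (box a b) :: R3 \<Rightarrow> real)"
      by (intro integrable_real_indicator) (auto simp: emeasure_lborel_box_eq)
    moreover have "(\<lambda>x. (cmod (?f x))\<^sup>2) = indicator (box a b)"
      by (auto simp: indicator_def)
    ultimately show "integrable lborel (\<lambda>x. (cmod (?f x))\<^sup>2)"
      by simp
  qed auto
  ultimately show ?thesis
    using approximable_limit[of ?f g] approximable_test[OF test] by blast
qed

text \<open>Dynkin induction starting from boxes. All sets are cut to one fixed box, since
  complements would otherwise have infinite measure and leave L2.\<close>

lemma approximable_indicator:
  assumes "A \<in> sets borel" shows "approximable (indicator (A \<inter> box a b))"
proof -
  have A: "A \<in> sigma_sets UNIV (range (\<lambda>(a, b). box a b :: R3 set))"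
    using assms by (subst (asm) borel_eq_box) simp
  have I: "Int_stable (range (\<lambda>(a, b). box a b :: R3 set))"
    by (auto simp: Int_stable_def box_Int_box)
  show ?thesis
    using I subset_UNIV[of "range (\<lambda>(a, b). box a b :: R3 set)", folded Pow_UNIV] A
  proof (induction A rule: sigma_sets_induct_disjoint)
    case (basic A)
    then obtain c d where "A = box c d" by auto
    then show ?case
      using approximable_box by (auto simp: box_Int_box)
  next
    case empty
    then show ?case
      using approximable_zero by (simp add: indicator_def[abs_def])
  next
    case (compl A)
    have "indicator ((UNIV - A) \<inter> box a b) = (\<lambda>x. indicator (box a b) x - indicator (A \<inter> box a b) x :: complex)"
      by (auto simp: indicator_def)
    then show ?case
      using approximable_diff[OF approximable_box compl(2)] by simp
  next
    case (union A)
    have Am: "A i \<in> sets borel" for i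
      using union(2) by (subst borel_eq_box) auto
    have box_int: "integrable lborel (indicator (box a b) :: R3 \<Rightarrow> real)"
      by (intro integrable_real_indicator) (auto simp: emeasure_lborel_box_eq)
    define g where "g n x = (\<Sum>i<n. indicator (A i \<inter> box a b) x :: complex)" for n and x :: R3
    have g_eq: "g n = indicator ((\<Union>i<n. A i) \<inter> box a b)" for n
    proof
      fix x
      have "disjoint_family_on (\<lambda>i. A i \<inter> box a b) {..<n}"
        using union(1) by (auto simp: disjoint_family_on_def)
      then show "g n x = indicator ((\<Union>i<n. A i) \<inter> box a b) x"
        unfolding g_def by (subst indicator_UN_disjoint[symmetric]) auto
    qed
    have lim: "(\<lambda>n. sqnorm (\<lambda>x. g n x - indicator ((\<Union>i. A i) \<inter> box a b) x)) \<longlonglongrightarrow> 0"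
    proof (rule sqnorm_tendsto_0[where w="indicator (box a b)"])
      show "AE x in lborel. (\<lambda>n. g n x) \<longlonglongrightarrow> indicator ((\<Union>i. A i) \<inter> box a b) x"
      proof (rule AE_I2, rule tendsto_eventually)
        fix x
        show "eventually (\<lambda>n. g n x = indicator ((\<Union>i. A i) \<inter> box a b) x) sequentially"
        proof (cases "x \<in> (\<Union>i. A i)")
          case True
          then obtain i where "x \<in> A i" by blast
          then have "g n x = indicator ((\<Union>i. A i) \<inter> box a b) x" if "n \<ge> Suc i" for n
            unfolding g_eq using that by (auto simp: indicator_def)
          then show ?thesis
            unfolding eventually_sequentially by blast
        next
          case False
          then show ?thesis
            unfolding g_eq by (auto simp: indicator_def)
        qed
      qed
      show "integrable lborel (\<lambda>x :: R3. (indicator (box a b) x)\<^sup>2 :: real)"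
      proof -
        have "(\<lambda>x :: R3. (indicator (box a b) x)\<^sup>2 :: real) = indicator (box a b)"
          by (auto simp: indicator_def)
        then show ?thesis
          using box_int by simp
      qed
    qed (use Am in \<open>auto simp: g_eq indicator_def intro!: borel_measurable_indicator\<close>)
    have "indicator ((\<Union>i. A i) \<inter> box a b) \<in> L2"
    proof (rule L2I)
      have m: "(\<Union>i. A i) \<inter> box a b \<in> sets borel"
        using Am by auto
      then show "indicator ((\<Union>i. A i) \<inter> box a b) \<in> borel_measurable borel"
        by auto
      have "integrable lborel (indicator ((\<Union>i. A i) \<inter> box a b) :: R3 \<Rightarrow> real)"
        by (rule Bochner_Integration.integrable_bound[OF box_int]) (use m in \<open>auto simp: indicator_def\<close>)
      moreover have "(\<lambda>x. (cmod (indicator ((\<Union>i. A i) \<inter> box a b) x))\<^sup>2) = indicator ((\<Union>i. A i) \<inter> box a b)"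
        by (auto simp: indicator_def)
      ultimately show "integrable lborel (\<lambda>x. (cmod (indicator ((\<Union>i. A i) \<inter> box a b) x))\<^sup>2)"
        by simp
    qed
    moreover have "approximable (g n)" for n
      unfolding g_def by (intro approximable_sum union) auto
    ultimately show ?case
      by (rule approximable_limit[OF _ _ lim])
  qed
qed

text \<open>Simple functions dominated by twice \<open>f\<close> are cut to growing boxes. Each
  level set is then the intersection of a Borel set with a box, and the truncation disappears
  pointwise.\<close>

lemma L2_approximable:
  assumes f: "f \<in> L2" shows "approximable f"
proof -
  note [measurable] = L2D(1)[OF f]
  obtain s where s: "\<And>n. simple_function borel (s n)" "\<And>x. (\<lambda>n. s n x) \<longlonglongrightarrow> f x"
    "\<And>n x. dist (s n x) 0 \<le> 2 * dist (f x) 0"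
    using borel_measurable_implies_sequence_metric[OF L2D(1)[OF f], of 0] by (auto simp: space_borel)
  define U where "U n = (box (\<chi> i. - real n) (\<chi> i. real n) :: R3 set)" for n :: nat
  define g where "g n x = (\<Sum>z\<in>range (s n). z * indicator (s n -` {z} \<inter> U n) x)" for n and x :: R3
  have g_eq: "g n x = s n x * indicator (U n) x" for n x
  proof -
    have "g n x = (\<Sum>z\<in>range (s n). if z = s n x then z * indicator (U n) x else 0)"
      unfolding g_def by (intro sum.cong) (auto simp: indicator_def)
    then show ?thesis
      using simple_functionD(1)[OF s(1)[of n]] by (simp add: space_borel)
  qed
  have ap: "approximable (g n)" for n
    unfolding g_def U_def
  proof (intro approximable_sum approximable_cmult approximable_indicator)
    show "finite (range (s n))"
      using simple_functionD(1)[OF s(1)[of n]] by (simp add: space_borel)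
    show "s n -` {z} \<in> sets borel" for z
      using simple_functionD(2)[OF s(1)[of n], of "{z}"] by (simp add: space_borel)
  qed
  have "(\<lambda>n. sqnorm (\<lambda>x. g n x - f x)) \<longlonglongrightarrow> 0"
  proof (rule sqnorm_tendsto_0[where w="\<lambda>x. 2 * cmod (f x)"])
    show "integrable lborel (\<lambda>x. (2 * cmod (f x))\<^sup>2)"
      using L2D(2)[OF f] by (simp add: power_mult_distrib)
    show "AE x in lborel. cmod (g n x) \<le> 2 * cmod (f x)" for n
      using s(3)[of n] by (intro AE_I2) (auto simp: g_eq indicator_def)
    show "g n \<in> borel_measurable borel" for n
      using ap[of n] L2D(1) by (auto simp: approximable_def)
    show "AE x in lborel. (\<lambda>n. g n x) \<longlonglongrightarrow> f x"
    proof (rule AE_I2)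
      fix x :: R3
      obtain N where N: "norm x < real N"
        using reals_Archimedean2 by blast
      have "x \<in> U n" if "n \<ge> N" for n
      proof -
        have "\<bar>x $ i\<bar> < real n" for i
          using component_le_norm_cart[of x i] N that by linarith
        then show ?thesis
          by (auto simp: U_def mem_box_cart abs_less_iff minus_less_iff)
      qed
      then have "eventually (\<lambda>n. s n x = g n x) sequentially"
        unfolding eventually_sequentially by (auto simp: g_eq intro!: exI[of _ N])
      then show "(\<lambda>n. g n x) \<longlonglongrightarrow> f x"
        using s(2)[of x] by (rule Lim_transform_eventually[rotated])
    qed
  qed auto
  then show ?thesis
    by (rule approximable_limit[OF f ap])
qed

lemma L2_dense:
  assumes f: "f \<in> L2"
  obtains \<psi> where "\<And>n. \<psi> n \<in> test_functions UNIV" and "(\<lambda>n. sqnorm (\<lambda>x. \<psi> n x - f x)) \<longlonglongrightarrow> 0"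
proof -
  have "\<exists>\<psi>\<in>test_functions UNIV. sqnorm (\<lambda>x. \<psi> x - f x) < 1 / real (Suc n)" for n
    using L2_approximable[OF f] by (simp add: approximable_def)
  then obtain \<psi> where \<psi>: "\<And>n. \<psi> n \<in> test_functions UNIV" "\<And>n. sqnorm (\<lambda>x. \<psi> n x - f x) < 1 / real (Suc n)"
    by metis
  have l: "(\<lambda>n. 1 / real (Suc n)) \<longlonglongrightarrow> 0"
    using LIMSEQ_inverse_real_of_nat by (simp add: inverse_eq_divide)
  have "(\<lambda>n. sqnorm (\<lambda>x. \<psi> n x - f x)) \<longlonglongrightarrow> 0"
    by (rule Lim_null_comparison[OF always_eventually l]) (use \<psi>(2) in \<open>auto simp: sqnorm_nonneg less_imp_le\<close>)
  then show ?thesis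
    using that \<psi>(1) by blast
qed

text \<open>Test functions approximating the conjugate of \<open>w\<close> turn the vanishing
  integrals into \<open>sqnorm w\<close>.\<close>

lemma L2_separation:
  assumes w: "w \<in> L2" and 0: "\<And>\<psi>. \<psi> \<in> test_functions UNIV \<Longrightarrow> (LINT x|lborel. w x * \<psi> x) = 0"
  shows "ae_eq w (\<lambda>_. 0)"
proof -
  obtain \<psi> where \<psi>: "\<And>n. \<psi> n \<in> test_functions UNIV" "(\<lambda>n. sqnorm (\<lambda>x. \<psi> n x - cnj (w x))) \<longlonglongrightarrow> 0"
    using L2_dense[OF L2_cnj[OF w]] by blast
  have "(\<lambda>n. LINT x|lborel. \<psi> n x * w x) \<longlonglongrightarrow> (LINT x|lborel. cnj (w x) * w x)"
    by (rule L2_integral_tendsto[OF test_function_L2[OF \<psi>(1)] L2_cnj[OF w] w \<psi>(2)])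
  then have "(LINT x|lborel. cnj (w x) * w x) = 0"
    using 0[OF \<psi>(1)] by (simp add: mult.commute LIMSEQ_const_iff)
  also have "(LINT x|lborel. cnj (w x) * w x) = (LINT x|lborel. complex_of_real ((cmod (w x))\<^sup>2))"
    by (intro Bochner_Integration.integral_cong) (metis complex_norm_square mult.commute)+
  finally have "sqnorm w = 0"
    by (simp only: sqnorm_def integral_complex_of_real of_real_eq_0_iff)
  then show ?thesis
    by (rule sqnorm_eq_0D[OF w])
qed

text \<open>For real \<kappa> the outgoing wave is not square integrable, so comparisons with it
  must be made after cutting off. Countably many radii suffice, which keeps the exceptional set
  null.\<close>

lemma locally_L2_separation:
  assumes w: "\<And>R. R > 0 \<Longrightarrow> (\<lambda>x. w x * scaled R x) \<in> L2"
    and 0: "\<And>\<psi>. \<psi> \<in> test_functions UNIV \<Longrightarrow> (LINT x|lborel. w x * \<psi> x) = 0"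
  shows "ae_eq w (\<lambda>_. 0)"
proof -
  have "ae_eq (\<lambda>x. w x * scaled (real (Suc n)) x) (\<lambda>_. 0)" for n
  proof (rule L2_separation[OF w])
    fix \<psi> :: "R3 \<Rightarrow> complex" assume \<psi>: "\<psi> \<in> test_functions UNIV"
    have "(\<lambda>x. \<psi> x * scaled (real (Suc n)) x) \<in> test_functions UNIV"
      by (intro test_function_mult_smooth \<psi> scaled_smooth)
    from 0[OF this] show "(LINT x|lborel. w x * scaled (real (Suc n)) x * \<psi> x) = 0"
      by (simp add: mult_ac)
  qed simp
  then have "AE x in lborel. \<forall>n. w x * scaled (real (Suc n)) x = 0"
    unfolding AE_all_countable by (simp add: ae_eq_def)
  then show ?thesis
    unfolding ae_eq_def
  proof eventually_elim
    case (elim x)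
    have "filterlim (\<lambda>n. real (Suc n)) at_top sequentially"
      using filterlim_real_sequentially filterlim_Suc by (rule filterlim_compose)
    then have "eventually (\<lambda>n. scaled (real (Suc n)) x = 1) sequentially"
      using scaled_eventually_1[of x] unfolding filterlim_iff by blast
    then obtain n where "scaled (real (Suc n)) x = 1"
      unfolding eventually_sequentially by blast
    then show ?case
      using elim spec[of "\<lambda>n. w x * scaled (real (Suc n)) x = 0" n] by simp
  qed
qed

end

section \<open>Square integrable solutions\<close>

lemma norm_outgoing: "cmod (outgoing \<kappa> x) = exp (- Im \<kappa> * norm x) / norm x"
  by (simp add: outgoing_def norm_divide)

lemma norm_outgoing_le:
  assumes "Im \<kappa> \<ge> 0" shows "cmod (outgoing \<kappa> x) \<le> 1 / norm x"
proof -
  have "exp (- Im \<kappa> * norm x) \<le> 1"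
    using assms by (simp add: mult_nonneg_nonneg)
  then show ?thesis
    unfolding norm_outgoing by (intro divide_right_mono) auto
qed

lemma locally_integrable_outgoing:
  assumes "Im \<kappa> \<ge> 0" shows "locally_integrable (outgoing \<kappa>)"
  unfolding locally_integrable_def
proof (intro conjI allI)
  fix R
  show "integrable lborel (\<lambda>x. indicator (ball 0 R) x *\<^sub>R outgoing \<kappa> x)"
  proof (rule Bochner_Integration.integrable_bound[OF integrable_inverse_norm_ball[of R]])
    show "AE x in lborel. norm (indicator (ball 0 R) x *\<^sub>R outgoing \<kappa> x) \<le> norm (indicator {..R} (norm x) / norm x)"
      using norm_outgoing_le[OF assms] by (intro AE_I2) (auto simp: indicator_def)
  qed (auto intro!: borel_measurable_scaleR borel_measurable_indicator measurable_outgoing)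
qed (rule measurable_outgoing)

lemma outgoing_L2:
  assumes "Im \<kappa> > 0" shows "outgoing \<kappa> \<in> L2"
  by (rule L2I) (use integrable_exp_norm_square[OF assms] in \<open>auto simp: norm_outgoing\<close>)

lemma outgoing_integrable:
  assumes "Im \<kappa> > 0" shows "integrable lborel (outgoing \<kappa>)"
  using integrable_exp_norm[OF assms]
  by (rule Bochner_Integration.integrable_bound) (auto simp: norm_outgoing)

lemma outgoing_not_L2:
  assumes "Im \<kappa> = 0" shows "outgoing \<kappa> \<notin> L2"
  using not_integrable_inverse_norm_square L2D(2)[of "outgoing \<kappa>"] assms
  by (auto simp: norm_outgoing power_divide)

lemma integral_laplacian_zero:
  assumes "\<psi> \<in> test_functions UNIV" shows "(LINT x|lborel. laplacian \<psi> x) = 0"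
proof -
  have "(LINT x|lborel. 1 * partial i (partial i \<psi>) x) = - (LINT x|lborel. 0 * partial i \<psi> x)" for i
    by (rule integral_by_parts) (auto intro: test_function_partial assms)
  then show ?thesis
    unfolding laplacian_def
    by (subst Bochner_Integration.integral_sum) (auto intro!: test_function_integrable test_function_partial assms)
qed

lemma laplacian_reflect:
  assumes "smooth \<psi>" shows "laplacian (\<lambda>y. \<psi> (x - y)) y = laplacian \<psi> (x - y)"
proof -
  have "partial i (\<lambda>y. \<psi> (x - y)) = (\<lambda>y. - partial i \<psi> (x - y))" if "smooth \<psi>" for \<psi> i
    using smooth_affine_partial[OF that, of i "-1" x] by simp
  moreover have "smooth (\<lambda>y. partial i \<psi> (x - y))" for i
    using smooth_affine[where c="-1" and a=x, OF smooth_partial[OF assms]] by simp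
  ultimately show ?thesis
    unfolding laplacian_def by (simp add: assms smooth_partial smooth_uminus_partial)
qed

text \<open>The derivatives fall on \<psi>; what remains is the fundamental solution tested with the
  reflected function \<open>\<lambda>y. \<psi> (x - y)\<close>, whose value at 0 is
  \<open>\<psi> x\<close>.\<close>

lemma helmholtz_conv_outgoing:
  assumes \<kappa>: "Im \<kappa> \<ge> 0" and \<psi>: "\<psi> \<in> test_functions UNIV"
  shows "laplacian (conv (outgoing \<kappa>) \<psi>) x + \<kappa>\<^sup>2 * conv (outgoing \<kappa>) \<psi> x = - of_real delta_mass * \<psi> x"
proof -
  note loc = locally_integrable_outgoing[OF \<kappa>]
  have "laplacian (conv (outgoing \<kappa>) \<psi>) x + \<kappa>\<^sup>2 * conv (outgoing \<kappa>) \<psi> x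
      = (LINT y|lborel. outgoing \<kappa> y * laplacian \<psi> (x - y)) + (LINT y|lborel. outgoing \<kappa> y * (\<kappa>\<^sup>2 * \<psi> (x - y)))"
    unfolding laplacian_conv[OF loc \<psi>] conv_def
    by (subst integral_mult_right_zero[symmetric]) (simp add: mult.left_commute)
  also have "\<dots> = (LINT y|lborel. outgoing \<kappa> y * (laplacian \<psi> (x - y) + \<kappa>\<^sup>2 * \<psi> (x - y)))"
    using conv_integrable[OF loc test_function_laplacian[OF \<psi>]] conv_integrable[OF loc test_function_cmult[OF \<psi>]]
    by (simp add: distrib_left)
  also have "\<dots> = (LINT y|lborel. outgoing \<kappa> y * (laplacian (\<lambda>y. \<psi> (x - y)) y + \<kappa>\<^sup>2 * \<psi> (x - y)))"
    by (simp add: laplacian_reflect test_function_smooth[OF \<psi>])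
  also have "\<dots> = - of_real delta_mass * \<psi> x"
    using fundamental_solution[OF test_function_reflect[OF \<psi>, of x], of \<kappa>] by simp
  finally show ?thesis .
qed

text \<open>When |x| is at least twice the radius of the support, only points y with |y| at least
  |x|/2 contribute. Because \<kappa> may be real, no better rate than 1/|x| holds in
  general.\<close>

lemma conv_outgoing_decay:
  assumes \<kappa>: "Im \<kappa> \<ge> 0" and \<psi>: "\<psi> \<in> test_functions UNIV"
  obtains C M where "C \<ge> 0" "M > 0" "\<And>x. norm x \<ge> M \<Longrightarrow> cmod (conv (outgoing \<kappa>) \<psi> x) \<le> C / norm x"
proof -
  obtain S where S: "S > 0" "\<And>x. norm x \<ge> S \<Longrightarrow> \<psi> x = 0"
    using test_function_support[OF \<psi>] by blast
  define N where "N = (LINT y|lborel. cmod (\<psi> y))"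
  have int: "integrable lborel (\<lambda>y. cmod (\<psi> y))"
    by (intro integrable_norm test_function_integrable \<psi>)
  have "cmod (conv (outgoing \<kappa>) \<psi> x) \<le> 2 * N / norm x" if x: "norm x \<ge> 2 * S" for x
  proof -
    have "cmod (conv (outgoing \<kappa>) \<psi> x) \<le> (LINT y|lborel. cmod (outgoing \<kappa> y * \<psi> (x - y)))"
      unfolding conv_def by (rule integral_norm_bound)
    also have "\<dots> \<le> (LINT y|lborel. 2 / norm x * cmod (\<psi> (x - y)))"
    proof (rule integral_mono_AE)
      show "integrable lborel (\<lambda>y. cmod (outgoing \<kappa> y * \<psi> (x - y)))"
        by (intro integrable_norm conv_integrable locally_integrable_outgoing \<kappa> \<psi>)
      show "integrable lborel (\<lambda>y. 2 / norm x * cmod (\<psi> (x - y)))"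
        using integrable_lborel_reflect[OF int, of x] by simp
      have "cmod (outgoing \<kappa> y * \<psi> (x - y)) \<le> 2 / norm x * cmod (\<psi> (x - y))" for y
      proof (cases "norm (x - y) < S")
        case True
        have "norm y \<ge> norm x / 2"
          using True x norm_triangle_ineq2[of x "x - y"] by simp
        moreover have "norm x > 0"
          using x S(1) by linarith
        ultimately have "1 / norm y \<le> 1 / (norm x / 2)"
          by (intro divide_left_mono mult_pos_pos) auto
        then have "cmod (outgoing \<kappa> y) \<le> 2 / norm x"
          using norm_outgoing_le[OF \<kappa>, of y] by simp
        then show ?thesis
          by (simp only: norm_mult mult_right_mono norm_ge_zero)
      qed (use S(2) in simp)
      then show "AE y in lborel. cmod (outgoing \<kappa> y * \<psi> (x - y)) \<le> 2 / norm x * cmod (\<psi> (x - y))"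
        by simp
    qed
    also have "\<dots> = 2 / norm x * N"
      using integral_lborel_reflect[of "\<lambda>y. cmod (\<psi> y)" x] int by (simp add: N_def)
    finally show ?thesis by simp
  qed
  moreover have "N \<ge> 0"
    by (simp add: N_def)
  ultimately show ?thesis
    using that[of "2 * N" "2 * S"] S(1) by simp
qed

lemma partials_const: "is \<noteq> [] \<Longrightarrow> partials is (\<lambda>_. c) = (\<lambda>_. 0)"
proof (induction "is")
  case (Cons i "is")
  then show ?case
    by (cases "is = []") simp_all
qed simp

section \<open>Functions in the adjoint domain and uniqueness for point sources\<close>

context cutoff
begin

lemma theta_near_0:
  "\<exists>a>0. (\<forall>x. norm x < a \<longrightarrow> \<theta> x = 1) \<and> (\<forall>is x. norm x < a \<longrightarrow> is \<noteq> [] \<longrightarrow> partials is \<theta> x = 0)"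
proof -
  obtain a where a: "a > 0" "\<And>x. norm x < a \<Longrightarrow> \<theta> x = 1"
    using theta_one_ball by blast
  have "partials is \<theta> x = 0" if "norm x < a" "is \<noteq> []" for "is" x
  proof -
    have "partials is \<theta> x = partials is (\<lambda>_. 1) x"
      using that a by (intro partials_cong_open[of "ball 0 a"]) auto
    then show ?thesis
      using partials_const[OF that(2)] by simp
  qed
  then show ?thesis
    using a by metis
qed

text \<open>Cutting a test function off near the origin makes it admissible in the definition of the adjoint,
  so only the behaviour of \<open>u\<close> at the origin contributes to the right-hand side.\<close>
lemma adjoint_distribution:
  assumes adj: "(u, w) \<in> adjoint L_min"
    and u: "ae_eq u (\<lambda>x. \<theta> x * \<beta> * of_real (1 / norm x + \<mu>) + f x)" and f: "f \<in> W22"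
    and \<phi>: "\<phi> \<in> test_functions UNIV"
  shows "(LINT x|lborel. u x * laplacian \<phi> x) = - of_real delta_mass * \<beta> * \<phi> 0 - (LINT x|lborel. w x * \<phi> x)"
proof -
  have L2: "u \<in> L2" "w \<in> L2" "f \<in> L2"
    using adj f by (auto simp: adjoint_def W22_def)
  note [measurable] = L2[THEN L2D(1)]
  \<comment> \<open>The adjoint relation is sesquilinear; inserting the conjugate of \<psi> turns it
    into an identity between bilinear integrals.\<close>
  have away: "(LINT x|lborel. u x * laplacian \<psi> x) = - (LINT x|lborel. w x * \<psi> x)"
    if \<psi>: "\<psi> \<in> test_functions (- {0})" for \<psi>
  proof -
    have sm: "smooth \<psi>"
      using \<psi> by (rule test_function_smooth)
    have "(\<lambda>x. cnj (\<psi> x), \<lambda>x. - laplacian (\<lambda>x. cnj (\<psi> x)) x) \<in> L_min"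
      using test_function_cnj[OF \<psi>] by (auto simp: L_min_def laplacian_def)
    then have "L2_inner (\<lambda>x. - laplacian (\<lambda>x. cnj (\<psi> x)) x) u = L2_inner (\<lambda>x. cnj (\<psi> x)) w"
      using adj unfolding adjoint_def by fastforce
    then have "(LINT x|lborel. cnj (- (u x * laplacian \<psi> x))) = (LINT x|lborel. cnj (w x * \<psi> x))"
      by (simp add: L2_inner_def laplacian_cnj[OF sm] mult.commute)
    then have "cnj (LINT x|lborel. - (u x * laplacian \<psi> x)) = cnj (LINT x|lborel. w x * \<psi> x)"
      by (simp only: Bochner_Integration.integral_cnj)
    then have "- (LINT x|lborel. u x * laplacian \<psi> x) = (LINT x|lborel. w x * \<psi> x)"
      unfolding complex_cnj_cancel_iff by simp
    then show ?thesis
      by (metis minus_minus)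
  qed
  have "\<forall>i. \<exists>g\<in>L2. weak_partials [i, i] f g"
    using f unfolding W22_def by simp
  then obtain g where g: "\<And>i. g i \<in> L2" "\<And>i. weak_partials [i, i] f (g i)"
    by metis
  \<comment> \<open>\<open>G\<close> represents the Laplacian of \<open>f\<close> plus
    \<open>w\<close>. Being locally integrable, it contributes nothing in the limit when tested with
    cut-offs that shrink to the origin.\<close>
  define G where "G x = (\<Sum>i\<in>UNIV. g i x) + w x" for x
  have G_f: "(LINT x|lborel. f x * laplacian \<psi> x) + (LINT x|lborel. w x * \<psi> x) = (LINT x|lborel. G x * \<psi> x)"
    if \<psi>: "\<psi> \<in> test_functions UNIV" for \<psi>
  proof -
    note \<psi>L = test_function_L2[OF \<psi>] and \<psi>iL = test_function_L2[OF test_function_partial[OF test_function_partial[OF \<psi>]]]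
    have "(LINT x|lborel. f x * laplacian \<psi> x) = (\<Sum>i\<in>UNIV. LINT x|lborel. f x * partial i (partial i \<psi>) x)"
      unfolding laplacian_def sum_distrib_left by (intro Bochner_Integration.integral_sum L2_mult_integrable(1) L2 \<psi>iL)
    also have "\<dots> = (\<Sum>i\<in>UNIV. LINT x|lborel. g i x * \<psi> x)"
      using g(2) \<psi> unfolding weak_partials_def by simp
    finally show ?thesis
      using L2_mult_integrable(1)[OF g(1) \<psi>L] L2_mult_integrable(1)[OF L2(2) \<psi>L]
      by (simp add: G_def distrib_right sum_distrib_right)
  qed
  have Gint: "integrable lborel (\<lambda>x. G x * \<phi> x)"
    unfolding G_def distrib_right sum_distrib_right
    by (intro Bochner_Integration.integrable_add Bochner_Integration.integrable_sum L2_mult_integrable(1) g L2 test_function_L2 \<phi>)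
  obtain a where a: "a > 0" "\<And>x. norm x < a \<Longrightarrow> \<theta> x = 1"
    using theta_one_ball by blast
  obtain b where b: "b > 0" "\<And>x. norm x \<ge> b \<Longrightarrow> \<theta> x = 0"
    using test_function_support[OF theta_test] by blast
  obtain B where B: "B > 0" "\<And>x. cmod (\<theta> x) \<le> B"
    using test_function_bounded[OF theta_test] by blast
  \<comment> \<open>The defect of the claimed identity. It does not depend on \<epsilon>, while the
    next step expresses it by an integral over a neighbourhood of size proportional to
    \<epsilon>.\<close>
  define T where "T = (LINT x|lborel. u x * laplacian \<phi> x) + (LINT x|lborel. w x * \<phi> x) + of_real delta_mass * \<beta> * \<phi> 0"
  have T: "T = (LINT x|lborel. G x * (\<phi> x * scaled \<epsilon> x))" if \<epsilon>: "\<epsilon> > 0" "\<epsilon> * b < a" for \<epsilon>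
  proof -
    \<comment> \<open>\<phi> is split into \<psi>, concentrated near the origin, and a remainder
      that vanishes there, to which the adjoint relation applies.\<close>
    define \<psi> where "\<psi> x = \<phi> x * scaled \<epsilon> x" for x
    define \<psi>' where "\<psi>' x = \<phi> x + (- 1) * \<psi> x" for x
    have \<psi>: "\<psi> \<in> test_functions UNIV"
      unfolding \<psi>_def by (intro test_function_mult_smooth \<phi> scaled_smooth)
    have \<psi>': "\<psi>' \<in> test_functions UNIV"
      unfolding \<psi>'_def by (intro test_function_add test_function_cmult \<phi> \<psi>)
    have one: "scaled \<epsilon> x = 1" if "norm x < \<epsilon> * a" for x
      unfolding scaled_def using that \<epsilon> by (intro a) (simp add: field_simps)
    have "\<psi>' \<in> test_functions (- {0})"
      by (rule test_functionI0[OF \<psi>', of "ball 0 (\<epsilon> * a)"]) (use one \<epsilon> a in \<open>auto simp: \<psi>'_def \<psi>_def\<close>)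
    from away[OF this] have "(LINT x|lborel. u x * laplacian \<psi>' x) + (LINT x|lborel. w x * \<psi>' x) = 0"
      by simp
    moreover have "laplacian \<psi>' x = laplacian \<phi> x - laplacian \<psi> x" for x
      unfolding \<psi>'_def laplacian_def
      by (simp only: smooth_add_partial smooth_cmult_partial smooth_mult smooth_const smooth_partial test_function_smooth[OF \<phi>] test_function_smooth[OF \<psi>])
        (simp add: sum_subtractf)
    ultimately have "(LINT x|lborel. u x * laplacian \<phi> x) - (LINT x|lborel. u x * laplacian \<psi> x)
        + ((LINT x|lborel. w x * \<phi> x) - (LINT x|lborel. w x * \<psi> x)) = 0"
      using L2_mult_integrable(1)[OF L2(1) test_function_L2[OF test_function_laplacian[OF \<phi>]]]
        L2_mult_integrable(1)[OF L2(1) test_function_L2[OF test_function_laplacian[OF \<psi>]]]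
        L2_mult_integrable(1)[OF L2(2) test_function_L2[OF \<phi>]] L2_mult_integrable(1)[OF L2(2) test_function_L2[OF \<psi>]]
      by (simp add: \<psi>'_def right_diff_distrib)
    moreover have "a + c = b + d" if "a - b + (c - d) = 0" for a b c d :: complex
      using that by algebra
    ultimately have "(LINT x|lborel. u x * laplacian \<phi> x) + (LINT x|lborel. w x * \<phi> x)
        = (LINT x|lborel. u x * laplacian \<psi> x) + (LINT x|lborel. w x * \<psi> x)"
      by blast
    moreover have "(LINT x|lborel. u x * laplacian \<psi> x) = - of_real delta_mass * \<beta> * \<phi> 0 + (LINT x|lborel. f x * laplacian \<psi> x)"
    proof -
      note l\<psi> = test_function_laplacian[OF \<psi>]
      note locint = locally_integrable_mult_test[OF locally_integrable_outgoing[of 0] l\<psi>]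
      have sup: "\<theta> x * laplacian \<psi> x = laplacian \<psi> x" for x
      proof (cases "norm x < a")
        case False
        have "\<psi> y = 0" if "norm y \<ge> \<epsilon> * b" for y
          unfolding \<psi>_def scaled_def using b(2)[of "(1 / \<epsilon>) *\<^sub>R y"] that \<epsilon>(1) by (simp add: field_simps)
        then have "partials [i, i] \<psi> x = 0" for i
          using False \<epsilon>(2) by (intro partials_support[of "\<epsilon> * b"]) auto
        then show ?thesis
          by (simp add: laplacian_def)
      qed (use a in simp)
      have "(LINT x|lborel. u x * laplacian \<psi> x) = (LINT x|lborel. (\<theta> x * \<beta> * of_real (1 / norm x + \<mu>) + f x) * laplacian \<psi> x)"
      proof (rule integral_cong_AE)
        show "AE x in lborel. u x * laplacian \<psi> x = (\<theta> x * \<beta> * of_real (1 / norm x + \<mu>) + f x) * laplacian \<psi> x"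
          using u unfolding ae_eq_def by eventually_elim simp
      qed (use smooth_measurable test_function_smooth[OF theta_test] test_function_smooth[OF l\<psi>] in measurable)
      also have "\<dots> = (LINT x|lborel. \<beta> * (outgoing 0 x * laplacian \<psi> x) + \<beta> * of_real \<mu> * laplacian \<psi> x + f x * laplacian \<psi> x)"
      proof (intro Bochner_Integration.integral_cong refl)
        fix x
        have "(\<theta> x * \<beta> * of_real (1 / norm x + \<mu>) + f x) * laplacian \<psi> x
            = \<beta> * of_real (1 / norm x + \<mu>) * (\<theta> x * laplacian \<psi> x) + f x * laplacian \<psi> x"
          by (simp add: algebra_simps)
        then show "(\<theta> x * \<beta> * of_real (1 / norm x + \<mu>) + f x) * laplacian \<psi> x
            = \<beta> * (outgoing 0 x * laplacian \<psi> x) + \<beta> * of_real \<mu> * laplacian \<psi> x + f x * laplacian \<psi> x"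
          unfolding sup by (simp add: outgoing_def algebra_simps)
      qed
      \<comment> \<open>The constant \<mu> is multiplied by the integral of a Laplacian, which is
        zero: the equation sees only 1/|x|, and \<mu> acts through the boundary value alone.\<close>
      also have "\<dots> = \<beta> * (LINT x|lborel. outgoing 0 x * laplacian \<psi> x) + \<beta> * of_real \<mu> * (LINT x|lborel. laplacian \<psi> x)
          + (LINT x|lborel. f x * laplacian \<psi> x)"
        using locint test_function_integrable[OF l\<psi>] L2_mult_integrable(1)[OF L2(3) test_function_L2[OF l\<psi>]] by simp
      also have "(LINT x|lborel. outgoing 0 x * laplacian \<psi> x) = - of_real delta_mass * \<phi> 0"
        using fundamental_solution[OF \<psi>, of 0] one[of 0] \<epsilon> a(1) by (simp add: \<psi>_def)
      finally show ?thesis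
        by (simp add: integral_laplacian_zero[OF \<psi>])
    qed
    ultimately show ?thesis
      using G_f[OF \<psi>] by (simp add: T_def \<psi>_def)
  qed
  \<comment> \<open>The factor \<open>a / (2 * b)\<close> guarantees
    \<open>\<epsilon> n * b < a\<close> from \<open>n = 0\<close> on.\<close>
  define \<epsilon> where "\<epsilon> n = a / (2 * b) * inverse (real (Suc n))" for n
  have \<epsilon>: "\<epsilon> n > 0" "\<epsilon> n * b < a" for n
  proof -
    show "\<epsilon> n > 0"
      using a b by (simp add: \<epsilon>_def)
    have "\<epsilon> n * b = a / (2 * real (Suc n))"
      using b(1) by (simp add: \<epsilon>_def inverse_eq_divide del: of_nat_Suc)
    also have "\<dots> < a / 1"
      using a(1) by (intro divide_strict_left_mono) auto
    finally show "\<epsilon> n * b < a" by simp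
  qed
  have [measurable]: "\<phi> \<in> borel_measurable borel" "scaled r \<in> borel_measurable borel" for r
    using smooth_measurable test_function_smooth[OF \<phi>] scaled_smooth by blast+
  have [measurable]: "G \<in> borel_measurable borel"
    unfolding G_def using g(1)[THEN L2D(1)] by measurable
  have "(\<lambda>n. LINT x|lborel. G x * (\<phi> x * scaled (\<epsilon> n) x)) \<longlonglongrightarrow> (LINT x|(lborel :: R3 measure). 0)"
  proof (rule integral_dominated_convergence[where w="\<lambda>x. B * cmod (G x * \<phi> x)"])
    show "integrable lborel (\<lambda>x. B * cmod (G x * \<phi> x))"
      by (intro integrable_mult_right integrable_norm Gint)
    have ae: "AE x in lborel. x \<noteq> (0 :: R3)"
      by (rule AE_lborel_singleton)
    then show "AE x in lborel. (\<lambda>n. G x * (\<phi> x * scaled (\<epsilon> n) x)) \<longlonglongrightarrow> 0"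
    proof eventually_elim
      case (elim x)
      have "\<epsilon> \<longlonglongrightarrow> 0"
        unfolding \<epsilon>_def[abs_def] using tendsto_mult[OF tendsto_const LIMSEQ_inverse_real_of_nat, of "a / (2 * b)"] by simp
      then have "eventually (\<lambda>n. \<epsilon> n < norm x / b) sequentially"
        using elim b(1) by (intro order_tendstoD) auto
      then have "eventually (\<lambda>n. G x * (\<phi> x * scaled (\<epsilon> n) x) = 0) sequentially"
      proof eventually_elim
        case (elim n)
        then have "scaled (\<epsilon> n) x = 0"
          unfolding scaled_def using b(1) \<epsilon>(1)[of n] by (intro b(2)) (simp add: field_simps)
        then show ?case by simp
      qed
      then show ?case
        by (rule tendsto_eventually)
    qed
    show "AE x in lborel. norm (G x * (\<phi> x * scaled (\<epsilon> n) x)) \<le> B * cmod (G x * \<phi> x)" for n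
    proof (rule AE_I2)
      fix x
      have "cmod (G x * \<phi> x) * cmod (scaled (\<epsilon> n) x) \<le> cmod (G x * \<phi> x) * B"
        unfolding scaled_def by (intro mult_left_mono B) auto
      then show "norm (G x * (\<phi> x * scaled (\<epsilon> n) x)) \<le> B * cmod (G x * \<phi> x)"
        by (simp add: norm_mult mult_ac)
    qed
  qed measurable
  then have "T = 0"
    using T[OF \<epsilon>] by (simp add: LIMSEQ_const_iff)
  then show ?thesis
    unfolding T_def by (simp add: algebra_simps eq_neg_iff_add_eq_0)
qed

text \<open>In dimension three the inverse square of the norm is locally integrable, so the
  singularity at the origin is harmless in L2, and the cut-off disposes of infinity.\<close>

lemma outgoing_scaled_L2:
  assumes \<kappa>: "Im \<kappa> \<ge> 0" and "R > 0" shows "(\<lambda>x. outgoing \<kappa> x * scaled R x) \<in> L2"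
proof (rule L2I)
  obtain S where S: "S > 0" "\<And>x. norm x \<ge> S \<Longrightarrow> scaled R x = 0"
    using test_function_support[OF scaled_test[OF assms(2)]] by blast
  obtain B where B: "B > 0" "\<And>x. cmod (scaled R x) \<le> B"
    using test_function_bounded[OF scaled_test[OF assms(2)]] by blast
  have [measurable]: "scaled R \<in> borel_measurable borel"
    using smooth_measurable scaled_smooth by blast
  show "(\<lambda>x. outgoing \<kappa> x * scaled R x) \<in> borel_measurable borel"
    by measurable
  have "integrable lborel (\<lambda>x :: R3. B\<^sup>2 * (indicator {..S} (norm x) / (norm x)\<^sup>2))"
    by (intro integrable_mult_right integrable_inverse_norm_square_ball)
  then show "integrable lborel (\<lambda>x. (cmod (outgoing \<kappa> x * scaled R x))\<^sup>2)"
  proof (rule Bochner_Integration.integrable_bound)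
    have "(cmod (outgoing \<kappa> x * scaled R x))\<^sup>2 \<le> B\<^sup>2 * (indicator {..S} (norm x) / (norm x)\<^sup>2)" for x
    proof (cases "norm x < S")
      case True
      have "cmod (outgoing \<kappa> x * scaled R x) \<le> 1 / norm x * B"
        unfolding norm_mult by (intro mult_mono norm_outgoing_le \<kappa> B) auto
      then have "(cmod (outgoing \<kappa> x * scaled R x))\<^sup>2 \<le> (1 / norm x * B)\<^sup>2"
        by (intro power_mono) auto
      then show ?thesis
        using True by (simp add: power_mult_distrib power_divide)
    qed (use S in simp)
    then show "AE x in lborel. norm ((cmod (outgoing \<kappa> x * scaled R x))\<^sup>2) \<le> norm (B\<^sup>2 * (indicator {..S} (norm x) / (norm x)\<^sup>2))"
      by (intro AE_I2) simp
  qed measurable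
qed

text \<open>A solution is tested against the cut-off of the outgoing solution for the source \<open>\<psi>\<close>.
  The commutator terms are of size \<open>R\<^sup>-\<^sup>2\<close> on a ball of radius of order \<open>R\<close>, so their
  \<open>L\<^sup>2\<close> norm vanishes as \<open>R \<rightarrow> \<infinity>\<close>, even for real \<open>\<kappa>\<close>.\<close>
lemma helmholtz_point_source_unique:
  assumes \<kappa>: "Im \<kappa> \<ge> 0" and u: "u \<in> L2"
    and eq: "\<And>\<phi>. \<phi> \<in> test_functions UNIV \<Longrightarrow>
      (LINT x|lborel. u x * (laplacian \<phi> x + \<kappa>\<^sup>2 * \<phi> x)) = - of_real delta_mass * \<beta> * \<phi> 0"
  shows "ae_eq u (\<lambda>x. \<beta> * outgoing \<kappa> x)"
proof -
  note loc = locally_integrable_outgoing[OF \<kappa>]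
  have key: "(LINT x|lborel. u x * \<psi> x) = \<beta> * (LINT x|lborel. outgoing \<kappa> x * \<psi> x)"
    if \<psi>: "\<psi> \<in> test_functions UNIV" for \<psi>
  proof -
    define h where "h = conv (outgoing \<kappa>) \<psi>"
    have h: "smooth h" and hi: "\<And>i. partial i h = conv (outgoing \<kappa>) (partial i \<psi>)"
      unfolding h_def using smooth_conv[OF loc \<psi>] partial_conv[OF loc \<psi>] by auto
    obtain C0 M0 where C0: "C0 \<ge> 0" "M0 > 0" "\<And>x. norm x \<ge> M0 \<Longrightarrow> cmod (h x) \<le> C0 / norm x"
      using conv_outgoing_decay[OF \<kappa> \<psi>] unfolding h_def by metis
    have "\<forall>i. \<exists>C M. C \<ge> 0 \<and> M > 0 \<and> (\<forall>x. norm x \<ge> M \<longrightarrow> cmod (partial i h x) \<le> C / norm x)"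
      unfolding hi using conv_outgoing_decay[OF \<kappa> test_function_partial[OF \<psi>]] by metis
    then obtain C1 M1 where C1: "\<And>i. C1 i \<ge> 0" "\<And>i x. norm x \<ge> M1 i \<Longrightarrow> cmod (partial i h x) \<le> C1 i / norm x"
      by metis
    obtain a where a: "a > 0" "\<And>x. norm x < a \<Longrightarrow> \<theta> x = 1"
      and in0: "\<And>is x. norm x < a \<Longrightarrow> is \<noteq> [] \<Longrightarrow> partials is \<theta> x = 0"
      using theta_near_0 by metis
    obtain b where b: "b > 0" "\<And>x. norm x \<ge> b \<Longrightarrow> \<theta> x = 0"
      using test_function_support[OF theta_test] by blast
    have "\<forall>i. \<exists>B. \<forall>x. cmod (partial i \<theta> x) \<le> B"
      using test_function_bounded[OF test_function_partial[OF theta_test]] by metis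
    then obtain B1 where B1: "\<And>i x. cmod (partial i \<theta> x) \<le> B1 i"
      by metis
    obtain B2 where B2: "B2 > 0" "\<And>x. cmod (laplacian \<theta> x) \<le> B2"
      using test_function_bounded[OF test_function_laplacian[OF theta_test]] by blast
    obtain S where S: "S > 0" "\<And>x. norm x \<ge> S \<Longrightarrow> \<psi> x = 0"
      using test_function_support[OF \<psi>] by blast
    have out0: "partials is \<theta> x = 0" if "norm x > b" for "is" x
      using partials_support[of b \<theta> x "is"] b(2) that by blast
    \<comment> \<open>The commutator of the Laplacian with the cut-off, applied to \<open>h\<close>.
      It lives on the shell where |x| lies between \<open>a * R\<close> and
      \<open>b * R\<close>.\<close>
    define E where "E R x = 2 * (\<Sum>i\<in>UNIV. partial i (scaled R) x * partial i h x) + laplacian (scaled R) x * h x" for R x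
    \<comment> \<open>From radius \<open>m\<close> on, the shell lies in the range of the decay
      bounds for \<open>h\<close> and its partials, the cut-off equals 1 on the support of \<psi>,
      and \<open>R\<close> is at least 1.\<close>
    define m where "m = Max (insert 1 (insert (M0 / a) (insert (S / a) (range (\<lambda>i. M1 i / a)))))"
    have m: "1 \<le> m" "M0 / a \<le> m" "S / a \<le> m" "M1 i / a \<le> m" for i
      unfolding m_def by (intro Max_ge; auto)+
    \<comment> \<open>A first derivative of the cut-off and one of \<open>h\<close> contribute a
      factor 1/R each. The Laplacian of the cut-off already has two, and the extra factor 1/R from
      \<open>h\<close> is estimated by 1.\<close>
    define Q where "Q = 2 * (\<Sum>i\<in>UNIV. B1 i * (C1 i / a)) + B2 * (C0 / a)"
    have E_bound: "cmod (E R x) \<le> Q / R\<^sup>2" if R: "R \<ge> m" for R x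
    proof (cases "norm x < a * R \<or> norm x > b * R")
      case True
      have R0: "R > 0"
        using m(1) R by linarith
      have "norm ((1 / R) *\<^sub>R x) < a \<or> norm ((1 / R) *\<^sub>R x) > b"
        using True R0 by (simp add: field_simps)
      then have "partials is \<theta> ((1 / R) *\<^sub>R x) = 0" if "is \<noteq> []" for "is"
        using in0 out0 that by blast
      from this[of "[i]" for i] this[of "[i, i]" for i] have "E R x = 0"
        unfolding E_def partial_scaled laplacian_scaled by (simp add: laplacian_def)
      moreover have "Q \<ge> 0"
        using B2 C0 C1 a(1) order_trans[OF norm_ge_zero B1] unfolding Q_def
        by (intro add_nonneg_nonneg mult_nonneg_nonneg sum_nonneg divide_nonneg_pos) auto
      ultimately show ?thesis by simp
    next
      case False
      then have x: "norm x \<ge> a * R" by simp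
      have R0: "R > 0" "R \<ge> 1"
        using m(1) R by linarith+
      have aR: "a * R > 0"
        using a(1) R0 by simp
      have "a * R \<ge> M0" "a * R \<ge> M1 i" for i
        using m(2) m(4)[of i] R a(1) by (auto simp: field_simps intro: order_trans)
      then have h_le: "cmod (h x) \<le> C0 / norm x" "cmod (partial i h x) \<le> C1 i / norm x" for i
        using x by (auto intro: C0 C1 order_trans)
      have h_le': "cmod (h x) \<le> C0 / a / R" "cmod (partial i h x) \<le> C1 i / a / R" for i
      proof -
        have "C0 / norm x \<le> C0 / (a * R)" "C1 i / norm x \<le> C1 i / (a * R)"
          using x aR C0(1) C1(1)[of i] by (auto intro!: divide_left_mono mult_pos_pos)
        then show "cmod (h x) \<le> C0 / a / R" "cmod (partial i h x) \<le> C1 i / a / R"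
          using h_le(1) h_le(2)[of i] by simp_all
      qed
      have t: "cmod (partial i (scaled R) x * partial i h x) \<le> B1 i * (C1 i / a) / R\<^sup>2" for i
      proof -
        have "cmod (partial i (scaled R) x) * cmod (partial i h x) \<le> (1 / R * B1 i) * (C1 i / a / R)"
        proof (intro mult_mono h_le')
          show "cmod (partial i (scaled R) x) \<le> 1 / R * B1 i"
            unfolding partial_scaled norm_mult using R0 by (intro mult_mono B1) (auto simp: norm_divide)
        qed (use R0 order_trans[OF norm_ge_zero B1] in auto)
        then show ?thesis
          by (simp add: norm_mult power2_eq_square mult_ac)
      qed
      have "cmod (laplacian (scaled R) x) * cmod (h x) \<le> (1 / R\<^sup>2 * B2) * (C0 / a / R)"
      proof (intro mult_mono h_le')
        show "cmod (laplacian (scaled R) x) \<le> 1 / R\<^sup>2 * B2"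
          unfolding laplacian_scaled norm_mult using R0 by (intro mult_mono B2) (auto simp: norm_divide norm_power)
      qed (use R0 B2 in auto)
      also have "\<dots> \<le> (1 / R\<^sup>2 * B2) * (C0 / a / 1)"
        using R0 B2 C0 a(1) by (intro mult_left_mono divide_left_mono) auto
      finally have t': "cmod (laplacian (scaled R) x * h x) \<le> B2 * (C0 / a) / R\<^sup>2"
        by (simp add: norm_mult mult_ac)
      have "cmod (E R x) \<le> 2 * (\<Sum>i\<in>UNIV. cmod (partial i (scaled R) x * partial i h x)) + cmod (laplacian (scaled R) x * h x)"
        unfolding E_def using norm_sum[of "\<lambda>i. partial i (scaled R) x * partial i h x" UNIV]
        by (intro order_trans[OF norm_triangle_ineq] add_mono order_refl) (simp add: norm_mult)
      also have "\<dots> \<le> 2 * (\<Sum>i\<in>UNIV. B1 i * (C1 i / a) / R\<^sup>2) + B2 * (C0 / a) / R\<^sup>2"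
        by (intro add_mono mult_left_mono sum_mono t t') auto
      also have "\<dots> = Q / R\<^sup>2"
        unfolding Q_def add_divide_distrib sum_divide_distrib[symmetric] times_divide_eq_right ..
      finally show ?thesis .
    qed
    have E_test: "E R \<in> test_functions UNIV" if "R > 0" for R
      unfolding E_def using scaled_test[OF that] h
      by (intro test_function_add test_function_cmult test_function_sum test_function_mult_smooth test_function_partial
          test_function_laplacian smooth_partial) auto
    have E_supp: "E R x = 0" if "R > 0" "norm x > b * R" for R x
    proof -
      have "norm ((1 / R) *\<^sub>R x) > b"
        using that by (simp add: field_simps)
      from out0[OF this, of "[i]" for i] out0[OF this, of "[i, i]" for i] show ?thesis
        unfolding E_def partial_scaled laplacian_scaled by (simp add: laplacian_def)
    qed
    \<comment> \<open>The doubled radius makes the open ball contain the closed region |x| \<le>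
      \<open>b * R\<close>, outside of which \<open>E R\<close> vanishes.\<close>
    have E_sq: "sqnorm (E R) \<le> Q\<^sup>2 * unit_ball_vol 3 * (2 * b) ^ 3 / R" if R: "R \<ge> m" for R
    proof -
      have R0: "R > 0" using m(1) R by linarith
      have "sqnorm (E R) \<le> (LINT x|lborel. (Q / R\<^sup>2)\<^sup>2 * indicator (ball (0 :: R3) (2 * b * R)) x)"
        unfolding sqnorm_def
      proof (rule integral_mono)
        fix x :: R3
        show "(cmod (E R x))\<^sup>2 \<le> (Q / R\<^sup>2)\<^sup>2 * indicator (ball 0 (2 * b * R)) x"
        proof (cases "norm x < 2 * b * R")
          case True
          then show ?thesis
            using E_bound[OF R, of x] by (simp add: power_mono)
        next
          case False
          moreover have "b * R > 0"
            using b(1) R0 by simp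
          ultimately have "norm x > b * R" by simp
          then show ?thesis
            using E_supp[OF R0] by simp
        qed
      qed (use L2D(2)[OF test_function_L2[OF E_test[OF R0]]] integrable_indicator_ball in auto)
      also have "\<dots> = (Q / R\<^sup>2)\<^sup>2 * (unit_ball_vol 3 * (2 * b * R) ^ 3)"
        using b(1) R0 by (simp add: content_ball)
      also have "\<dots> = Q\<^sup>2 * unit_ball_vol 3 * (2 * b) ^ 3 / R"
        using R0 by (simp add: field_simps eval_nat_numeral)
      finally show ?thesis .
    qed
    \<comment> \<open>The right-hand side is independent of \<open>R\<close>, whereas by
      Cauchy-Schwarz the square of the left-hand side is of order 1/R; hence both vanish.\<close>
    have const: "(LINT x|lborel. E R x * u x) = of_real delta_mass * ((LINT x|lborel. u x * \<psi> x) - \<beta> * h 0)" if R: "R \<ge> m" for R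
    proof -
      have R0: "R > 0" using m(1) R by linarith
      have \<phi>: "(\<lambda>x. scaled R x * h x) \<in> test_functions UNIV"
        by (intro test_function_mult_smooth scaled_test R0 h)
      have "laplacian (\<lambda>x. scaled R x * h x) x + \<kappa>\<^sup>2 * (scaled R x * h x) = E R x - of_real delta_mass * \<psi> x" for x
      proof -
        have "laplacian (\<lambda>x. scaled R x * h x) x + \<kappa>\<^sup>2 * (scaled R x * h x)
            = scaled R x * (laplacian h x + \<kappa>\<^sup>2 * h x) + E R x"
          unfolding laplacian_mult[OF scaled_smooth h] E_def by (simp add: algebra_simps)
        also have "laplacian h x + \<kappa>\<^sup>2 * h x = - of_real delta_mass * \<psi> x"
          unfolding h_def by (rule helmholtz_conv_outgoing[OF \<kappa> \<psi>])
        also have "scaled R x * (- of_real delta_mass * \<psi> x) = - of_real delta_mass * \<psi> x"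
        proof (cases "norm x < S")
          case True
          have "S \<le> a * R"
            using order_trans[OF m(3) R] a(1) by (simp add: field_simps)
          then have "scaled R x = 1"
            unfolding scaled_def using True R0 by (intro a) (simp add: field_simps)
          then show ?thesis by simp
        qed (use S in simp)
        finally show ?thesis by simp
      qed
      with eq[OF \<phi>] have "(LINT x|lborel. u x * (E R x - of_real delta_mass * \<psi> x)) = - of_real delta_mass * \<beta> * (scaled R 0 * h 0)"
        by simp
      moreover have "scaled R 0 = 1"
        unfolding scaled_def using a by simp
      ultimately have "(LINT x|lborel. u x * E R x - of_real delta_mass * (u x * \<psi> x)) = - of_real delta_mass * \<beta> * h 0"
        by (simp add: algebra_simps)
      then have "(LINT x|lborel. u x * E R x) - of_real delta_mass * (LINT x|lborel. u x * \<psi> x) = - of_real delta_mass * \<beta> * h 0"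
        using L2_mult_integrable(1)[OF u test_function_L2[OF \<psi>]] L2_mult_integrable(1)[OF u test_function_L2[OF E_test[OF R0]]]
        by simp
      then show ?thesis
        by (simp add: algebra_simps)
    qed
    define z where "z = of_real delta_mass * ((LINT x|lborel. u x * \<psi> x) - \<beta> * h 0)"
    define D where "D = Q\<^sup>2 * unit_ball_vol 3 * (2 * b) ^ 3 * sqnorm u"
    have "(cmod z)\<^sup>2 \<le> D / R" if R: "R \<ge> m" for R
    proof -
      have R0: "R > 0" using m(1) R by linarith
      have "(cmod z)\<^sup>2 \<le> sqnorm (E R) * sqnorm u"
        using L2_cauchy_schwarz_norm[OF test_function_L2[OF E_test[OF R0]] u] by (simp add: const[OF R] z_def)
      also have "\<dots> \<le> Q\<^sup>2 * unit_ball_vol 3 * (2 * b) ^ 3 / R * sqnorm u"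
        by (intro mult_right_mono E_sq R sqnorm_nonneg)
      finally show ?thesis by (simp add: D_def)
    qed
    then have "eventually (\<lambda>R. (cmod z)\<^sup>2 \<le> D / R) at_top"
      unfolding eventually_at_top_linorder by blast
    moreover have "((\<lambda>R. D / R) \<longlongrightarrow> 0) at_top"
      by (rule tendsto_divide_0[OF tendsto_const filterlim_at_top_imp_at_infinity[OF filterlim_ident]])
    ultimately have "(cmod z)\<^sup>2 \<le> 0"
      using tendsto_lowerbound[of "\<lambda>R. D / R" 0 at_top "(cmod z)\<^sup>2"] by simp
    then have "z = 0" by simp
    then have "(LINT x|lborel. u x * \<psi> x) = \<beta> * h 0"
      using delta_mass_pos by (simp add: z_def)
    also have "h 0 = (LINT y|lborel. outgoing \<kappa> (0 - y) * \<psi> (0 - y))"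
      by (simp add: h_def conv_def outgoing_def)
    also have "\<dots> = (LINT y|lborel. outgoing \<kappa> y * \<psi> y)"
    proof (rule integral_lborel_reflect)
      have [measurable]: "\<psi> \<in> borel_measurable borel"
        by (intro smooth_measurable test_function_smooth[OF \<psi>])
      show "(\<lambda>y. outgoing \<kappa> y * \<psi> y) \<in> borel_measurable borel"
        by measurable
    qed
    finally show ?thesis .
  qed
  \<comment> \<open>For real \<kappa> the difference is known to be square integrable only after
    cutting off, hence the local form of separation.\<close>
  have "ae_eq (\<lambda>x. u x - \<beta> * outgoing \<kappa> x) (\<lambda>_. 0)"
  proof (rule locally_L2_separation)
    fix R :: real assume R: "R > 0"
    obtain B where B: "\<And>x. cmod (scaled R x) \<le> B"
      using test_function_bounded[OF scaled_test[OF R]] by blast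
    have "(\<lambda>x. u x * scaled R x) \<in> L2"
    proof (rule L2_bound[OF u, where C=B])
      have [measurable]: "u \<in> borel_measurable borel" "scaled R \<in> borel_measurable borel"
        using L2D(1)[OF u] smooth_measurable scaled_smooth by blast+
      show "(\<lambda>x. u x * scaled R x) \<in> borel_measurable borel"
        by measurable
      show "AE x in lborel. cmod (u x * scaled R x) \<le> B * cmod (u x)"
        using mult_left_mono[OF B norm_ge_zero] by (intro AE_I2) (simp add: norm_mult mult.commute)
    qed
    then show "(\<lambda>x. (u x - \<beta> * outgoing \<kappa> x) * scaled R x) \<in> L2"
      using L2_diff[OF _ L2_cmult[OF outgoing_scaled_L2[OF \<kappa> R], of \<beta>]] by (simp add: left_diff_distrib mult.assoc)
  next
    fix \<psi> :: "R3 \<Rightarrow> complex" assume \<psi>: "\<psi> \<in> test_functions UNIV"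
    have "(LINT x|lborel. (u x - \<beta> * outgoing \<kappa> x) * \<psi> x) = (LINT x|lborel. u x * \<psi> x - \<beta> * (outgoing \<kappa> x * \<psi> x))"
      by (simp add: left_diff_distrib mult.assoc)
    then show "(LINT x|lborel. (u x - \<beta> * outgoing \<kappa> x) * \<psi> x) = 0"
      using key[OF \<psi>] L2_mult_integrable(1)[OF u test_function_L2[OF \<psi>]] locally_integrable_mult_test[OF loc \<psi>] by simp
  qed
  then show ?thesis
    by (simp add: ae_eq_def)
qed

end

section \<open>The free resolvent\<close>

lemma conv_commute:
  assumes "g \<in> borel_measurable borel" and "\<phi> \<in> borel_measurable borel"
  shows "conv g \<phi> x = conv \<phi> g x"
proof -
  have "(\<lambda>y. \<phi> y * g (x - y)) \<in> borel_measurable borel"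
    using assms by measurable
  from integral_lborel_reflect[OF this, of x] show ?thesis
    by (simp add: conv_def mult.commute)
qed

lemma open_AE_empty:
  fixes U :: "R3 set"
  assumes "open U" and "AE x in lborel. x \<notin> U" shows "U = {}"
proof -
  have "U \<in> null_sets lborel"
    using assms by (subst AE_iff_null_sets) auto
  then have "negligible U"
    by (simp add: negligible_iff_null_sets null_sets_completionI)
  then show ?thesis
    using open_not_negligible[OF assms(1)] by blast
qed

lemma continuous_AE_zero:
  fixes d :: "R3 \<Rightarrow> complex"
  assumes "continuous_on UNIV d" and "AE x in lborel. d x = 0" shows "d x = 0"
proof -
  have "open (d -` (- {0}))"
    by (rule open_vimage[OF _ assms(1)]) auto
  then have "d -` (- {0}) = {}"
    by (rule open_AE_empty) (use assms(2) in auto)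
  then show ?thesis by blast
qed

section \<open>Commuting partials, and integration by parts without compact support\<close>

context cutoff
begin

text \<open>In a convolution with a test function either factor may take the derivative; distributing \<open>\<partial>\<^sub>i\<close> and \<open>\<partial>\<^sub>j\<close>
  over the two factors shows that both orders have the same mollification.\<close>
lemma partial_commute_test:
  assumes \<phi>: "\<phi> \<in> test_functions UNIV"
  shows "partial i (partial j \<phi>) x = partial j (partial i \<phi>) x"
proof -
  define d where "d x = partial i (partial j \<phi>) x - partial j (partial i \<phi>) x" for x
  have loc: "locally_integrable \<eta>" if \<eta>: "\<eta> \<in> test_functions UNIV" for \<eta>
  proof -
    obtain B where "\<And>x. cmod (\<eta> x) \<le> B"
      using test_function_bounded[OF \<eta>] by blast
    then show ?thesis
      by (intro locally_integrable_bounded[of \<eta> B] smooth_measurable test_function_smooth[OF \<eta>])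
  qed
  have comm: "conv \<eta> \<psi> = conv \<psi> \<eta>" if "\<eta> \<in> test_functions UNIV" "\<psi> \<in> test_functions UNIV" for \<eta> \<psi>
    by (rule ext, rule conv_commute; intro smooth_measurable test_function_smooth[OF that(1)] test_function_smooth[OF that(2)])
  have sw: "conv \<eta> (partial i \<psi>) = conv (partial i \<eta>) \<psi>" if "\<eta> \<in> test_functions UNIV" "\<psi> \<in> test_functions UNIV" for \<eta> \<psi> i
  proof -
    have "conv \<eta> (partial i \<psi>) = partial i (conv \<eta> \<psi>)"
      by (simp add: partial_conv loc that)
    also have "\<dots> = partial i (conv \<psi> \<eta>)"
      by (simp only: comm[OF that])
    also have "\<dots> = conv \<psi> (partial i \<eta>)"
      by (simp add: partial_conv loc that)
    also have "\<dots> = conv (partial i \<eta>) \<psi>"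
      by (rule comm) (intro that test_function_partial)+
    finally show ?thesis .
  qed
  have smd: "d \<in> test_functions UNIV"
    using test_function_add[OF test_function_partial[OF test_function_partial[OF \<phi>]]
        test_function_cmult[OF test_function_partial[OF test_function_partial[OF \<phi>]], where c = "-1"]]
    by (simp add: d_def[abs_def])
  have "ae_eq d (\<lambda>_. 0)"
  proof (rule L2_separation[OF test_function_L2[OF smd]])
    fix \<psi> :: "R3 \<Rightarrow> complex" assume \<psi>: "\<psi> \<in> test_functions UNIV"
    \<comment> \<open>The reflection makes the convolution with \<open>\<eta>\<close> at 0 equal to
      the integral against \<psi>.\<close>
    define \<eta> where "\<eta> y = \<psi> (0 - y)" for y
    have \<eta>: "\<eta> \<in> test_functions UNIV"
      unfolding \<eta>_def by (rule test_function_reflect[OF \<psi>])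
    note t = test_function_partial[OF \<phi>] test_function_partial[OF \<eta>]
    have "conv \<eta> (partial i (partial j \<phi>)) = conv \<eta> (partial j (partial i \<phi>))"
    proof -
      have "conv \<eta> (partial i (partial j \<phi>)) = conv (partial i \<eta>) (partial j \<phi>)"
        by (rule sw[OF \<eta> t(1)])
      also have "\<dots> = partial j (conv (partial i \<eta>) \<phi>)"
        by (simp add: partial_conv loc t \<phi>)
      also have "\<dots> = partial j (conv \<eta> (partial i \<phi>))"
        by (simp only: sw[OF \<eta> \<phi>])
      also have "\<dots> = conv \<eta> (partial j (partial i \<phi>))"
        by (simp add: partial_conv loc t \<eta>)
      finally show ?thesis .
    qed
    moreover have "conv \<eta> d 0 = conv \<eta> (partial i (partial j \<phi>)) 0 - conv \<eta> (partial j (partial i \<phi>)) 0"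
      unfolding conv_def d_def right_diff_distrib
      by (intro Bochner_Integration.integral_diff conv_integrable loc \<eta> test_function_partial \<phi>)
    ultimately have "conv \<eta> d 0 = 0"
      by simp
    then have "conv d \<eta> 0 = 0"
      using comm[OF smd \<eta>] by simp
    then show "(LINT x|lborel. d x * \<psi> x) = 0"
      by (simp add: conv_def \<eta>_def)
  qed
  then have "d x = 0" for x
    by (intro continuous_AE_zero smooth_continuous_on test_function_smooth[OF smd]) (simp add: ae_eq_def)
  then show ?thesis
    by (simp add: d_def)
qed

text \<open>A cut-off is inserted next to \<open>b\<close>. The additional term carries the gradient
  of the cut-off, which is of order 1/R, against the integrable product of \<open>a\<close> and
  \<open>b\<close>, so it vanishes in the limit.\<close>

lemma L2_parts:
  assumes a: "smooth a" "a \<in> L2" "partial i a \<in> L2" and b: "smooth b" "b \<in> L2" "partial i b \<in> L2"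
  shows "(LINT x|lborel. a x * partial i b x) = - (LINT x|lborel. partial i a x * b x)"
proof -
  obtain B where B: "B > 0" "\<And>x. cmod (\<theta> x) \<le> B"
    using test_function_bounded[OF theta_test] by blast
  obtain B1 where B1: "B1 > 0" "\<And>x. cmod (partial i \<theta> x) \<le> B1"
    using test_function_bounded[OF test_function_partial[OF theta_test]] by blast
  define r where "r n = real (Suc n)" for n
  have r: "r n > 0" "r n \<ge> 1" for n
    by (auto simp: r_def)
  have r_top: "filterlim r at_top sequentially"
    unfolding r_def by (rule filterlim_compose[OF filterlim_real_sequentially filterlim_Suc])
  have sc_le: "cmod (scaled (r n) x) \<le> B" for n x
    unfolding scaled_def by (rule B)
  have psc_le: "cmod (partial i (scaled (r n)) x) \<le> 1 / r n * B1" for n x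
    unfolding partial_scaled norm_mult using r[of n] by (intro mult_mono B1) (auto simp: norm_divide)
  have sc_lim: "(\<lambda>n. scaled (r n) x) \<longlonglongrightarrow> 1" for x
    by (rule tendsto_eventually, rule eventually_compose_filterlim[OF scaled_eventually_1 r_top])
  have [measurable]: "scaled R \<in> borel_measurable borel" "partial i (scaled R) \<in> borel_measurable borel" for R
    by (intro smooth_measurable smooth_partial scaled_smooth)+
  note [measurable] = L2D(1)[OF a(2)] L2D(1)[OF a(3)] L2D(1)[OF b(2)] L2D(1)[OF b(3)]
  have eq: "(LINT x|lborel. a x * partial i b x * scaled (r n) x) + (LINT x|lborel. a x * b x * partial i (scaled (r n)) x)
      = - (LINT x|lborel. partial i a x * b x * scaled (r n) x)" for n
  proof -
    have t: "(\<lambda>x. scaled (r n) x * b x) \<in> test_functions UNIV"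
      by (intro test_function_mult_smooth scaled_test r b)
    have "(LINT x|lborel. a x * partial i (\<lambda>x. scaled (r n) x * b x) x) = - (LINT x|lborel. partial i a x * (scaled (r n) x * b x))"
      by (rule integral_by_parts[OF _ _ _ t])
        (auto intro: partial_line0 smooth_differentiable smooth_continuous_on smooth_partial a)
    moreover have "a x * partial i (\<lambda>x. scaled (r n) x * b x) x = a x * partial i b x * scaled (r n) x + a x * b x * partial i (scaled (r n)) x" for x
      unfolding smooth_mult_partial[OF scaled_smooth b(1)] by (simp add: algebra_simps)
    moreover have "integrable lborel (\<lambda>x. a x * partial i b x * scaled (r n) x)"
      by (rule Bochner_Integration.integrable_bound[OF integrable_mult_right[OF integrable_norm[OF L2_mult_integrable(1)[OF a(2) b(3)]], of B]])
        (use sc_le B in \<open>auto simp: norm_mult mult.commute[of B] intro!: mult_left_mono\<close>)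
    moreover have "integrable lborel (\<lambda>x. a x * b x * partial i (scaled (r n)) x)"
      by (rule Bochner_Integration.integrable_bound[OF integrable_mult_right[OF integrable_norm[OF L2_mult_integrable(1)[OF a(2) b(2)]], of "1 / r n * B1"]])
        (use mult_left_mono[OF psc_le[of n] norm_ge_zero[of "a x * b x" for x]] B1 r(1)[of n] in
          \<open>auto simp: norm_mult abs_mult mult_ac intro!: AE_I2\<close>)
    ultimately show ?thesis
      by (simp add: mult_ac)
  qed
  have conv1: "(\<lambda>n. LINT x|lborel. g x * scaled (r n) x) \<longlonglongrightarrow> (LINT x|lborel. g x)" if g: "integrable lborel g" for g
  proof (rule integral_dominated_convergence[where w="\<lambda>x. B * cmod (g x)"])
    note [measurable] = borel_measurable_integrable[OF g]
    show "AE x in lborel. (\<lambda>n. g x * scaled (r n) x) \<longlonglongrightarrow> g x"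
      using tendsto_mult[OF tendsto_const sc_lim] by fastforce
    show "AE x in lborel. cmod (g x * scaled (r n) x) \<le> B * cmod (g x)" for n
      using sc_le[of n] by (intro AE_I2) (simp add: norm_mult mult.commute[of B] mult_left_mono)
    show "integrable lborel (\<lambda>x. B * cmod (g x))"
      using g by simp
  qed (use g in auto)
  have "(\<lambda>n. LINT x|lborel. a x * b x * partial i (scaled (r n)) x) \<longlonglongrightarrow> 0"
  proof (rule Lim_null_comparison)
    define N where "N = (LINT x|lborel. cmod (a x * b x))"
    have "norm (LINT x|lborel. a x * b x * partial i (scaled (r n)) x) \<le> N * B1 * (1 / r n)" for n
    proof -
      have "norm (LINT x|lborel. a x * b x * partial i (scaled (r n)) x) \<le> (LINT x|lborel. cmod (a x * b x * partial i (scaled (r n)) x))"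
        by (rule integral_norm_bound)
      also have "\<dots> \<le> (LINT x|lborel. cmod (a x * b x) * (1 / r n * B1))"
      proof (rule integral_mono_AE')
        show "integrable lborel (\<lambda>x. cmod (a x * b x) * (1 / r n * B1))"
          by (intro integrable_mult_left integrable_norm L2_mult_integrable(1) a b)
        show "AE x in lborel. cmod (a x * b x * partial i (scaled (r n)) x) \<le> cmod (a x * b x) * (1 / r n * B1)"
          by (intro AE_I2) (subst norm_mult, intro mult_left_mono psc_le norm_ge_zero)
        show "AE x in lborel. 0 \<le> cmod (a x * b x) * (1 / r n * B1)"
          using B1(1) r(1)[of n] by (intro AE_I2 mult_nonneg_nonneg) auto
      qed
      finally show ?thesis
        by (simp add: N_def)
    qed
    then show "eventually (\<lambda>n. norm (LINT x|lborel. a x * b x * partial i (scaled (r n)) x) \<le> N * B1 * (1 / r n)) sequentially"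
      by simp
    have "(\<lambda>n. N * B1 * (1 / r n)) \<longlonglongrightarrow> N * B1 * 0"
      using LIMSEQ_inverse_real_of_nat by (intro tendsto_intros) (simp add: r_def inverse_eq_divide)
    then show "(\<lambda>n. N * B1 * (1 / r n)) \<longlonglongrightarrow> 0" by simp
  qed
  then have "(\<lambda>n. (LINT x|lborel. a x * partial i b x * scaled (r n) x) + (LINT x|lborel. a x * b x * partial i (scaled (r n)) x))
      \<longlonglongrightarrow> (LINT x|lborel. a x * partial i b x) + 0"
    by (intro tendsto_add conv1 L2_mult_integrable(1) a b)
  moreover have "(\<lambda>n. - (LINT x|lborel. partial i a x * b x * scaled (r n) x)) \<longlonglongrightarrow> - (LINT x|lborel. partial i a x * b x)"
    by (intro tendsto_minus conv1 L2_mult_integrable(1) a b)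
  ultimately show ?thesis
    unfolding eq using LIMSEQ_unique by fastforce
qed

end

text \<open>Completeness of L2 for rapidly converging sequences, which converge also almost
  everywhere; the limit is thereby a concrete Borel function. The weights \<open>2 ^ n\<close> in
  \<open>H\<close> still leave a summable series against \<open>(1 / 4) ^ n\<close>, so
  \<open>H\<close> is finite almost everywhere.\<close>

lemma L2_fast_cauchy:
  assumes g: "\<And>n. g n \<in> L2" and fast: "\<And>n. sqnorm (\<lambda>x. g (Suc n) x - g n x) \<le> C * (1 / 4) ^ n"
  obtains g' where "g' \<in> L2" and "(\<lambda>n. sqnorm (\<lambda>x. g n x - g' x)) \<longlonglongrightarrow> 0"
proof -
  note [measurable] = g[THEN L2D(1)]
  define d where "d n x = g (Suc n) x - g n x" for n x
  have dL: "d n \<in> L2" for n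
    unfolding d_def by (intro L2_diff g)
  note [measurable] = dL[THEN L2D(1)]
  define H where "H x = (\<Sum>n. ennreal (2 ^ n * (cmod (d n x))\<^sup>2))" for x
  have [measurable]: "H \<in> borel_measurable borel"
    unfolding H_def by measurable
  have C: "C \<ge> 0"
    using order_trans[OF sqnorm_nonneg fast[of 0]] by simp
  have "(\<integral>\<^sup>+x. H x \<partial>lborel) = (\<Sum>n. \<integral>\<^sup>+x. ennreal (2 ^ n * (cmod (d n x))\<^sup>2) \<partial>lborel)"
    unfolding H_def by (intro nn_integral_suminf) measurable
  also have "\<dots> \<le> (\<Sum>n. ennreal (C * (1 / 2) ^ n))"
  proof (intro suminf_le allI)
    fix n
    have "(\<integral>\<^sup>+x. ennreal (2 ^ n * (cmod (d n x))\<^sup>2) \<partial>lborel) = ennreal (2 ^ n * sqnorm (d n))"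
      unfolding sqnorm_def by (subst nn_integral_eq_integral) (use L2D(2)[OF dL[of n]] in auto)
    also have "\<dots> \<le> ennreal (2 ^ n * (C * (1 / 4) ^ n))"
      using fast[of n] by (intro ennreal_leI mult_left_mono) (auto simp: d_def[abs_def])
    also have "2 ^ n * (C * (1 / 4) ^ n) = C * (1 / 2 :: real) ^ n"
    proof -
      have "(2 :: real) ^ n * (1 / 4) ^ n = (1 / 2) ^ n"
        by (subst power_mult_distrib[symmetric]) simp
      then show ?thesis by simp
    qed
    finally show "(\<integral>\<^sup>+x. ennreal (2 ^ n * (cmod (d n x))\<^sup>2) \<partial>lborel) \<le> ennreal (C * (1 / 2) ^ n)" .
  qed auto
  also have "\<dots> = ennreal (\<Sum>n. C * (1 / 2) ^ n)"
    by (rule suminf_ennreal2) (use C in \<open>auto intro!: summable_mult summable_geometric\<close>)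
  finally have H_fin: "(\<integral>\<^sup>+x. H x \<partial>lborel) < \<infinity>"
    using order.strict_trans1 by fastforce
  then have H_AE: "AE x in lborel. H x \<noteq> \<infinity>"
    by (intro nn_integral_PInf_AE) auto
  define h where "h x = enn2real (H x)" for x
  have [measurable]: "h \<in> borel_measurable borel"
    unfolding h_def by measurable
  have h_int: "integrable lborel h"
  proof (rule integrableI_nonneg)
    have "(\<integral>\<^sup>+x. ennreal (h x) \<partial>lborel) \<le> (\<integral>\<^sup>+x. H x \<partial>lborel)"
      unfolding h_def by (intro nn_integral_mono) (simp add: ennreal_enn2real_if)
    then show "(\<integral>\<^sup>+x. ennreal (h x) \<partial>lborel) < \<infinity>"
      using H_fin by (rule order.strict_trans1)
  qed (auto simp: h_def)
  \<comment> \<open>One term of the series \<open>H\<close> bounds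
    \<open>2 ^ n * (cmod (d n x))\<^sup>2\<close> by \<open>h x\<close>, so the increments decrease
    geometrically with ratio 1 / sqrt 2.\<close>
  define q :: real where "q = 1 / sqrt 2"
  have q: "0 \<le> q" "q < 1" "q\<^sup>2 = 1 / 2"
    by (auto simp: q_def power_divide real_less_rsqrt)
  have d_le: "cmod (d n x) \<le> sqrt (h x) * q ^ n" if "H x \<noteq> \<infinity>" for n x
  proof -
    have "(\<Sum>k\<in>{n}. ennreal (2 ^ k * (cmod (d k x))\<^sup>2)) \<le> H x"
      unfolding H_def by (rule sum_le_suminf) auto
    then have "ennreal (2 ^ n * (cmod (d n x))\<^sup>2) \<le> H x"
      by simp
    also have "H x = ennreal (h x)"
      using that by (simp add: h_def less_top[symmetric])
    finally have "2 ^ n * (cmod (d n x))\<^sup>2 \<le> h x"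
      by (simp add: h_def)
    then have "(cmod (d n x))\<^sup>2 \<le> h x * (1 / 2) ^ n"
      by (simp add: field_simps power_divide)
    also have "\<dots> = (sqrt (h x) * q ^ n)\<^sup>2"
    proof -
      have "(q ^ n)\<^sup>2 = (1 / 2) ^ n"
        using q(3) by (metis power_mult mult.commute)
      then show ?thesis
        by (simp add: power_mult_distrib h_def)
    qed
    finally show ?thesis
      by (rule power2_le_imp_le) (use q in \<open>auto simp: h_def\<close>)
  qed
  \<comment> \<open>The value 0 on the null set where \<open>H\<close> is infinite makes the limit a
    total function.\<close>
  define g' where "g' x = (if H x \<noteq> \<infinity> then lim (\<lambda>n. g n x) else 0)" for x
  have tele: "(\<Sum>k<m. d (n + k) x) = g (n + m) x - g n x" for n m x
    by (induction m) (simp_all add: d_def)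
  have diff_le: "cmod (g (n + m) x - g n x) \<le> sqrt (h x) * q ^ n / (1 - q)" if "H x \<noteq> \<infinity>" for n m x
  proof -
    have "cmod (g (n + m) x - g n x) \<le> (\<Sum>k<m. cmod (d (n + k) x))"
      unfolding tele[symmetric] by (rule norm_sum)
    also have "\<dots> \<le> (\<Sum>k<m. sqrt (h x) * q ^ n * q ^ k)"
    proof (intro sum_mono)
      fix k
      show "cmod (d (n + k) x) \<le> sqrt (h x) * q ^ n * q ^ k"
        using d_le[OF that, of "n + k"] by (simp add: power_add mult.assoc)
    qed
    also have "\<dots> = sqrt (h x) * q ^ n * (\<Sum>k<m. q ^ k)"
      by (simp add: sum_distrib_left)
    also have "\<dots> \<le> sqrt (h x) * q ^ n * (1 / (1 - q))"
    proof (intro mult_left_mono)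
      have "(\<Sum>k<m. q ^ k) = (1 - q ^ m) / (1 - q)"
        using q(2) by (simp add: sum_gp_strict)
      also have "\<dots> \<le> 1 / (1 - q)"
        using q by (intro divide_right_mono) auto
      finally show "(\<Sum>k<m. q ^ k) \<le> 1 / (1 - q)" .
    qed (use q in \<open>auto simp: h_def\<close>)
    finally show ?thesis by simp
  qed
  have q_lim: "(\<lambda>n. sqrt (h x) * q ^ n / (1 - q)) \<longlonglongrightarrow> 0" for x
  proof -
    have "(\<lambda>n. q ^ n) \<longlonglongrightarrow> 0"
      using q by (intro LIMSEQ_realpow_zero) auto
    then have "(\<lambda>n. sqrt (h x) * q ^ n / (1 - q)) \<longlonglongrightarrow> sqrt (h x) * 0 / (1 - q)"
      using q by (intro tendsto_intros) auto
    then show ?thesis by simp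
  qed
  have g'_lim: "(\<lambda>n. g n x) \<longlonglongrightarrow> g' x" if x: "H x \<noteq> \<infinity>" for x
  proof -
    have "Cauchy (\<lambda>n. g n x)"
      unfolding Cauchy_altdef2
    proof (intro allI impI)
      fix e :: real assume "e > 0"
      then have "eventually (\<lambda>n. sqrt (h x) * q ^ n / (1 - q) < e) sequentially"
        using order_tendstoD(2)[OF q_lim[of x]] by blast
      then obtain N where N: "sqrt (h x) * q ^ N / (1 - q) < e"
        unfolding eventually_sequentially by blast
      have "dist (g n x) (g N x) < e" if "n \<ge> N" for n
        using diff_le[OF x, of N "n - N"] N that by (simp add: dist_norm)
      then show "\<exists>N. \<forall>n\<ge>N. dist (g n x) (g N x) < e"
        by blast
    qed
    then have "convergent (\<lambda>n. g n x)"
      by (rule Cauchy_convergent)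
    then show ?thesis
      using x by (simp add: g'_def convergent_LIMSEQ_iff)
  qed
  have g'_le: "cmod (g n x - g' x) \<le> sqrt (h x) * q ^ n / (1 - q)" if x: "H x \<noteq> \<infinity>" for n x
  proof -
    have "(\<lambda>m. g (n + m) x) \<longlonglongrightarrow> g' x"
      using LIMSEQ_ignore_initial_segment[OF g'_lim[OF x], of n] by (simp add: add.commute)
    then have "(\<lambda>m. cmod (g (n + m) x - g n x)) \<longlonglongrightarrow> cmod (g' x - g n x)"
      by (intro tendsto_intros)
    then have "cmod (g' x - g n x) \<le> sqrt (h x) * q ^ n / (1 - q)"
      by (rule LIMSEQ_le_const2) (use diff_le[OF x] in auto)
    then show ?thesis
      by (simp add: norm_minus_commute)
  qed
  have g'm [measurable]: "g' \<in> borel_measurable borel"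
    unfolding g'_def by measurable
  define c where "c = 1 / (1 - q)\<^sup>2"
  have sq_le: "(cmod (g n x - g' x))\<^sup>2 \<le> c * (1 / 2) ^ n * h x" if x: "H x \<noteq> \<infinity>" for n x
  proof -
    have "(cmod (g n x - g' x))\<^sup>2 \<le> (sqrt (h x) * q ^ n / (1 - q))\<^sup>2"
      by (intro power_mono g'_le x) simp
    also have "\<dots> = c * (q\<^sup>2) ^ n * h x"
      by (simp add: power_mult_distrib power_divide c_def h_def power_mult[symmetric] mult.commute)
    finally show ?thesis
      by (simp add: q(3))
  qed
  have int_diff: "integrable lborel (\<lambda>x. (cmod (g n x - g' x))\<^sup>2)" for n
  proof (rule Bochner_Integration.integrable_bound[of _ "\<lambda>x. c * (1 / 2) ^ n * h x"])
    show "AE x in lborel. norm ((cmod (g n x - g' x))\<^sup>2) \<le> norm (c * (1 / 2) ^ n * h x)"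
      using H_AE by eventually_elim (use sq_le[of _ n] in \<open>force intro: order_trans\<close>)
  qed (use h_int in auto)
  have sq: "sqnorm (\<lambda>x. g n x - g' x) \<le> c * (1 / 2) ^ n * (LINT x|lborel. h x)" for n
  proof -
    have "sqnorm (\<lambda>x. g n x - g' x) \<le> (LINT x|lborel. c * (1 / 2) ^ n * h x)"
      unfolding sqnorm_def
    proof (rule integral_mono_AE[OF int_diff])
      show "AE x in lborel. (cmod (g n x - g' x))\<^sup>2 \<le> c * (1 / 2) ^ n * h x"
        using H_AE by eventually_elim (rule sq_le)
    qed (use h_int in auto)
    then show ?thesis by simp
  qed
  have "(\<lambda>x. g 0 x - g' x) \<in> L2"
    by (intro L2I int_diff) measurable
  then have "(\<lambda>x. g 0 x - (g 0 x - g' x)) \<in> L2"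
    by (rule L2_diff[OF g])
  then have "g' \<in> L2" by simp
  moreover have "(\<lambda>n. sqnorm (\<lambda>x. g n x - g' x)) \<longlonglongrightarrow> 0"
  proof (rule Lim_null_comparison)
    show "eventually (\<lambda>n. norm (sqnorm (\<lambda>x. g n x - g' x)) \<le> c * (1 / 2) ^ n * (LINT x|lborel. h x)) sequentially"
      using sq by (simp add: sqnorm_nonneg)
    have "(\<lambda>n. (1 / 2 :: real) ^ n) \<longlonglongrightarrow> 0"
      by (intro LIMSEQ_realpow_zero) auto
    then have "(\<lambda>n. c * (1 / 2) ^ n * (LINT x|lborel. h x)) \<longlonglongrightarrow> c * 0 * (LINT x|lborel. h x)"
      by (intro tendsto_mult tendsto_const)
    then show "(\<lambda>n. c * (1 / 2) ^ n * (LINT x|lborel. h x)) \<longlonglongrightarrow> 0" by simp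
  qed
  ultimately show ?thesis
    using that by blast
qed

text \<open>Up to the factor \<open>delta_mass\<close> this is the free resolvent. For
  \<open>Im \<kappa> > 0\<close> each translate of the kernel is in L2, so for \<open>f\<close> in
  L2 the integral converges at every point and not merely almost everywhere.\<close>

definition potential :: "complex \<Rightarrow> (R3 \<Rightarrow> complex) \<Rightarrow> R3 \<Rightarrow> complex" where
  "potential \<kappa> f x = (LINT y|lborel. outgoing \<kappa> (x - y) * f y)"

lemma conv_eq_potential:
  assumes [measurable]: "\<psi> \<in> borel_measurable borel"
  shows "conv (outgoing \<kappa>) \<psi> x = potential \<kappa> \<psi> x"
proof -
  have "(\<lambda>y. outgoing \<kappa> y * \<psi> (x - y)) \<in> borel_measurable borel"
    by measurable
  from integral_lborel_reflect[OF this, of x] show ?thesis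
    by (simp add: conv_def potential_def)
qed

lemma conv_outgoing_test:
  "\<psi> \<in> test_functions UNIV \<Longrightarrow> conv (outgoing \<kappa>) \<psi> = potential \<kappa> \<psi>"
  by (rule ext, rule conv_eq_potential, rule smooth_measurable, rule test_function_smooth)

lemma outgoing_minus: "outgoing \<kappa> (x - y) = outgoing \<kappa> (y - x)"
  by (simp add: outgoing_def norm_minus_commute)

lemma outgoing_shift_L2:
  assumes "Im \<kappa> > 0"
  shows "(\<lambda>y. outgoing \<kappa> (x - y)) \<in> L2" and "sqnorm (\<lambda>y. outgoing \<kappa> (x - y)) = sqnorm (outgoing \<kappa>)"
proof -
  note L = outgoing_L2[OF assms]
  show "(\<lambda>y. outgoing \<kappa> (x - y)) \<in> L2"
    by (rule L2I) (use integrable_lborel_reflect[OF L2D(2)[OF L], of x] in auto)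
  show "sqnorm (\<lambda>y. outgoing \<kappa> (x - y)) = sqnorm (outgoing \<kappa>)"
    unfolding sqnorm_def by (rule integral_lborel_reflect) measurable
qed

section \<open>Boundedness and continuity of the potential\<close>

context
  fixes \<kappa> :: complex
  assumes \<kappa>: "Im \<kappa> > 0"
begin

lemma potential_integrable: "f \<in> L2 \<Longrightarrow> integrable lborel (\<lambda>y. outgoing \<kappa> (x - y) * f y)"
  by (intro L2_mult_integrable(1) outgoing_shift_L2 \<kappa>)

lemma norm_potential_le:
  assumes "f \<in> L2" shows "(cmod (potential \<kappa> f x))\<^sup>2 \<le> sqnorm (outgoing \<kappa>) * sqnorm f"
  using L2_cauchy_schwarz_norm[OF outgoing_shift_L2(1)[OF \<kappa>] assms, of x] outgoing_shift_L2(2)[OF \<kappa>, of x]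
  by (simp add: potential_def)

lemma potential_diff:
  assumes "f \<in> L2" and "g \<in> L2"
  shows "potential \<kappa> (\<lambda>x. f x - g x) x = potential \<kappa> f x - potential \<kappa> g x"
  unfolding potential_def right_diff_distrib
  by (intro Bochner_Integration.integral_diff potential_integrable assms)

lemma potential_add:
  assumes "f \<in> L2" and "g \<in> L2"
  shows "potential \<kappa> (\<lambda>x. f x + g x) x = potential \<kappa> f x + potential \<kappa> g x"
  unfolding potential_def distrib_left
  by (intro Bochner_Integration.integral_add potential_integrable assms)

lemma potential_cmult: "potential \<kappa> (\<lambda>x. c * f x) x = c * potential \<kappa> f x"
  unfolding potential_def by (simp add: mult.left_commute)

text \<open>Schur's test: Cauchy-Schwarz for the kernel split into two square roots, followed by
  Tonelli, where all row and column integrals equal \<open>N\<close>. Measurability of the potential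
  is supplied later by its continuity.\<close>

lemma potential_young:
  assumes f: "f \<in> L2" and [measurable]: "potential \<kappa> f \<in> borel_measurable borel"
  shows "potential \<kappa> f \<in> L2" and "sqnorm (potential \<kappa> f) \<le> (LINT x|lborel. cmod (outgoing \<kappa> x))\<^sup>2 * sqnorm f"
proof -
  note [measurable] = L2D(1)[OF f]
  define N where "N = (LINT x|lborel. cmod (outgoing \<kappa> x))"
  have N0: "N \<ge> 0"
    by (simp add: N_def)
  have int: "integrable lborel (\<lambda>y. cmod (outgoing \<kappa> (x - y)))" for x
    using integrable_lborel_reflect[OF integrable_norm[OF outgoing_integrable[OF \<kappa>]], of x] .
  have N: "(\<integral>\<^sup>+y. ennreal (cmod (outgoing \<kappa> (x - y))) \<partial>lborel) = ennreal N" for x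
  proof -
    have "(\<integral>\<^sup>+y. ennreal (cmod (outgoing \<kappa> (x - y))) \<partial>lborel) = ennreal (LINT y|lborel. cmod (outgoing \<kappa> (x - y)))"
      by (intro nn_integral_eq_integral int) auto
    also have "(LINT y|lborel. cmod (outgoing \<kappa> (x - y))) = N"
      unfolding N_def by (rule integral_lborel_reflect) measurable
    finally show ?thesis .
  qed
  have N': "(\<integral>\<^sup>+x. ennreal (cmod (outgoing \<kappa> (x - y))) \<partial>lborel) = ennreal N" for y
    using N[of y] by (simp add: outgoing_minus[of \<kappa> _ y])
  have pt: "ennreal ((cmod (potential \<kappa> f x))\<^sup>2)
      \<le> ennreal N * (\<integral>\<^sup>+y. ennreal (cmod (outgoing \<kappa> (x - y))) * ennreal ((cmod (f y))\<^sup>2) \<partial>lborel)" for x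
  proof -
    define k where "k y = cmod (outgoing \<kappa> (x - y))" for y
    have [measurable]: "k \<in> borel_measurable borel"
      unfolding k_def by measurable
    have k0: "k y \<ge> 0" for y
      by (simp add: k_def)
    have "ennreal (cmod (potential \<kappa> f x)) \<le> (\<integral>\<^sup>+y. ennreal (cmod (outgoing \<kappa> (x - y) * f y)) \<partial>lborel)"
      unfolding potential_def by (rule integral_norm_bound_ennreal[OF potential_integrable[OF f]])
    also have "\<dots> = (\<integral>\<^sup>+y. ennreal (sqrt (k y)) * ennreal (sqrt (k y) * cmod (f y)) \<partial>lborel)"
      using k0 by (intro nn_integral_cong) (simp add: norm_mult k_def flip: ennreal_mult mult.assoc)
    finally have "(ennreal (cmod (potential \<kappa> f x)))\<^sup>2 \<le> (\<integral>\<^sup>+y. ennreal (sqrt (k y)) * ennreal (sqrt (k y) * cmod (f y)) \<partial>lborel)\<^sup>2"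
      by (intro power_mono) auto
    also have "\<dots> \<le> (\<integral>\<^sup>+y. (ennreal (sqrt (k y)))\<^sup>2 \<partial>lborel) * (\<integral>\<^sup>+y. (ennreal (sqrt (k y) * cmod (f y)))\<^sup>2 \<partial>lborel)"
      by (rule Cauchy_Schwarz_nn_integral) measurable
    also have "(\<integral>\<^sup>+y. (ennreal (sqrt (k y)))\<^sup>2 \<partial>lborel) = (\<integral>\<^sup>+y. ennreal (cmod (outgoing \<kappa> (x - y))) \<partial>lborel)"
      using k0 by (intro nn_integral_cong) (simp add: ennreal_power k_def)
    also have "(\<integral>\<^sup>+y. (ennreal (sqrt (k y) * cmod (f y)))\<^sup>2 \<partial>lborel)
        = (\<integral>\<^sup>+y. ennreal (cmod (outgoing \<kappa> (x - y))) * ennreal ((cmod (f y))\<^sup>2) \<partial>lborel)"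
      using k0 by (intro nn_integral_cong) (simp add: ennreal_power power_mult_distrib k_def flip: ennreal_mult)
    finally show ?thesis
      by (simp add: N ennreal_power)
  qed
  have "(\<integral>\<^sup>+x. ennreal ((cmod (potential \<kappa> f x))\<^sup>2) \<partial>lborel)
      \<le> (\<integral>\<^sup>+x. ennreal N * (\<integral>\<^sup>+y. ennreal (cmod (outgoing \<kappa> (x - y))) * ennreal ((cmod (f y))\<^sup>2) \<partial>lborel) \<partial>lborel)"
    by (intro nn_integral_mono pt)
  also have "\<dots> = ennreal N * (\<integral>\<^sup>+x. \<integral>\<^sup>+y. ennreal (cmod (outgoing \<kappa> (x - y))) * ennreal ((cmod (f y))\<^sup>2) \<partial>lborel \<partial>lborel)"
    by (rule nn_integral_cmult) measurable
  also have "(\<integral>\<^sup>+x. \<integral>\<^sup>+y. ennreal (cmod (outgoing \<kappa> (x - y))) * ennreal ((cmod (f y))\<^sup>2) \<partial>lborel \<partial>lborel)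
      = (\<integral>\<^sup>+y. \<integral>\<^sup>+x. ennreal (cmod (outgoing \<kappa> (x - y))) * ennreal ((cmod (f y))\<^sup>2) \<partial>lborel \<partial>lborel)"
    by (rule lborel_pair.Fubini'[symmetric]) measurable
  also have "\<dots> = (\<integral>\<^sup>+y. ennreal N * ennreal ((cmod (f y))\<^sup>2) \<partial>lborel)"
    by (intro nn_integral_cong) (simp add: nn_integral_multc N')
  also have "\<dots> = ennreal N * ennreal (sqnorm f)"
    unfolding sqnorm_def by (subst nn_integral_cmult) (use L2D(2)[OF f] in \<open>auto simp: nn_integral_eq_integral\<close>)
  finally have le: "(\<integral>\<^sup>+x. ennreal ((cmod (potential \<kappa> f x))\<^sup>2) \<partial>lborel) \<le> ennreal (N\<^sup>2 * sqnorm f)"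
    using N0 by (simp add: power2_eq_square ennreal_mult sqnorm_nonneg mult.assoc)
  show L2: "potential \<kappa> f \<in> L2"
  proof (rule L2I)
    show "integrable lborel (\<lambda>x. (cmod (potential \<kappa> f x))\<^sup>2)"
      using le by (intro integrableI_nonneg) (auto simp: order.strict_trans1[OF le])
  qed simp
  have "ennreal (sqnorm (potential \<kappa> f)) \<le> ennreal (N\<^sup>2 * sqnorm f)"
    using le unfolding sqnorm_def by (subst nn_integral_eq_integral[symmetric]) (use L2D(2)[OF L2] in auto)
  then show "sqnorm (potential \<kappa> f) \<le> (LINT x|lborel. cmod (outgoing \<kappa> x))\<^sup>2 * sqnorm f"
    unfolding N_def[symmetric] by (simp add: sqnorm_nonneg)
qed

end

text \<open>By \<open>norm_potential_le\<close> the potential is bounded from L2 to the uniform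
  norm, so it is a uniform limit of smooth potentials of test functions. This provides the
  continuous representative that the boundary condition refers to.\<close>

lemma (in cutoff) potential_continuous:
  assumes \<kappa>: "Im \<kappa> > 0" and f: "f \<in> L2"
  shows "continuous_on UNIV (potential \<kappa> f)"
proof -
  obtain \<psi> where \<psi>: "\<And>n. \<psi> n \<in> test_functions UNIV" "(\<lambda>n. sqnorm (\<lambda>x. \<psi> n x - f x)) \<longlonglongrightarrow> 0"
    using L2_dense[OF f] by blast
  have "uniform_limit UNIV (\<lambda>n. potential \<kappa> (\<psi> n)) (potential \<kappa> f) sequentially"
  proof (rule uniform_limitI)
    fix e :: real assume e: "e > 0"
    have "(\<lambda>n. sqnorm (outgoing \<kappa>) * sqnorm (\<lambda>x. \<psi> n x - f x)) \<longlonglongrightarrow> sqnorm (outgoing \<kappa>) * 0"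
      by (intro tendsto_intros \<psi>)
    then have "eventually (\<lambda>n. sqnorm (outgoing \<kappa>) * sqnorm (\<lambda>x. \<psi> n x - f x) < e\<^sup>2) sequentially"
      using e by (intro order_tendstoD) auto
    then show "eventually (\<lambda>n. \<forall>x\<in>UNIV. dist (potential \<kappa> (\<psi> n) x) (potential \<kappa> f x) < e) sequentially"
    proof eventually_elim
      case (elim n)
      have "(cmod (potential \<kappa> (\<psi> n) x - potential \<kappa> f x))\<^sup>2 < e\<^sup>2" for x
        using norm_potential_le[OF \<kappa> L2_diff[OF test_function_L2[OF \<psi>(1)] f], of n x] elim
        by (simp add: potential_diff[OF \<kappa> test_function_L2[OF \<psi>(1)] f])
      then show ?case
        using power2_less_imp_less[OF _ less_imp_le[OF e]] by (simp add: dist_norm)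
    qed
  qed
  moreover have "continuous_on UNIV (potential \<kappa> (\<psi> n))" for n
    using smooth_conv[OF locally_integrable_outgoing \<psi>(1), of \<kappa> n] \<kappa>
    by (simp add: conv_outgoing_test[OF \<psi>(1)] smooth_continuous_on)
  ultimately show ?thesis
    by (intro uniform_limit_theorem[where F=sequentially and f="\<lambda>n. potential \<kappa> (\<psi> n)"]) auto
qed

lemma (in cutoff)
  assumes \<kappa>: "Im \<kappa> > 0" and f: "f \<in> L2"
  shows potential_L2: "potential \<kappa> f \<in> L2"
    and sqnorm_potential_le: "sqnorm (potential \<kappa> f) \<le> (LINT x|lborel. cmod (outgoing \<kappa> x))\<^sup>2 * sqnorm f"
  using potential_young[OF \<kappa> f borel_measurable_continuous_onI[OF potential_continuous[OF assms]]] by auto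

section \<open>Second-order regularity of the potential\<close>

context cutoff
begin

context
  fixes \<kappa> :: complex
  assumes \<kappa>: "Im \<kappa> > 0"
begin

lemma potential_smooth: "\<psi> \<in> test_functions UNIV \<Longrightarrow> smooth (potential \<kappa> \<psi>)"
  using smooth_conv[OF locally_integrable_outgoing, of \<kappa> \<psi>] \<kappa> by (simp add: conv_outgoing_test)

lemma partial_potential: "\<psi> \<in> test_functions UNIV \<Longrightarrow> partial i (potential \<kappa> \<psi>) = potential \<kappa> (partial i \<psi>)"
  using partial_conv[OF locally_integrable_outgoing, of \<kappa> \<psi> i] \<kappa> by (simp add: conv_outgoing_test test_function_partial)

lemma helmholtz_potential:
  "\<psi> \<in> test_functions UNIV \<Longrightarrow> laplacian (potential \<kappa> \<psi>) x = - of_real delta_mass * \<psi> x - \<kappa>\<^sup>2 * potential \<kappa> \<psi> x"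
  using helmholtz_conv_outgoing[of \<kappa> \<psi> x] \<kappa> by (simp add: conv_outgoing_test algebra_simps eq_diff_eq)

lemma potential_test_L2: "\<psi> \<in> test_functions UNIV \<Longrightarrow> potential \<kappa> \<psi> \<in> L2"
  by (intro potential_L2 \<kappa> test_function_L2)

text \<open>Two integrations by parts turn \<open>\<Sum>\<^sub>i\<^sub>j \<parallel>\<partial>\<^sub>i \<partial>\<^sub>j h\<parallel>\<^sup>2\<close> into \<open>\<parallel>\<Delta> h\<parallel>\<^sup>2\<close>.\<close>
lemma sqnorm_second_partial_le:
  assumes \<psi>: "\<psi> \<in> test_functions UNIV"
  shows "sqnorm (partial i (partial j (potential \<kappa> \<psi>))) \<le> sqnorm (laplacian (potential \<kappa> \<psi>))"
proof -
  define h where "h = potential \<kappa> \<psi>"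
  note t = \<psi> test_function_partial[OF \<psi>]
  have P: "partial k (partial l h) = potential \<kappa> (partial k (partial l \<psi>))" for k l
    unfolding h_def by (simp add: partial_potential t)
  have P3: "partial m (partial k (partial l h)) = potential \<kappa> (partial m (partial k (partial l \<psi>)))" for k l m
    unfolding h_def by (simp add: partial_potential t test_function_partial)
  have sm: "smooth h" "smooth (partial k h)" "smooth (partial k (partial l h))" for k l
    unfolding h_def by (intro smooth_partial potential_smooth t)+
  have L2: "h \<in> L2" "partial k h \<in> L2" "partial k (partial l h) \<in> L2" "partial m (partial k (partial l h)) \<in> L2" for k l m
    unfolding P3 unfolding P unfolding h_def partial_potential[OF \<psi>] by (intro potential_test_L2 t test_function_partial)+
  \<comment> \<open>Partials are commuted on \<psi>, where \<open>partial_commute_test\<close>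
    applies, and the result is carried over to the potential.\<close>
  have comm: "partial k (partial l \<psi>) = partial l (partial k \<psi>)" for k l
    by (rule ext) (rule partial_commute_test[OF \<psi>])
  have comm3: "partial k (partial k (partial l h)) = partial l (partial k (partial k h))" for k l
    unfolding P3 comm[of k l] by (intro arg_cong[where f="potential \<kappa>"] ext) (rule partial_commute_test[OF t(2)])
  have sq: "of_real (sqnorm g) = (LINT x|lborel. g x * cnj (g x))" for g
    unfolding sqnorm_def by (simp add: complex_norm_square[symmetric] flip: integral_complex_of_real)
  define cj where "cj g x = cnj (g x)" for g :: "R3 \<Rightarrow> complex" and x
  have cjp: "partial k (cj g) = cj (partial k g)" if "smooth g" for k g
    unfolding cj_def[abs_def] by (rule smooth_cnj_partial[OF that])
  have cjs: "smooth (cj g)" if "smooth g" for g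
    unfolding cj_def[abs_def] by (rule smooth_cnj[OF that])
  have cjL: "cj g \<in> L2" if "g \<in> L2" for g
    unfolding cj_def[abs_def] by (rule L2_cnj[OF that])
  have swap: "of_real (sqnorm (partial k (partial l h))) = (LINT x|lborel. partial l (partial l h) x * cnj (partial k (partial k h) x))" for k l
  proof -
    have "of_real (sqnorm (partial k (partial l h))) = (LINT x|lborel. partial k (partial l h) x * cj (partial k (partial l h)) x)"
      unfolding sq cj_def ..
    also have "\<dots> = - (LINT x|lborel. partial l h x * partial k (cj (partial k (partial l h))) x)"
      using L2_parts[of "partial l h" k "cj (partial k (partial l h))"] by (simp add: cjp cjs cjL sm L2)
    also have "partial k (cj (partial k (partial l h))) = partial l (cj (partial k (partial k h)))"
      by (simp only: cjp sm comm3[of k l])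
    also have "- (LINT x|lborel. partial l h x * partial l (cj (partial k (partial k h))) x)
        = (LINT x|lborel. partial l (partial l h) x * cj (partial k (partial k h)) x)"
      using L2_parts[of "partial l h" l "cj (partial k (partial k h))"] by (simp add: cjp cjs cjL sm L2)
    finally show ?thesis
      by (simp add: cj_def)
  qed
  have "of_real (\<Sum>k\<in>UNIV. \<Sum>l\<in>UNIV. sqnorm (partial k (partial l h)))
      = (\<Sum>k\<in>UNIV. \<Sum>l\<in>UNIV. LINT x|lborel. partial l (partial l h) x * cnj (partial k (partial k h) x))"
    by (simp add: swap)
  also have "\<dots> = (LINT x|lborel. (\<Sum>k\<in>UNIV. \<Sum>l\<in>UNIV. partial l (partial l h) x * cnj (partial k (partial k h) x)))"
    by (subst Bochner_Integration.integral_sum Bochner_Integration.integral_sum;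
        intro Bochner_Integration.integrable_sum L2_mult_integrable(1) L2_cnj L2 sum.cong refl Bochner_Integration.integral_sum[symmetric])
  also have "\<dots> = of_real (sqnorm (laplacian h))"
    unfolding sq laplacian_def by (simp add: sum_distrib_left sum_distrib_right)
  finally have "(\<Sum>k\<in>UNIV. \<Sum>l\<in>UNIV. sqnorm (partial k (partial l h))) = sqnorm (laplacian h)"
    by (simp only: of_real_eq_iff)
  moreover have "sqnorm (partial i (partial j h)) \<le> (\<Sum>l\<in>UNIV. sqnorm (partial i (partial l h)))"
    by (rule member_le_sum) (auto simp: sqnorm_nonneg)
  moreover have "\<dots> \<le> (\<Sum>k\<in>UNIV. \<Sum>l\<in>UNIV. sqnorm (partial k (partial l h)))"
    by (rule member_le_sum[of i UNIV "\<lambda>k. \<Sum>l\<in>UNIV. sqnorm (partial k (partial l h))"]) (auto intro!: sum_nonneg simp: sqnorm_nonneg)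
  ultimately show ?thesis
    unfolding h_def by linarith
qed

text \<open>Order zero is Young's bound, order two follows from the Helmholtz equation and
  \<open>sqnorm_second_partial_le\<close>, and order one lies between them: one integration by parts
  bounds the squared norm of a first partial by the product of the other two norms. The constant
  does not depend on \<psi>, so the bound survives limits.\<close>

lemma sqnorm_partials_potential_le:
  obtains C where "C \<ge> 0" and "\<And>\<psi> is. \<psi> \<in> test_functions UNIV \<Longrightarrow> length is \<le> 2 \<Longrightarrow>
    sqnorm (partials is (potential \<kappa> \<psi>)) \<le> C * sqnorm \<psi>"
proof -
  define N where "N = (LINT x|lborel. cmod (outgoing \<kappa> x))\<^sup>2"
  define C2 where "C2 = 2 * delta_mass\<^sup>2 + 2 * (cmod \<kappa>)^4 * N"
  define C where "C = N + C2"
  have N0: "N \<ge> 0" "C2 \<ge> 0"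
    by (auto simp: N_def C2_def)
  have b0: "sqnorm (potential \<kappa> \<psi>) \<le> N * sqnorm \<psi>" if "\<psi> \<in> test_functions UNIV" for \<psi>
    unfolding N_def by (intro sqnorm_potential_le \<kappa> test_function_L2 that)
  have b2: "sqnorm (partial i (partial j (potential \<kappa> \<psi>))) \<le> C2 * sqnorm \<psi>" if \<psi>: "\<psi> \<in> test_functions UNIV" for \<psi> i j
  proof -
    have "laplacian (potential \<kappa> \<psi>) = (\<lambda>x. - of_real delta_mass * \<psi> x + - \<kappa>\<^sup>2 * potential \<kappa> \<psi> x)"
      by (simp add: helmholtz_potential[OF \<psi>] fun_eq_iff)
    then have "sqnorm (laplacian (potential \<kappa> \<psi>))
        \<le> 2 * sqnorm (\<lambda>x. - of_real delta_mass * \<psi> x) + 2 * sqnorm (\<lambda>x. - \<kappa>\<^sup>2 * potential \<kappa> \<psi> x)"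
      by (simp only: sqnorm_add_le L2_cmult test_function_L2[OF \<psi>] potential_test_L2[OF \<psi>])
    also have "\<dots> = 2 * delta_mass\<^sup>2 * sqnorm \<psi> + 2 * (cmod \<kappa>)^4 * sqnorm (potential \<kappa> \<psi>)"
      by (subst sqnorm_cmult[OF test_function_L2[OF \<psi>]], subst sqnorm_cmult[OF potential_test_L2[OF \<psi>]])
        (simp add: norm_power flip: power_mult)
    also have "\<dots> \<le> 2 * delta_mass\<^sup>2 * sqnorm \<psi> + 2 * (cmod \<kappa>)^4 * (N * sqnorm \<psi>)"
      by (intro add_left_mono mult_left_mono b0 \<psi>) auto
    also have "\<dots> = C2 * sqnorm \<psi>"
      by (simp add: C2_def algebra_simps)
    finally show ?thesis
      using sqnorm_second_partial_le[OF \<psi>, of i j] by linarith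
  qed
  have b1: "sqnorm (partial i (potential \<kappa> \<psi>)) \<le> C * sqnorm \<psi>" if \<psi>: "\<psi> \<in> test_functions UNIV" for \<psi> i
  proof -
    define h where "h = potential \<kappa> \<psi>"
    note t = \<psi> test_function_partial[OF \<psi>] test_function_partial[OF test_function_partial[OF \<psi>]]
    have sm: "smooth h" "smooth (partial i h)"
      unfolding h_def by (intro smooth_partial potential_smooth \<psi>)+
    have L2: "h \<in> L2" "partial i h \<in> L2" "partial i (partial i h) \<in> L2"
      unfolding h_def by (simp_all add: partial_potential t potential_test_L2)
    have "(LINT x|lborel. h x * partial i (\<lambda>x. cnj (partial i h x)) x) = - (LINT x|lborel. partial i h x * cnj (partial i h x))"
      by (rule L2_parts) (auto simp: smooth_cnj_partial sm intro!: smooth_cnj sm L2 L2_cnj)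
    also have "(LINT x|lborel. partial i h x * cnj (partial i h x)) = of_real (sqnorm (partial i h))"
      unfolding sqnorm_def by (simp add: complex_norm_square[symmetric] flip: integral_complex_of_real)
    finally have "sqnorm (partial i h) = cmod (LINT x|lborel. h x * cnj (partial i (partial i h) x))"
      by (simp add: smooth_cnj_partial sm sqnorm_nonneg)
    then have "(sqnorm (partial i h))\<^sup>2 \<le> sqnorm h * sqnorm (\<lambda>x. cnj (partial i (partial i h) x))"
      using L2_cauchy_schwarz_norm[OF L2(1) L2_cnj[OF L2(3)]] by simp
    also have "sqnorm (\<lambda>x. cnj (partial i (partial i h) x)) = sqnorm (partial i (partial i h))"
      by (simp add: sqnorm_def)
    also have "sqnorm h * sqnorm (partial i (partial i h)) \<le> (C * sqnorm \<psi>) * (C * sqnorm \<psi>)"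
    proof (intro mult_mono)
      show "sqnorm h \<le> C * sqnorm \<psi>"
        unfolding h_def by (rule order_trans[OF b0[OF \<psi>]]) (simp add: C_def N0 sqnorm_nonneg mult_right_mono)
      show "sqnorm (partial i (partial i h)) \<le> C * sqnorm \<psi>"
        unfolding h_def by (rule order_trans[OF b2[OF \<psi>]]) (simp add: C_def N0 sqnorm_nonneg mult_right_mono)
    qed (auto simp: sqnorm_nonneg C_def N0)
    finally have "(sqnorm (partial i h))\<^sup>2 \<le> (C * sqnorm \<psi>)\<^sup>2"
      by (simp add: power2_eq_square)
    then show ?thesis
      unfolding h_def by (rule power2_le_imp_le) (simp add: C_def N0 sqnorm_nonneg)
  qed
  have "sqnorm (partials is (potential \<kappa> \<psi>)) \<le> C * sqnorm \<psi>" if \<psi>: "\<psi> \<in> test_functions UNIV" and len: "length is \<le> 2" for \<psi> "is"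
  proof -
    consider "is = []" | i where "is = [i]" | i j where "is = [i, j]"
      using len by (cases "is" rule: remdups_adj.cases) auto
    then show ?thesis
    proof cases
      case 1
      have "N * sqnorm \<psi> \<le> C * sqnorm \<psi>"
        by (intro mult_right_mono) (auto simp: C_def N0 sqnorm_nonneg)
      then show ?thesis
        using b0[OF \<psi>] 1 by simp
    next
      case 2
      then show ?thesis
        using b1[OF \<psi>] by simp
    next
      case 3
      have "C2 * sqnorm \<psi> \<le> C * sqnorm \<psi>"
        by (intro mult_right_mono) (auto simp: C_def N0 sqnorm_nonneg)
      then show ?thesis
        using b2[OF \<psi>, of "i" "j" for i j] 3 by (auto intro: order_trans)
    qed
  qed
  then show ?thesis
    using that[of C] N0 by (simp add: C_def)
qed

lemma partials_potential: "\<psi> \<in> test_functions UNIV \<Longrightarrow> partials is (potential \<kappa> \<psi>) = potential \<kappa> (partials is \<psi>)"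
  by (induction "is") (simp_all add: partial_potential test_function_partials)

text \<open>The outermost derivative is moved first and becomes the innermost one on
  \<open>h\<close>, hence \<open>rev\<close>.\<close>

lemma smooth_parts_partials:
  assumes "smooth h" and "\<phi> \<in> test_functions UNIV"
  shows "(LINT x|lborel. h x * partials is \<phi> x) = (-1) ^ length is * (LINT x|lborel. partials (rev is) h x * \<phi> x)"
  using assms(1)
proof (induction "is" arbitrary: h)
  case (Cons i "is")
  have "(LINT x|lborel. h x * partial i (partials is \<phi>) x) = - (LINT x|lborel. partial i h x * partials is \<phi> x)"
    by (rule integral_by_parts[OF _ _ _ test_function_partials[OF assms(2)]])
      (auto intro: partial_line0 smooth_differentiable smooth_continuous_on smooth_partial Cons.prems)
  also have "\<dots> = - ((-1) ^ length is * (LINT x|lborel. partials (rev is) (partial i h) x * \<phi> x))"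
    by (subst Cons.IH[OF smooth_partial[OF Cons.prems]]) simp
  finally show ?case
    by (simp add: partials_append)
qed simp

lemma potential_tendsto:
  assumes f: "f \<in> L2" and g: "\<And>n. g n \<in> L2" and lim: "(\<lambda>n. sqnorm (\<lambda>x. g n x - f x)) \<longlonglongrightarrow> 0"
  shows "(\<lambda>n. sqnorm (\<lambda>x. potential \<kappa> (g n) x - potential \<kappa> f x)) \<longlonglongrightarrow> 0"
proof (rule Lim_null_comparison)
  define N where "N = (LINT x|lborel. cmod (outgoing \<kappa> x))\<^sup>2"
  have "sqnorm (\<lambda>x. potential \<kappa> (g n) x - potential \<kappa> f x) \<le> N * sqnorm (\<lambda>x. g n x - f x)" for n
    using sqnorm_potential_le[OF \<kappa> L2_diff[OF g f], of n] by (simp add: N_def potential_diff[OF \<kappa> g f, abs_def])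
  then show "eventually (\<lambda>n. norm (sqnorm (\<lambda>x. potential \<kappa> (g n) x - potential \<kappa> f x)) \<le> N * sqnorm (\<lambda>x. g n x - f x)) sequentially"
    by (simp add: sqnorm_nonneg)
  show "(\<lambda>n. N * sqnorm (\<lambda>x. g n x - f x)) \<longlonglongrightarrow> 0"
    using tendsto_mult[OF tendsto_const lim, of N] by simp
qed

text \<open>Along rapidly converging test functions, the uniform bound makes the classical partials
  of the potentials converge rapidly in L2; their limit inherits the integration by parts
  formula.\<close>

lemma potential_weak_partials:
  assumes f: "f \<in> L2" and len: "length is \<le> 2"
  obtains w where "w \<in> L2" and "weak_partials is (potential \<kappa> f) w"
proof -
  obtain C where C: "C \<ge> 0" "\<And>\<psi> is. \<psi> \<in> test_functions UNIV \<Longrightarrow> length is \<le> 2 \<Longrightarrow>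
      sqnorm (partials is (potential \<kappa> \<psi>)) \<le> C * sqnorm \<psi>"
    using sqnorm_partials_potential_le by blast
  have "\<exists>\<psi>\<in>test_functions UNIV. sqnorm (\<lambda>x. \<psi> x - f x) < (1 / 4) ^ n" for n
    using L2_approximable[OF f] by (simp add: approximable_def)
  then obtain \<psi> where \<psi>: "\<And>n. \<psi> n \<in> test_functions UNIV" "\<And>n. sqnorm (\<lambda>x. \<psi> n x - f x) < (1 / 4) ^ n"
    by metis
  note \<psi>L = test_function_L2[OF \<psi>(1)]
  have q0: "(\<lambda>n. (1 / 4 :: real) ^ n) \<longlonglongrightarrow> 0"
    by (intro LIMSEQ_realpow_zero) auto
  have \<psi>lim: "(\<lambda>n. sqnorm (\<lambda>x. \<psi> n x - f x)) \<longlonglongrightarrow> 0"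
    by (rule Lim_null_comparison[OF always_eventually q0]) (use \<psi>(2) in \<open>auto simp: sqnorm_nonneg less_imp_le\<close>)
  define g where "g n = partials (rev is) (potential \<kappa> (\<psi> n))" for n
  have gL: "g n \<in> L2" for n
    unfolding g_def partials_potential[OF \<psi>(1)] by (intro potential_test_L2 test_function_partials \<psi>)
  \<comment> \<open>Consecutive approximants differ from each other by at most twice the sum of
    their squared errors, \<open>2 * (1 / 4) ^ Suc n + 2 * (1 / 4) ^ n\<close>, whence the factor
    4.\<close>
  have fast: "sqnorm (\<lambda>x. g (Suc n) x - g n x) \<le> 4 * C * (1 / 4) ^ n" for n
  proof -
    define \<delta> where "\<delta> x = \<psi> (Suc n) x + (- 1) * \<psi> n x" for x
    have \<delta>: "\<delta> \<in> test_functions UNIV"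
      unfolding \<delta>_def by (intro test_function_add test_function_cmult \<psi>)
    have lin: "partials is \<delta> = (\<lambda>x. partials is (\<psi> (Suc n)) x + (- 1) * partials is (\<psi> n) x)" for "is"
    proof (induction "is")
      case (Cons i "is")
      then show ?case
        by (simp only: partials_Cons smooth_add_partial smooth_cmult_partial smooth_partials test_function_smooth[OF \<psi>(1)] smooth_mult smooth_const)
    qed (simp add: \<delta>_def[abs_def])
    have pL: "partials (rev is) (\<psi> m) \<in> L2" for m
      by (intro test_function_L2 test_function_partials \<psi>)
    have "(\<lambda>x. g (Suc n) x - g n x) = partials (rev is) (potential \<kappa> \<delta>)"
    proof
      fix x
      have "potential \<kappa> (partials (rev is) \<delta>) x = potential \<kappa> (partials (rev is) (\<psi> (Suc n))) x + (-1) * potential \<kappa> (partials (rev is) (\<psi> n)) x"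
        unfolding lin potential_add[OF \<kappa> pL L2_cmult[OF pL]] potential_cmult[OF \<kappa>] ..
      then show "g (Suc n) x - g n x = partials (rev is) (potential \<kappa> \<delta>) x"
        unfolding g_def partials_potential[OF \<psi>(1)] partials_potential[OF \<delta>] by simp
    qed
    then have le: "sqnorm (\<lambda>x. g (Suc n) x - g n x) \<le> C * sqnorm \<delta>"
      using C(2)[OF \<delta>, of "rev is"] len by simp
    have "sqnorm \<delta> = sqnorm (\<lambda>x. (\<psi> (Suc n) x - f x) + (f x - \<psi> n x))"
      by (simp add: \<delta>_def[abs_def])
    also have "\<dots> \<le> 2 * sqnorm (\<lambda>x. \<psi> (Suc n) x - f x) + 2 * sqnorm (\<lambda>x. f x - \<psi> n x)"
      by (intro sqnorm_add_le L2_diff \<psi>L f)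
    also have "\<dots> \<le> 2 * (1 / 4) ^ Suc n + 2 * (1 / 4) ^ n"
      using \<psi>(2)[of "Suc n"] \<psi>(2)[of n] by (intro add_mono mult_left_mono) (auto simp: sqnorm_diff_commute[of f] less_imp_le)
    also have "\<dots> \<le> 4 * (1 / 4) ^ n"
      by simp
    finally have "C * sqnorm \<delta> \<le> C * (4 * (1 / 4) ^ n)"
      using C(1) by (rule mult_left_mono)
    then show ?thesis
      using le by simp
  qed
  obtain w where w: "w \<in> L2" "(\<lambda>n. sqnorm (\<lambda>x. g n x - w x)) \<longlonglongrightarrow> 0"
    using L2_fast_cauchy[OF gL fast] by blast
  note hlim = potential_tendsto[OF f \<psi>L \<psi>lim]
  have "weak_partials is (potential \<kappa> f) w"
    unfolding weak_partials_def
  proof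
    fix \<phi> :: "R3 \<Rightarrow> complex" assume \<phi>: "\<phi> \<in> test_functions UNIV"
    have "(\<lambda>n. LINT x|lborel. potential \<kappa> (\<psi> n) x * partials is \<phi> x) \<longlonglongrightarrow> (LINT x|lborel. potential \<kappa> f x * partials is \<phi> x)"
      by (rule L2_integral_tendsto[OF potential_test_L2[OF \<psi>(1)] potential_L2[OF \<kappa> f] test_function_L2[OF test_function_partials[OF \<phi>]] hlim])
    moreover have "(\<lambda>n. (-1) ^ length is * (LINT x|lborel. g n x * \<phi> x)) \<longlonglongrightarrow> (-1) ^ length is * (LINT x|lborel. w x * \<phi> x)"
      by (intro tendsto_mult tendsto_const L2_integral_tendsto[OF gL w(1) test_function_L2[OF \<phi>] w(2)])
    ultimately show "(LINT x|lborel. potential \<kappa> f x * partials is \<phi> x) = (-1) ^ length is * (LINT x|lborel. w x * \<phi> x)"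
      unfolding g_def smooth_parts_partials[OF potential_smooth[OF \<psi>(1)] \<phi>] by (rule LIMSEQ_unique)
  qed
  then show ?thesis
    using that w(1) by blast
qed

lemma potential_W22: "f \<in> L2 \<Longrightarrow> potential \<kappa> f \<in> W22"
  unfolding W22_def using potential_L2[OF \<kappa>] potential_weak_partials by blast

lemma potential_equation:
  assumes f: "f \<in> L2" and \<phi>: "\<phi> \<in> test_functions UNIV"
  shows "(LINT x|lborel. potential \<kappa> f x * (laplacian \<phi> x + \<kappa>\<^sup>2 * \<phi> x)) = - of_real delta_mass * (LINT x|lborel. f x * \<phi> x)"
proof -
  obtain \<psi> where \<psi>: "\<And>n. \<psi> n \<in> test_functions UNIV" "(\<lambda>n. sqnorm (\<lambda>x. \<psi> n x - f x)) \<longlonglongrightarrow> 0"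
    using L2_dense[OF f] by blast
  note \<psi>L = test_function_L2[OF \<psi>(1)]
  define \<phi>' where "\<phi>' x = laplacian \<phi> x + \<kappa>\<^sup>2 * \<phi> x" for x
  have \<phi>': "\<phi>' \<in> test_functions UNIV"
    unfolding \<phi>'_def by (intro test_function_add test_function_laplacian test_function_cmult \<phi>)
  have eq: "(LINT x|lborel. potential \<kappa> (\<psi> n) x * \<phi>' x) = - of_real delta_mass * (LINT x|lborel. \<psi> n x * \<phi> x)" for n
  proof -
    define h where "h = potential \<kappa> (\<psi> n)"
    have sm: "smooth h"
      unfolding h_def by (rule potential_smooth[OF \<psi>(1)])
    have hL: "h \<in> L2" "partial i (partial i h) \<in> L2" for i
      unfolding h_def by (simp_all add: partial_potential \<psi> test_function_partial potential_test_L2)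
    have "(LINT x|lborel. h x * laplacian \<phi> x) = (\<Sum>i\<in>UNIV. LINT x|lborel. h x * partials [i, i] \<phi> x)"
      unfolding laplacian_def sum_distrib_left
      by (simp, intro Bochner_Integration.integral_sum L2_mult_integrable(1) hL test_function_L2 test_function_partial \<phi>)
    also have "\<dots> = (\<Sum>i\<in>UNIV. LINT x|lborel. partial i (partial i h) x * \<phi> x)"
      unfolding smooth_parts_partials[OF sm \<phi>] by simp
    also have "\<dots> = (LINT x|lborel. laplacian h x * \<phi> x)"
      unfolding laplacian_def sum_distrib_right
      by (intro Bochner_Integration.integral_sum[symmetric] L2_mult_integrable(1) hL test_function_L2 \<phi>)
    finally have "(LINT x|lborel. h x * \<phi>' x) = (LINT x|lborel. laplacian h x * \<phi> x) + (LINT x|lborel. h x * (\<kappa>\<^sup>2 * \<phi> x))"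
      unfolding \<phi>'_def distrib_left
      using L2_mult_integrable(1)[OF hL(1) test_function_L2[OF test_function_laplacian[OF \<phi>]]]
        L2_mult_integrable(1)[OF hL(1) test_function_L2[OF test_function_cmult[OF \<phi>]]]
      by (subst Bochner_Integration.integral_add) auto
    also have "\<dots> = (LINT x|lborel. laplacian h x * \<phi> x + h x * (\<kappa>\<^sup>2 * \<phi> x))"
    proof (rule Bochner_Integration.integral_add[symmetric])
      show "integrable lborel (\<lambda>x. laplacian h x * \<phi> x)"
        unfolding laplacian_def sum_distrib_right
        by (intro Bochner_Integration.integrable_sum L2_mult_integrable(1) hL test_function_L2 \<phi>)
    qed (intro L2_mult_integrable(1) hL test_function_L2 test_function_cmult \<phi>)
    also have "\<dots> = (LINT x|lborel. - of_real delta_mass * (\<psi> n x * \<phi> x))"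
      unfolding h_def helmholtz_potential[OF \<psi>(1)] by (simp add: algebra_simps)
    finally show ?thesis
      unfolding h_def by simp
  qed
  note hlim = potential_tendsto[OF f \<psi>L \<psi>(2)]
  have l1: "(\<lambda>n. LINT x|lborel. potential \<kappa> (\<psi> n) x * \<phi>' x) \<longlonglongrightarrow> (LINT x|lborel. potential \<kappa> f x * \<phi>' x)"
    by (rule L2_integral_tendsto[OF potential_test_L2[OF \<psi>(1)] potential_L2[OF \<kappa> f] test_function_L2[OF \<phi>'] hlim])
  have l2: "(\<lambda>n. - of_real delta_mass * (LINT x|lborel. \<psi> n x * \<phi> x)) \<longlonglongrightarrow> - of_real delta_mass * (LINT x|lborel. f x * \<phi> x)"
    by (intro tendsto_mult tendsto_const L2_integral_tendsto[OF \<psi>L f test_function_L2[OF \<phi>] \<psi>(2)])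
  from LIMSEQ_unique[OF l1[unfolded eq] l2] show ?thesis
    by (simp add: \<phi>'_def)
qed

text \<open>The difference of two solutions has no source, which is the point source problem with
  coefficient 0.\<close>

lemma helmholtz_solution_eq_potential:
  assumes q: "q \<in> L2" and F: "F \<in> L2"
    and eq: "\<And>\<phi>. \<phi> \<in> test_functions UNIV \<Longrightarrow>
      (LINT x|lborel. q x * (laplacian \<phi> x + \<kappa>\<^sup>2 * \<phi> x)) = - of_real delta_mass * (LINT x|lborel. F x * \<phi> x)"
  shows "ae_eq q (potential \<kappa> F)"
proof -
  have "ae_eq (\<lambda>x. q x - potential \<kappa> F x) (\<lambda>x. 0 * outgoing \<kappa> x)"
  proof (rule helmholtz_point_source_unique)
    fix \<phi> :: "R3 \<Rightarrow> complex" assume \<phi>: "\<phi> \<in> test_functions UNIV"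
    define \<phi>' where "\<phi>' x = laplacian \<phi> x + \<kappa>\<^sup>2 * \<phi> x" for x
    have \<phi>': "\<phi>' \<in> L2"
      unfolding \<phi>'_def by (intro test_function_L2 test_function_add test_function_laplacian test_function_cmult \<phi>)
    show "(LINT x|lborel. (q x - potential \<kappa> F x) * (laplacian \<phi> x + \<kappa>\<^sup>2 * \<phi> x)) = - of_real delta_mass * 0 * \<phi> 0"
      using eq[OF \<phi>] potential_equation[OF F \<phi>] L2_mult_integrable(1)[OF q \<phi>'] L2_mult_integrable(1)[OF potential_L2[OF \<kappa> F] \<phi>']
      by (simp add: left_diff_distrib flip: \<phi>'_def)
  qed (use \<kappa> in \<open>auto intro!: L2_diff q potential_L2 F\<close>)
  then show ?thesis
    by (simp add: ae_eq_def)
qed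

end

end

section \<open>The point interactions\<close>

lemma W22_L2: "f \<in> W22 \<Longrightarrow> f \<in> L2"
  by (simp add: W22_def)

lemma W22_add:
  assumes f: "f \<in> W22" and g: "g \<in> W22" shows "(\<lambda>x. f x + g x) \<in> W22"
proof -
  have "\<exists>w\<in>L2. weak_partials is (\<lambda>x. f x + g x) w" if len: "length is \<le> 2" for "is"
  proof -
    obtain v w where v: "v \<in> L2" "weak_partials is f v" and w: "w \<in> L2" "weak_partials is g w"
      using f g len unfolding W22_def by blast
    have "weak_partials is (\<lambda>x. f x + g x) (\<lambda>x. v x + w x)"
      unfolding weak_partials_def
    proof
      fix \<phi> :: "R3 \<Rightarrow> complex" assume \<phi>: "\<phi> \<in> test_functions UNIV"
      note L = test_function_L2[OF \<phi>] test_function_L2[OF test_function_partials[OF \<phi>, of "is"]]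
      show "(LINT x|lborel. (f x + g x) * partials is \<phi> x) = (-1) ^ length is * (LINT x|lborel. (v x + w x) * \<phi> x)"
        using v(2) w(2) \<phi> L2_mult_integrable(1)[OF W22_L2[OF f] L(2)] L2_mult_integrable(1)[OF W22_L2[OF g] L(2)]
          L2_mult_integrable(1)[OF v(1) L(1)] L2_mult_integrable(1)[OF w(1) L(1)]
        by (simp add: weak_partials_def distrib_right distrib_left)
    qed
    then show ?thesis
      using L2_add[OF v(1) w(1)] by blast
  qed
  then show ?thesis
    using L2_add[OF W22_L2[OF f] W22_L2[OF g]] by (simp add: W22_def)
qed

lemma W22_cmult:
  assumes f: "f \<in> W22" shows "(\<lambda>x. c * f x) \<in> W22"
proof -
  have "\<exists>w\<in>L2. weak_partials is (\<lambda>x. c * f x) w" if len: "length is \<le> 2" for "is"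
  proof -
    obtain v where v: "v \<in> L2" "weak_partials is f v"
      using f len unfolding W22_def by blast
    have "weak_partials is (\<lambda>x. c * f x) (\<lambda>x. c * v x)"
      using v(2) by (simp only: weak_partials_def mult.assoc integral_mult_right_zero) (simp add: mult.left_commute)
    then show ?thesis
      using L2_cmult[OF v(1)] by blast
  qed
  then show ?thesis
    using L2_cmult[OF W22_L2[OF f]] by (simp add: W22_def)
qed

text \<open>Equality almost everywhere says nothing at the single point 0. But if the limit differed
  from \<open>g 0\<close>, then \<open>g\<close> and \<open>q\<close> would differ on a whole
  punctured ball, which has positive measure. This is how the boundary condition is read
  off.\<close>

lemma continuous_AE_limit:
  fixes g q :: "R3 \<Rightarrow> complex"
  assumes g: "continuous_on UNIV g" and q: "(q \<longlongrightarrow> l) (at 0)" and ae: "ae_eq g q"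
  shows "g 0 = l"
proof (rule ccontr)
  assume neq: "g 0 \<noteq> l"
  define e where "e = dist (g 0) l / 2"
  have e: "e > 0"
    using neq by (simp add: e_def)
  have "(g \<longlongrightarrow> g 0) (at 0)"
    using g by (simp add: continuous_on_def)
  then have "eventually (\<lambda>x. dist (g x) (g 0) < e) (at 0)"
    using e tendstoD by blast
  moreover have "eventually (\<lambda>x. dist (q x) l < e) (at 0)"
    using q e tendstoD by blast
  ultimately have "eventually (\<lambda>x. g x \<noteq> q x) (at 0)"
  proof eventually_elim
    case (elim x)
    show ?case
      using elim dist_triangle3[of "g 0" l "g x"] by (auto simp: e_def)
  qed
  then obtain d where d: "d > 0" "\<And>x. x \<noteq> 0 \<Longrightarrow> dist x 0 < d \<Longrightarrow> g x \<noteq> q x"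
    unfolding eventually_at by auto
  have "ball 0 d - {0} = ({} :: R3 set)"
  proof (rule open_AE_empty)
    show "AE x in lborel. x \<notin> ball (0 :: R3) d - {0}"
      using ae unfolding ae_eq_def by eventually_elim (use d(2) in \<open>auto simp: dist_commute\<close>)
  qed auto
  moreover have "(d / 2) *\<^sub>R axis 1 1 \<in> ball 0 d - {0 :: R3}"
    using d(1) by (simp add: axis_eq_0_iff)
  ultimately show False
    by blast
qed

lemma adjoint_diff:
  assumes "(u, w) \<in> adjoint L_min" and "(u', w') \<in> adjoint L_min"
  shows "(\<lambda>x. u x - u' x, \<lambda>x. w x - w' x) \<in> adjoint L_min"
proof -
  have L: "u \<in> L2" "w \<in> L2" "u' \<in> L2" "w' \<in> L2"
    using assms by (auto simp: adjoint_def)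
  have "L2_inner \<psi> (\<lambda>x. u x - u' x) = L2_inner \<phi> (\<lambda>x. w x - w' x)" if m: "(\<phi>, \<psi>) \<in> L_min" for \<phi> \<psi>
  proof -
    obtain "\<phi> \<in> test_functions (- {0})" and \<psi>: "\<psi> = (\<lambda>x. - laplacian \<phi> x)"
      using m by (auto simp: L_min_def laplacian_def[abs_def])
    then have \<phi>: "\<phi> \<in> test_functions UNIV"
      using test_functions_mono by blast
    have L': "\<phi> \<in> L2" "\<psi> \<in> L2"
      unfolding \<psi> by (intro L2_uminus test_function_L2 test_function_laplacian \<phi>)+
    have "L2_inner \<psi> u = L2_inner \<phi> w" "L2_inner \<psi> u' = L2_inner \<phi> w'"
      using assms m by (auto simp: adjoint_def)
    then show ?thesis
      using L2_mult_integrable(1)[OF L'(2) L2_cnj[OF L(1)]] L2_mult_integrable(1)[OF L'(2) L2_cnj[OF L(3)]]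
        L2_mult_integrable(1)[OF L'(1) L2_cnj[OF L(2)]] L2_mult_integrable(1)[OF L'(1) L2_cnj[OF L(4)]]
      by (simp add: L2_inner_def right_diff_distrib)
  qed
  then show ?thesis
    using L by (auto simp: adjoint_def intro: L2_diff)
qed

text \<open>The bilinear identity suffices because test functions away from the origin are stable
  under conjugation.\<close>

lemma adjointI:
  assumes u: "u \<in> L2" and w: "w \<in> L2"
    and eq: "\<And>\<eta>. \<eta> \<in> test_functions (- {0}) \<Longrightarrow> (LINT x|lborel. u x * laplacian \<eta> x) = - (LINT x|lborel. w x * \<eta> x)"
  shows "(u, w) \<in> adjoint L_min"
proof -
  have "L2_inner \<psi> u = L2_inner \<phi> w" if m: "(\<phi>, \<psi>) \<in> L_min" for \<phi> \<psi>
  proof -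
    obtain \<phi>: "\<phi> \<in> test_functions (- {0})" and \<psi>: "\<psi> = (\<lambda>x. - laplacian \<phi> x)"
      using m by (auto simp: L_min_def laplacian_def[abs_def])
    have sm: "smooth \<phi>"
      using \<phi> by (rule test_function_smooth)
    have "cnj (L2_inner \<psi> u) = - (LINT x|lborel. u x * laplacian (\<lambda>x. cnj (\<phi> x)) x)"
      unfolding L2_inner_def \<psi> laplacian_cnj[OF sm] Bochner_Integration.integral_cnj[symmetric] integral_minus[symmetric]
      by (simp add: mult.commute)
    also have "\<dots> = (LINT x|lborel. w x * cnj (\<phi> x))"
      by (simp add: eq[OF test_function_cnj[OF \<phi>]])
    also have "\<dots> = cnj (L2_inner \<phi> w)"
      unfolding L2_inner_def Bochner_Integration.integral_cnj[symmetric] by (simp add: mult.commute)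
    finally show ?thesis
      by simp
  qed
  then show ?thesis
    using u w by (auto simp: adjoint_def)
qed

section \<open>The boundary condition and the operator\<close>

context cutoff
begin

lemma theta_0: "\<theta> 0 = 1"
  using theta_one by (rule eventually_nhds_x_imp_x)

definition singular_part :: "real \<Rightarrow> R3 \<Rightarrow> complex" where
  "singular_part \<mu> x = \<theta> x * of_real (1 / norm x + \<mu>)"

lemma singular_part_L2: "singular_part \<mu> \<in> L2"
proof -
  have "(\<lambda>x. outgoing 0 x * scaled 1 x + of_real \<mu> * \<theta> x) \<in> L2"
    by (intro L2_add L2_cmult outgoing_scaled_L2 test_function_L2 theta_test) auto
  moreover have "(\<lambda>x. outgoing 0 x * scaled 1 x + of_real \<mu> * \<theta> x) = singular_part \<mu>"
    by (auto simp: singular_part_def outgoing_def scaled_def algebra_simps)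
  ultimately show ?thesis by simp
qed

text \<open>Near 0 the cut-off is 1, so 1/|x| cancels and what remains is a difference quotient of
  the exponential minus \<mu>. The zero of this limit,
  \<open>\<i> * \<kappa> = of_real \<mu>\<close>, locates the eigenvalue or the resonance.\<close>

lemma outgoing_singular_limit:
  "((\<lambda>x. outgoing \<kappa> x - singular_part \<mu> x) \<longlongrightarrow> \<i> * \<kappa> - of_real \<mu>) (at 0)"
proof -
  have "((\<lambda>z. exp (\<i> * \<kappa> * z)) has_field_derivative (\<i> * \<kappa>)) (at 0)"
    by (auto intro!: derivative_eq_intros)
  then have 1: "((\<lambda>z. (exp (\<i> * \<kappa> * z) - 1) / z) \<longlongrightarrow> \<i> * \<kappa>) (at 0)"
    by (simp add: DERIV_def)
  have "filterlim (\<lambda>x :: R3. complex_of_real (norm x)) (at 0) (at 0)"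
  proof (rule filterlim_atI)
    have "((\<lambda>x :: R3. complex_of_real (norm x)) \<longlongrightarrow> of_real (norm (0 :: R3))) (at 0)"
      by (intro tendsto_intros)
    then show "((\<lambda>x :: R3. complex_of_real (norm x)) \<longlongrightarrow> 0) (at 0)"
      by simp
    show "\<forall>\<^sub>F x in at (0 :: R3). complex_of_real (norm x) \<noteq> 0"
      by (auto simp: eventually_at intro!: exI[of _ 1])
  qed
  from filterlim_compose[OF 1 this]
  have "((\<lambda>x :: R3. (exp (\<i> * \<kappa> * of_real (norm x)) - 1) / of_real (norm x) - of_real \<mu>) \<longlongrightarrow> \<i> * \<kappa> - of_real \<mu>) (at 0)"
    by (intro tendsto_intros)
  moreover have "eventually (\<lambda>x. (exp (\<i> * \<kappa> * of_real (norm x)) - 1) / of_real (norm x) - of_real \<mu>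
      = outgoing \<kappa> x - singular_part \<mu> x) (at 0)"
    using eventually_nhds_conv_at[THEN iffD1, OF theta_one, THEN conjunct1]
    by eventually_elim (simp add: outgoing_def singular_part_def diff_divide_distrib)
  ultimately show ?thesis
    by (rule Lim_transform_eventually)
qed

text \<open>The difference solves a Helmholtz equation with square integrable right-hand side, so it inherits the
  regularity of the potential that solves the same equation.\<close>
lemma outgoing_singular_potential:
  assumes \<kappa>: "Im \<kappa> > 0"
  obtains F where "F \<in> L2" and "ae_eq (\<lambda>x. outgoing \<kappa> x - singular_part \<mu> x) (potential \<kappa> F)"
proof -
  obtain a where a: "a > 0" and "\<And>x. norm x < a \<Longrightarrow> \<theta> x = 1"
    and in0: "\<And>is x. norm x < a \<Longrightarrow> is \<noteq> [] \<Longrightarrow> partials is \<theta> x = 0"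
    using theta_near_0 by metis
  note \<theta>s = test_function_smooth[OF theta_test]
  have [measurable]: "\<theta> \<in> borel_measurable borel" "partial i \<theta> \<in> borel_measurable borel" "laplacian \<theta> \<in> borel_measurable borel" for i
    by (intro smooth_measurable smooth_partial smooth_laplacian \<theta>s)+
  \<comment> \<open>\<open>P1\<close> and \<open>P2\<close> come from the product rule for \<theta>
    and 1/|x|. Derivatives of \<theta> vanish for |x| < \<open>a\<close>, so the negative powers of
    the norm are bounded where they matter.\<close>
  define P1 where "P1 x = of_real (1 / norm x) * laplacian \<theta> x" for x
  define P2 where "P2 i x = of_real (x $ i / norm x ^ 3) * partial i \<theta> x" for i x
  have P1: "P1 \<in> L2"
  proof (rule L2_bound[OF test_function_L2[OF test_function_laplacian[OF theta_test]], where C="1 / a"])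
    have "cmod (P1 x) \<le> 1 / a * cmod (laplacian \<theta> x)" for x
    proof (cases "norm x < a")
      case True
      then show ?thesis
        using in0[of x "[i, i]" for i] by (simp add: P1_def laplacian_def)
    next
      case False
      then have "1 / norm x \<le> 1 / a"
        using a by (intro divide_left_mono mult_pos_pos) auto
      then show ?thesis
        unfolding P1_def norm_mult by (intro mult_right_mono) (auto simp: norm_divide)
    qed
    then show "AE x in lborel. cmod (P1 x) \<le> 1 / a * cmod (laplacian \<theta> x)" by blast
    show "P1 \<in> borel_measurable borel"
      unfolding P1_def by measurable
  qed
  have P2: "P2 i \<in> L2" for i
  proof (rule L2_bound[OF test_function_L2[OF test_function_partial[OF theta_test, of i]], where C="1 / a\<^sup>2"])
    have "cmod (P2 i x) \<le> 1 / a\<^sup>2 * cmod (partial i \<theta> x)" for x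
    proof (cases "norm x < a")
      case True
      then show ?thesis
        using in0[of x "[i]"] by (simp add: P2_def)
    next
      case False
      then have nx: "norm x > 0" "norm x \<ge> a"
        using a by auto
      have "\<bar>x $ i\<bar> / norm x ^ 3 \<le> norm x / norm x ^ 3"
        by (intro divide_right_mono component_le_norm_cart) auto
      also have "\<dots> = 1 / (norm x)\<^sup>2"
        using nx by (simp add: eval_nat_numeral)
      also have "\<dots> \<le> 1 / a\<^sup>2"
        using nx a by (intro divide_left_mono power_mono mult_pos_pos) auto
      finally show ?thesis
        unfolding P2_def norm_mult by (intro mult_right_mono) (auto simp: norm_divide norm_power)
    qed
    then show "AE x in lborel. cmod (P2 i x) \<le> 1 / a\<^sup>2 * cmod (partial i \<theta> x)" by blast
    show "P2 i \<in> borel_measurable borel"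
      unfolding P2_def by measurable
  qed
  \<comment> \<open>This is \<open>\<Delta> + \<kappa>\<^sup>2\<close> applied to the difference and
    divided by minus \<open>delta_mass\<close>: the two point masses cancel. The coefficient -2
    combines the 2 of the product rule with the minus sign in the gradient of 1/|x|.\<close>
  define F where "F x = (1 / of_real delta_mass) * (P1 x + (- 2) * (\<Sum>i\<in>UNIV. P2 i x) + of_real \<mu> * laplacian \<theta> x + \<kappa>\<^sup>2 * singular_part \<mu> x)" for x
  have sumL2: "(\<lambda>x. \<Sum>i\<in>UNIV. P2 i x) \<in> L2"
    unfolding UNIV_3 by (simp add: L2_add P2)
  have F: "F \<in> L2"
    unfolding F_def by (intro L2_cmult L2_add P1 sumL2 test_function_L2 test_function_laplacian theta_test singular_part_L2)
  have loc0: "locally_integrable (outgoing 0)"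
    by (rule locally_integrable_outgoing) simp
  have key: "(LINT x|lborel. (outgoing \<kappa> x - singular_part \<mu> x) * (laplacian \<phi> x + \<kappa>\<^sup>2 * \<phi> x))
      = - of_real delta_mass * (LINT x|lborel. F x * \<phi> x)" if \<phi>: "\<phi> \<in> test_functions UNIV" for \<phi>
  proof -
    note \<phi>s = test_function_smooth[OF \<phi>]
    have \<theta>\<phi>: "(\<lambda>x. \<theta> x * \<phi> x) \<in> test_functions UNIV"
      by (intro test_function_mult_smooth theta_test \<phi>s)
    have \<theta>i\<phi>: "(\<lambda>x. partial i \<theta> x * \<phi> x) \<in> test_functions UNIV" for i
      by (intro test_function_mult_smooth test_function_partial theta_test \<phi>s)
    \<comment> \<open>Every derivative of \<phi> is absorbed into the derivative of a product with
      \<theta> or its partials. These products are test functions, against which 1/|x| and its weak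
      gradient are known.\<close>
    have lap: "\<theta> x * laplacian \<phi> x = laplacian (\<lambda>x. \<theta> x * \<phi> x) x
        - 2 * (\<Sum>i\<in>UNIV. partial i (\<lambda>x. partial i \<theta> x * \<phi> x) x) + laplacian \<theta> x * \<phi> x" for x
      unfolding laplacian_mult[OF \<theta>s \<phi>s]
      by (simp add: smooth_mult_partial smooth_partial \<theta>s \<phi>s laplacian_def sum.distrib sum_distrib_left sum_distrib_right algebra_simps)
    have o0: "outgoing 0 x = of_real (1 / norm x)" for x
      by (simp add: outgoing_def)
    have i1: "integrable lborel (\<lambda>x. outgoing 0 x * laplacian (\<lambda>x. \<theta> x * \<phi> x) x)"
      by (intro locally_integrable_mult_test loc0 test_function_laplacian \<theta>\<phi>)
    have i2: "integrable lborel (\<lambda>x. outgoing 0 x * partial i (\<lambda>x. partial i \<theta> x * \<phi> x) x)" for i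
      by (intro locally_integrable_mult_test loc0 test_function_partial \<theta>i\<phi>)
    have i3: "integrable lborel (\<lambda>x. P1 x * \<phi> x)"
      by (intro L2_mult_integrable(1) P1 test_function_L2 \<phi>)
    have i4: "integrable lborel (\<lambda>x. P2 i x * \<phi> x)" for i
      by (intro L2_mult_integrable(1) P2 test_function_L2 \<phi>)
    have i5: "integrable lborel (\<lambda>x. \<theta> x * laplacian \<phi> x)" "integrable lborel (\<lambda>x. laplacian \<theta> x * \<phi> x)"
      by (intro L2_mult_integrable(1) test_function_L2 test_function_laplacian theta_test \<phi>)+
    have i6: "integrable lborel (\<lambda>x. singular_part \<mu> x * \<phi> x)"
      by (intro L2_mult_integrable(1) singular_part_L2 test_function_L2 \<phi>)
    have i7: "integrable lborel (\<lambda>x. outgoing 0 x * (\<theta> x * laplacian \<phi> x))"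
      by (intro locally_integrable_mult_test loc0 test_function_mult_smooth theta_test smooth_laplacian \<phi>s)
    have A: "(LINT x|lborel. outgoing 0 x * (\<theta> x * laplacian \<phi> x))
        = - of_real delta_mass * \<phi> 0 - 2 * (\<Sum>i\<in>UNIV. LINT x|lborel. P2 i x * \<phi> x) + (LINT x|lborel. P1 x * \<phi> x)"
    proof -
      have P2eq: "(LINT x|lborel. outgoing 0 x * partial i (\<lambda>x. partial i \<theta> x * \<phi> x) x) = (LINT x|lborel. P2 i x * \<phi> x)" for i
        unfolding o0 integral_inverse_norm_partial[OF \<theta>i\<phi>] by (simp add: P2_def mult.assoc)
      have "(LINT x|lborel. outgoing 0 x * (\<theta> x * laplacian \<phi> x))
          = (LINT x|lborel. outgoing 0 x * laplacian (\<lambda>x. \<theta> x * \<phi> x) x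
              - 2 * (\<Sum>i\<in>UNIV. outgoing 0 x * partial i (\<lambda>x. partial i \<theta> x * \<phi> x) x) + P1 x * \<phi> x)"
        unfolding lap by (intro Bochner_Integration.integral_cong refl)
          (simp add: o0 P1_def algebra_simps sum_distrib_left sum_divide_distrib)
      also have "\<dots> = (LINT x|lborel. outgoing 0 x * laplacian (\<lambda>x. \<theta> x * \<phi> x) x)
              - 2 * (\<Sum>i\<in>UNIV. LINT x|lborel. outgoing 0 x * partial i (\<lambda>x. partial i \<theta> x * \<phi> x) x) + (LINT x|lborel. P1 x * \<phi> x)"
        using i1 i2 i3 by simp
      also have "(LINT x|lborel. outgoing 0 x * laplacian (\<lambda>x. \<theta> x * \<phi> x) x) = - of_real delta_mass * \<phi> 0"
        using fundamental_solution[OF \<theta>\<phi>, of 0] by (simp add: theta_0)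
      finally show ?thesis
        unfolding P2eq .
    qed
    have B: "(LINT x|lborel. \<theta> x * laplacian \<phi> x) = (LINT x|lborel. laplacian \<theta> x * \<phi> x)"
    proof -
      have "(LINT x|lborel. \<theta> x * laplacian \<phi> x) = (\<Sum>i\<in>UNIV. LINT x|lborel. \<theta> x * partials [i, i] \<phi> x)"
        unfolding laplacian_def sum_distrib_left
        by (simp, intro Bochner_Integration.integral_sum L2_mult_integrable(1) test_function_L2 test_function_partial theta_test \<phi>)
      also have "\<dots> = (\<Sum>i\<in>UNIV. LINT x|lborel. partial i (partial i \<theta>) x * \<phi> x)"
        unfolding smooth_parts_partials[OF \<kappa> \<theta>s \<phi>] by simp
      also have "\<dots> = (LINT x|lborel. laplacian \<theta> x * \<phi> x)"
        unfolding laplacian_def sum_distrib_right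
        by (intro Bochner_Integration.integral_sum[symmetric] L2_mult_integrable(1) test_function_L2 test_function_partial theta_test \<phi>)
      finally show ?thesis .
    qed
    have eL: "integrable lborel (\<lambda>x. outgoing \<kappa> x * (laplacian \<phi> x + \<kappa>\<^sup>2 * \<phi> x))"
      by (intro L2_mult_integrable(1) outgoing_L2 \<kappa> test_function_L2 test_function_add test_function_laplacian test_function_cmult \<phi>)
    have "(LINT x|lborel. (outgoing \<kappa> x - singular_part \<mu> x) * (laplacian \<phi> x + \<kappa>\<^sup>2 * \<phi> x))
        = (LINT x|lborel. outgoing \<kappa> x * (laplacian \<phi> x + \<kappa>\<^sup>2 * \<phi> x) - outgoing 0 x * (\<theta> x * laplacian \<phi> x)
            - of_real \<mu> * (\<theta> x * laplacian \<phi> x) - \<kappa>\<^sup>2 * (singular_part \<mu> x * \<phi> x))"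
      by (intro Bochner_Integration.integral_cong refl) (simp add: o0 singular_part_def algebra_simps)
    also have "\<dots> = - of_real delta_mass * \<phi> 0 - (LINT x|lborel. outgoing 0 x * (\<theta> x * laplacian \<phi> x))
            - of_real \<mu> * (LINT x|lborel. \<theta> x * laplacian \<phi> x) - \<kappa>\<^sup>2 * (LINT x|lborel. singular_part \<mu> x * \<phi> x)"
      using eL i5(1) i6 i7 fundamental_solution[OF \<phi>, of \<kappa>] by simp
    also have "\<dots> = - ((LINT x|lborel. P1 x * \<phi> x) - 2 * (\<Sum>i\<in>UNIV. LINT x|lborel. P2 i x * \<phi> x)
            + of_real \<mu> * (LINT x|lborel. laplacian \<theta> x * \<phi> x) + \<kappa>\<^sup>2 * (LINT x|lborel. singular_part \<mu> x * \<phi> x))"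
      unfolding A B by (simp add: algebra_simps)
    also have "\<dots> = - (LINT x|lborel. P1 x * \<phi> x - 2 * (\<Sum>i\<in>UNIV. P2 i x * \<phi> x)
            + of_real \<mu> * (laplacian \<theta> x * \<phi> x) + \<kappa>\<^sup>2 * (singular_part \<mu> x * \<phi> x))"
      using i3 i4 i5(2) i6 by simp
    also have "\<dots> = - (LINT x|lborel. of_real delta_mass * (F x * \<phi> x))"
      using delta_mass_pos by (intro arg_cong[where f=uminus] Bochner_Integration.integral_cong refl)
        (simp add: F_def algebra_simps, simp add: sum_distrib_left)
    finally show ?thesis by simp
  qed
  have "ae_eq (\<lambda>x. outgoing \<kappa> x - singular_part \<mu> x) (potential \<kappa> F)"
    by (rule helmholtz_solution_eq_potential[OF \<kappa> L2_diff[OF outgoing_L2[OF \<kappa>] singular_part_L2] F key])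
  then show ?thesis
    using that F by blast
qed

text \<open>The regular part of the function has the value \<open>potential \<kappa> f 0 + c * (\<i>
  * \<kappa> - of_real \<mu>)\<close> at the origin, and the hypothesis on \<open>c\<close> says
  that it vanishes. With \<open>f\<close> zero the lemma also produces the eigenfunction.\<close>

lemma L_op_solution:
  assumes \<kappa>: "Im \<kappa> > 0" and f: "f \<in> L2" and c: "c * (of_real \<mu> - \<i> * \<kappa>) = potential \<kappa> f 0"
  shows "(\<lambda>x. potential \<kappa> f x + c * outgoing \<kappa> x,
      \<lambda>x. of_real delta_mass * f x + \<kappa>\<^sup>2 * (potential \<kappa> f x + c * outgoing \<kappa> x)) \<in> L_op \<theta> \<mu>"
proof -
  define u where "u x = potential \<kappa> f x + c * outgoing \<kappa> x" for x
  have u: "u \<in> L2"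
    unfolding u_def by (intro L2_add L2_cmult potential_L2 \<kappa> f outgoing_L2)
  have adj: "(u, \<lambda>x. of_real delta_mass * f x + \<kappa>\<^sup>2 * u x) \<in> adjoint L_min"
  proof (rule adjointI[OF u])
    show wL: "(\<lambda>x. of_real delta_mass * f x + \<kappa>\<^sup>2 * u x) \<in> L2"
      by (intro L2_add L2_cmult f u)
    fix \<eta> :: "R3 \<Rightarrow> complex" assume \<eta>0: "\<eta> \<in> test_functions (- {0})"
    then have \<eta>: "\<eta> \<in> test_functions UNIV"
      using test_functions_mono by blast
    \<comment> \<open>The point mass created by the outgoing wave is invisible to test functions
      that vanish at the origin.\<close>
    have "0 \<notin> closure {x. \<eta> x \<noteq> 0}"
      using \<eta>0 by (auto simp: test_functions_def)
    then have "\<eta> 0 = 0"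
      using closure_subset[of "{x. \<eta> x \<noteq> 0}"] by auto
    define \<eta>' where "\<eta>' x = laplacian \<eta> x + \<kappa>\<^sup>2 * \<eta> x" for x
    have \<eta>': "\<eta>' \<in> L2"
      unfolding \<eta>'_def by (intro test_function_L2 test_function_add test_function_laplacian test_function_cmult \<eta>)
    have "(LINT x|lborel. u x * \<eta>' x) = (LINT x|lborel. potential \<kappa> f x * \<eta>' x) + c * (LINT x|lborel. outgoing \<kappa> x * \<eta>' x)"
      using L2_mult_integrable(1)[OF potential_L2[OF \<kappa> f] \<eta>'] L2_mult_integrable(1)[OF outgoing_L2[OF \<kappa>] \<eta>']
      by (simp add: u_def distrib_right mult.assoc)
    also have "\<dots> = - of_real delta_mass * (LINT x|lborel. f x * \<eta> x)"
      unfolding \<eta>'_def potential_equation[OF \<kappa> f \<eta>] fundamental_solution[OF \<eta>] by (simp add: \<open>\<eta> 0 = 0\<close>)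
    finally have eq: "(LINT x|lborel. u x * \<eta>' x) = - of_real delta_mass * (LINT x|lborel. f x * \<eta> x)" .
    have i: "integrable lborel (\<lambda>x. u x * laplacian \<eta> x)" "integrable lborel (\<lambda>x. u x * \<eta> x)" "integrable lborel (\<lambda>x. f x * \<eta> x)"
      by (intro L2_mult_integrable(1) u f test_function_L2 test_function_laplacian \<eta>)+
    have "(LINT x|lborel. u x * \<eta>' x) = (LINT x|lborel. u x * laplacian \<eta> x) + \<kappa>\<^sup>2 * (LINT x|lborel. u x * \<eta> x)"
    proof -
      have "\<kappa>\<^sup>2 * (LINT x|lborel. u x * \<eta> x) = (LINT x|lborel. u x * (\<kappa>\<^sup>2 * \<eta> x))"
        by (subst integral_mult_right_zero[symmetric]) (simp add: mult.left_commute)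
      moreover have "integrable lborel (\<lambda>x. u x * (\<kappa>\<^sup>2 * \<eta> x))"
        by (intro L2_mult_integrable(1) u test_function_L2 test_function_cmult \<eta>)
      ultimately show ?thesis
        using i(1) by (simp add: \<eta>'_def distrib_left)
    qed
    moreover have "(LINT x|lborel. (of_real delta_mass * f x + \<kappa>\<^sup>2 * u x) * \<eta> x)
        = of_real delta_mass * (LINT x|lborel. f x * \<eta> x) + \<kappa>\<^sup>2 * (LINT x|lborel. u x * \<eta> x)"
      using i by (simp add: distrib_right mult.assoc)
    ultimately show "(LINT x|lborel. u x * laplacian \<eta> x) = - (LINT x|lborel. (of_real delta_mass * f x + \<kappa>\<^sup>2 * u x) * \<eta> x)"
      using eq by (simp add: algebra_simps eq_diff_eq)
  qed
  obtain F where F: "F \<in> L2" "ae_eq (\<lambda>x. outgoing \<kappa> x - singular_part \<mu> x) (potential \<kappa> F)"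
    using outgoing_singular_potential[OF \<kappa>] by blast
  \<comment> \<open>Replacing the difference of wave and singular part by the potential of
    \<open>F\<close> exhibits the regular part as a sum of two potentials, hence continuous and in
    \<open>W22\<close>.\<close>
  define g where "g x = potential \<kappa> f x + c * potential \<kappa> F x" for x
  have pF: "potential \<kappa> F 0 = \<i> * \<kappa> - of_real \<mu>"
    by (rule continuous_AE_limit[OF potential_continuous[OF \<kappa> F(1)] outgoing_singular_limit ae_eq_sym[OF F(2)]])
  have "g 0 = 0"
    unfolding g_def c[symmetric] pF by (simp add: algebra_simps)
  moreover have "g \<in> W22"
    unfolding g_def by (intro W22_add W22_cmult potential_W22 \<kappa> f F)
  moreover have "continuous_on UNIV g"
    unfolding g_def by (intro continuous_intros potential_continuous \<kappa> f F)
  moreover have "ae_eq u (\<lambda>x. \<theta> x * c * of_real (1 / norm x + \<mu>) + g x)"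
    using F(2) unfolding ae_eq_def
  proof eventually_elim
    case (elim x)
    then show ?case
      unfolding u_def g_def elim[symmetric] singular_part_def by (simp add: algebra_simps)
  qed
  ultimately have "u \<in> dom_L \<theta> \<mu>"
    using u unfolding dom_L_def by blast
  then show ?thesis
    using adj unfolding L_op_def u_def by blast
qed

lemma L_op_eigenfunction:
  assumes \<kappa>: "Im \<kappa> \<ge> 0" and uw: "(u, w) \<in> L_op \<theta> \<mu>" and w: "ae_eq w (\<lambda>x. \<kappa>\<^sup>2 * u x)"
  obtains \<beta> where "ae_eq u (\<lambda>x. \<beta> * outgoing \<kappa> x)" and "\<beta> = 0 \<or> Im \<kappa> > 0 \<and> \<kappa> = - \<i> * of_real \<mu>"
proof -
  have adj: "(u, w) \<in> adjoint L_min"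
    using uw by (simp add: L_op_def)
  obtain \<beta> g where g: "g \<in> W22" "continuous_on UNIV g" "g 0 = 0"
      and u: "ae_eq u (\<lambda>x. \<theta> x * \<beta> * of_real (1 / norm x + \<mu>) + g x)"
    using uw by (auto simp: L_op_def dom_L_def)
  have L: "u \<in> L2" "w \<in> L2"
    using adj by (auto simp: adjoint_def)
  note [measurable] = L[THEN L2D(1)]
  have eq: "ae_eq u (\<lambda>x. \<beta> * outgoing \<kappa> x)"
  proof (rule helmholtz_point_source_unique[OF \<kappa> L(1)])
    fix \<phi> :: "R3 \<Rightarrow> complex" assume \<phi>: "\<phi> \<in> test_functions UNIV"
    have [measurable]: "\<phi> \<in> borel_measurable borel"
      by (intro smooth_measurable test_function_smooth[OF \<phi>])
    have i: "integrable lborel (\<lambda>x. u x * laplacian \<phi> x)" "integrable lborel (\<lambda>x. u x * (\<kappa>\<^sup>2 * \<phi> x))"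
      by (intro L2_mult_integrable(1) L test_function_L2 test_function_laplacian test_function_cmult \<phi>)+
    have "(LINT x|lborel. w x * \<phi> x) = (LINT x|lborel. u x * (\<kappa>\<^sup>2 * \<phi> x))"
    proof (rule integral_cong_AE)
      show "AE x in lborel. w x * \<phi> x = u x * (\<kappa>\<^sup>2 * \<phi> x)"
        using w unfolding ae_eq_def by eventually_elim simp
    qed measurable
    then show "(LINT x|lborel. u x * (laplacian \<phi> x + \<kappa>\<^sup>2 * \<phi> x)) = - of_real delta_mass * \<beta> * \<phi> 0"
      using adjoint_distribution[OF adj u g(1) \<phi>] i by (simp add: distrib_left)
  qed
  moreover have "\<beta> = 0 \<or> Im \<kappa> > 0 \<and> \<kappa> = - \<i> * of_real \<mu>"
  proof (rule ccontr)
    assume *: "\<not> (\<beta> = 0 \<or> Im \<kappa> > 0 \<and> \<kappa> = - \<i> * of_real \<mu>)"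
    show False
    proof (cases "Im \<kappa> > 0")
      case False
      have "outgoing \<kappa> \<in> L2"
      proof (rule ae_eq_L2[OF L2_cmult[OF L(1), of "1 / \<beta>"]])
        show "ae_eq (\<lambda>x. 1 / \<beta> * u x) (outgoing \<kappa>)"
          using eq unfolding ae_eq_def by eventually_elim (use * in simp)
      qed measurable
      then show False
        using outgoing_not_L2 False \<kappa> by simp
    next
      case True
      \<comment> \<open>The continuous function \<open>g\<close> vanishes at the origin, so the
        limit of the other side there must be 0 as well.\<close>
      have "ae_eq g (\<lambda>x. \<beta> * (outgoing \<kappa> x - singular_part \<mu> x))"
        using eq u unfolding ae_eq_def by eventually_elim (simp add: singular_part_def algebra_simps)
      then have "g 0 = \<beta> * (\<i> * \<kappa> - of_real \<mu>)"
        by (rule continuous_AE_limit[OF g(2) tendsto_mult[OF tendsto_const outgoing_singular_limit]])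
      then have "\<i> * \<kappa> = of_real \<mu>"
        using g(3) * by simp
      then have "- \<i> * (\<i> * \<kappa>) = - \<i> * of_real \<mu>"
        by simp
      then show False
        using True * by (simp flip: mult.assoc)
    qed
  qed
  ultimately show ?thesis
    using that by blast
qed

lemma L_op_diff:
  assumes "(u, w) \<in> L_op \<theta> \<mu>" and "(u', w') \<in> L_op \<theta> \<mu>"
  shows "(\<lambda>x. u x - u' x, \<lambda>x. w x - w' x) \<in> L_op \<theta> \<mu>"
proof -
  obtain \<beta> g where g: "g \<in> W22" "continuous_on UNIV g" "g 0 = 0"
      and u: "u \<in> L2" "ae_eq u (\<lambda>x. \<theta> x * \<beta> * of_real (1 / norm x + \<mu>) + g x)"
    using assms(1) by (auto simp: L_op_def dom_L_def)
  obtain \<beta>' g' where g': "g' \<in> W22" "continuous_on UNIV g'" "g' 0 = 0"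
      and u': "u' \<in> L2" "ae_eq u' (\<lambda>x. \<theta> x * \<beta>' * of_real (1 / norm x + \<mu>) + g' x)"
    using assms(2) by (auto simp: L_op_def dom_L_def)
  have "ae_eq (\<lambda>x. u x - u' x) (\<lambda>x. \<theta> x * (\<beta> - \<beta>') * of_real (1 / norm x + \<mu>) + (g x + (- 1) * g' x))"
    using u(2) u'(2) unfolding ae_eq_def by eventually_elim (simp add: algebra_simps)
  moreover have "(\<lambda>x. g x + (- 1) * g' x) \<in> W22"
    by (intro W22_add W22_cmult g g')
  moreover have "continuous_on UNIV (\<lambda>x. g x + (- 1) * g' x)"
    by (intro continuous_intros g g')
  ultimately have "(\<lambda>x. u x - u' x) \<in> dom_L \<theta> \<mu>"
    unfolding dom_L_def using L2_diff[OF u(1) u'(1)] g(3) g'(3)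
    by (intro CollectI conjI exI[of _ "\<beta> - \<beta>'"] exI[of _ "\<lambda>x. g x + (- 1) * g' x"]) auto
  then show ?thesis
    using adjoint_diff assms by (auto simp: L_op_def)
qed

text \<open>Graphs consist of representatives. The eigenspace therefore contains each square
  integrable function that is almost everywhere a multiple of \<open>v \<mu>\<close>, and this lemma
  reaches all of them.\<close>

lemma L_op_ae_cong:
  assumes uw: "(u, w) \<in> L_op \<theta> \<mu>" and u': "u' \<in> L2" "ae_eq u u'" and w': "w' \<in> L2" "ae_eq w w'"
  shows "(u', w') \<in> L_op \<theta> \<mu>"
proof -
  have adj: "(u, w) \<in> adjoint L_min"
    using uw by (simp add: L_op_def)
  have L: "u \<in> L2" "w \<in> L2"
    using adj by (auto simp: adjoint_def)
  have "L2_inner \<psi> u' = L2_inner \<phi> w'" if m: "(\<phi>, \<psi>) \<in> L_min" for \<phi> \<psi>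
  proof -
    obtain "\<phi> \<in> test_functions (- {0})" and \<psi>: "\<psi> = (\<lambda>x. - laplacian \<phi> x)"
      using m by (auto simp: L_min_def laplacian_def[abs_def])
    then have \<phi>: "\<phi> \<in> test_functions UNIV"
      using test_functions_mono by blast
    have [measurable]: "\<phi> \<in> borel_measurable borel" "\<psi> \<in> borel_measurable borel"
      unfolding \<psi> using L2D(1)[OF test_function_L2[OF \<phi>]] L2D(1)[OF L2_uminus[OF test_function_L2[OF test_function_laplacian[OF \<phi>]]]] by auto
    note [measurable] = L2D(1)[OF u'(1)] L2D(1)[OF w'(1)] L[THEN L2D(1)]
    have "L2_inner \<psi> u' = L2_inner \<psi> u"
      unfolding L2_inner_def
    proof (rule integral_cong_AE)
      show "AE x in lborel. \<psi> x * cnj (u' x) = \<psi> x * cnj (u x)"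
        using u'(2) unfolding ae_eq_def by eventually_elim simp
    qed measurable
    also have "\<dots> = L2_inner \<phi> w"
      using adj m by (auto simp: adjoint_def)
    also have "\<dots> = L2_inner \<phi> w'"
      unfolding L2_inner_def
    proof (rule integral_cong_AE)
      show "AE x in lborel. \<phi> x * cnj (w x) = \<phi> x * cnj (w' x)"
        using w'(2) unfolding ae_eq_def by eventually_elim simp
    qed measurable
    finally show ?thesis .
  qed
  then have "(u', w') \<in> adjoint L_min"
    using u'(1) w'(1) by (auto simp: adjoint_def)
  moreover have "u' \<in> dom_L \<theta> \<mu>"
    using uw u' ae_eq_trans[OF ae_eq_sym[OF u'(2)]] unfolding L_op_def dom_L_def by blast
  ultimately show ?thesis
    by (simp add: L_op_def)
qed

end

section \<open>Resolvent, eigenvalues and resonances\<close>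

definition point_kernel :: "real \<Rightarrow> complex \<Rightarrow> R3 \<Rightarrow> R3 \<Rightarrow> complex" where
  "point_kernel \<mu> \<kappa> x y = outgoing \<kappa> (x - y) / of_real delta_mass
     + outgoing \<kappa> x * outgoing \<kappa> y / (of_real delta_mass * (of_real \<mu> - \<i> * \<kappa>))"

text \<open>Gives access to the values of \<open>K\<close>, which is an arbitrary choice. If two
  kernels differ at a regular pair, their difference stays away from 0 on a product of two balls;
  applied to the indicator of the second ball they then give different functions on the first, a set
  of positive measure.\<close>

lemma resolvent_kernel_unique:
  assumes z: "z \<in> resolvent_set A" and k: "is_resolvent_kernel A z k" and k': "is_resolvent_kernel A z k'"
    and xy: "(x0, y0) \<in> regular_pairs"
  shows "k x0 y0 = k' x0 y0"
proof (rule ccontr)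
  assume neq: "k x0 y0 \<noteq> k' x0 y0"
  define d where "d = k x0 y0 - k' x0 y0"
  \<comment> \<open>Normalized to the value 1 at the pair in question, so that near it the real part
    is at least 1/2 and no cancellation occurs in the integral.\<close>
  define q where "q p = (k (fst p) (snd p) - k' (fst p) (snd p)) / d" for p
  have d: "d \<noteq> 0"
    using neq by (simp add: d_def)
  have reg_eq: "regular_pairs = {p. fst p \<noteq> 0} \<inter> {p. snd p \<noteq> 0} \<inter> {p. fst p \<noteq> snd p}"
    by (auto simp: regular_pairs_def)
  have reg: "open regular_pairs"
    unfolding reg_eq by (intro open_Int open_Collect_neq continuous_intros)
  have "continuous_on regular_pairs q"
    unfolding q_def using k k' d by (intro continuous_intros) (auto simp: is_resolvent_kernel_def case_prod_beta)
  then have "isCont q (x0, y0)"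
    using reg xy by (simp add: continuous_on_eq_continuous_at)
  moreover have "q (x0, y0) = 1"
    using d by (simp add: q_def d_def)
  ultimately have "(q \<longlongrightarrow> 1) (nhds (x0, y0))"
    by (simp add: isCont_def tendsto_nhds_iff)
  then have "eventually (\<lambda>p. dist (q p) 1 < 1 / 2) (nhds (x0, y0))"
    by (rule tendstoD) simp
  then obtain P Q where P: "eventually P (nhds x0)" and Q: "eventually Q (nhds y0)"
      and PQ: "\<And>x y. P x \<Longrightarrow> Q y \<Longrightarrow> dist (q (x, y)) 1 < 1 / 2"
    unfolding nhds_prod eventually_prod_filter by (auto simp: split_paired_all)
  obtain r where r: "r > 0" "\<And>x. dist x x0 < r \<Longrightarrow> P x"
    using P unfolding eventually_nhds_metric by blast
  obtain s where s: "s > 0" "\<And>y. dist y y0 < s \<Longrightarrow> Q y"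
    using Q unfolding eventually_nhds_metric by blast
  have close: "Re (q (x, y)) \<ge> 1 / 2" if "x \<in> ball x0 r" "y \<in> ball y0 s" for x y
  proof -
    have "dist (q (x, y)) 1 < 1 / 2"
      using that by (intro PQ r(2) s(2)) (simp_all add: dist_commute)
    then have "\<bar>Re (q (x, y) - 1)\<bar> < 1 / 2"
      using abs_Re_le_cmod[of "q (x, y) - 1"] unfolding dist_norm by linarith
    then show ?thesis
      by (auto simp: abs_if split: if_splits)
  qed
  define f :: "R3 \<Rightarrow> complex" where "f = indicator (ball y0 s)"
  have f: "f \<in> L2"
  proof (rule L2I)
    have "(\<lambda>x. (cmod (f x))\<^sup>2) = indicator (ball y0 s)"
      by (auto simp: f_def indicator_def)
    then show "integrable lborel (\<lambda>x. (cmod (f x))\<^sup>2)"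
      using integrable_indicator_ball[of y0 s] by simp
  qed (unfold f_def, rule borel_measurable_indicator, simp)
  then obtain u where u: "(f, u) \<in> inverse_graph A z"
    using z by (auto simp: resolvent_set_def)
  have "AE x in lborel. integrable lborel (\<lambda>y. k x y * f y) \<and> u x = (LINT y|lborel. k x y * f y)"
    using k u by (auto simp: is_resolvent_kernel_def)
  moreover have "AE x in lborel. integrable lborel (\<lambda>y. k' x y * f y) \<and> u x = (LINT y|lborel. k' x y * f y)"
    using k' u by (auto simp: is_resolvent_kernel_def)
  ultimately have "AE x in lborel. x \<notin> ball x0 r"
  proof eventually_elim
    case (elim x)
    show ?case
    proof
      assume x: "x \<in> ball x0 r"
      have int: "integrable lborel (\<lambda>y. q (x, y) * f y)"
        using elim by (simp add: q_def diff_divide_distrib left_diff_distrib)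
      have "(LINT y|lborel. q (x, y) * f y) = ((LINT y|lborel. k x y * f y) - (LINT y|lborel. k' x y * f y)) / d"
        using elim by (simp add: q_def diff_divide_distrib left_diff_distrib)
      then have "(LINT y|lborel. Re (q (x, y) * f y)) = 0"
        unfolding integral_Re[OF int] using elim by simp
      moreover have "(LINT y|lborel. 1 / 2 * indicator (ball y0 s) y) \<le> (LINT y|lborel. Re (q (x, y) * f y))"
      proof (rule integral_mono)
        show "integrable lborel (\<lambda>y. 1 / 2 * indicator (ball y0 s) y :: real)"
          by (intro integrable_mult_right integrable_indicator_ball)
        show "integrable lborel (\<lambda>y. Re (q (x, y) * f y))"
          by (rule integrable_Re[OF int])
        fix y
        show "1 / 2 * indicator (ball y0 s) y \<le> Re (q (x, y) * f y)"
          using close[OF x, of y] by (auto simp: f_def indicator_def)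
      qed
      ultimately have "1 / 2 * measure lborel (ball y0 s) \<le> 0"
        by simp
      moreover have "measure lborel (ball y0 s) > 0"
        using s(1) by (simp add: content_ball)
      ultimately show False by simp
    qed
  qed
  then have "ball x0 r = {}"
    by (intro open_AE_empty) auto
  then show False
    using r(1) by simp
qed

section \<open>The resolvent in the upper half-plane\<close>

context cutoff
begin

definition resolvent_solution :: "real \<Rightarrow> complex \<Rightarrow> (R3 \<Rightarrow> complex) \<Rightarrow> R3 \<Rightarrow> complex" where
  "resolvent_solution \<mu> \<kappa> f x = (potential \<kappa> f x + potential \<kappa> f 0 / (of_real \<mu> - \<i> * \<kappa>) * outgoing \<kappa> x) / of_real delta_mass"

context
  fixes \<mu> :: real and \<kappa> :: complex
  assumes \<kappa>: "Im \<kappa> > 0" and neq: "\<kappa> \<noteq> - \<i> * of_real \<mu>"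
begin

lemma denominator_nonzero: "of_real \<mu> - \<i> * \<kappa> \<noteq> 0"
proof
  assume "of_real \<mu> - \<i> * \<kappa> = 0"
  then have "- \<i> * of_real \<mu> = - \<i> * (\<i> * \<kappa>)" by simp
  then show False
    using neq by (simp flip: mult.assoc)
qed

lemma inverse_graph_solution:
  assumes f: "f \<in> L2" shows "(f, resolvent_solution \<mu> \<kappa> f) \<in> inverse_graph (L_op \<theta> \<mu>) (\<kappa>\<^sup>2)"
proof -
  \<comment> \<open>\<open>L_op_solution\<close> solves with right-hand side
    \<open>delta_mass\<close> times its source, so the source is divided by it beforehand.\<close>
  define g where "g x = 1 / of_real delta_mass * f x" for x
  have g: "g \<in> L2"
    unfolding g_def by (intro L2_cmult f)
  define c where "c = potential \<kappa> g 0 / (of_real \<mu> - \<i> * \<kappa>)"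
  have p: "potential \<kappa> g x = potential \<kappa> f x / of_real delta_mass" for x
    unfolding g_def[abs_def] potential_cmult[OF \<kappa>] by simp
  have u: "(\<lambda>x. potential \<kappa> g x + c * outgoing \<kappa> x) = resolvent_solution \<mu> \<kappa> f"
    by (auto simp: resolvent_solution_def c_def p add_divide_distrib)
  have fg: "of_real delta_mass * g x = f x" for x
    using delta_mass_pos by (simp add: g_def)
  have "(\<lambda>x. potential \<kappa> g x + c * outgoing \<kappa> x,
      \<lambda>x. of_real delta_mass * g x + \<kappa>\<^sup>2 * (potential \<kappa> g x + c * outgoing \<kappa> x)) \<in> L_op \<theta> \<mu>"
    using denominator_nonzero by (intro L_op_solution \<kappa> g) (simp add: c_def)
  then have "(resolvent_solution \<mu> \<kappa> f, \<lambda>x. f x + \<kappa>\<^sup>2 * resolvent_solution \<mu> \<kappa> f x) \<in> L_op \<theta> \<mu>"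
    by (simp add: fg flip: u)
  then show ?thesis
    unfolding inverse_graph_def using f by (auto intro!: exI[of _ "\<lambda>x. f x + \<kappa>\<^sup>2 * resolvent_solution \<mu> \<kappa> f x"] simp: ae_eq_refl)
qed

lemma inverse_graph_unique:
  assumes "(f, u) \<in> inverse_graph (L_op \<theta> \<mu>) (\<kappa>\<^sup>2)" and "(f, u') \<in> inverse_graph (L_op \<theta> \<mu>) (\<kappa>\<^sup>2)"
  shows "ae_eq u u'"
proof -
  obtain w where w: "(u, w) \<in> L_op \<theta> \<mu>" "ae_eq (\<lambda>x. w x - \<kappa>\<^sup>2 * u x) f"
    using assms(1) by (auto simp: inverse_graph_def)
  obtain w' where w': "(u', w') \<in> L_op \<theta> \<mu>" "ae_eq (\<lambda>x. w' x - \<kappa>\<^sup>2 * u' x) f"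
    using assms(2) by (auto simp: inverse_graph_def)
  have ae: "ae_eq (\<lambda>x. w x - w' x) (\<lambda>x. \<kappa>\<^sup>2 * (u x - u' x))"
    using w(2) w'(2) unfolding ae_eq_def
  proof eventually_elim
    case (elim x)
    then have "w x = f x + \<kappa>\<^sup>2 * u x" "w' x = f x + \<kappa>\<^sup>2 * u' x"
      by (simp_all add: algebra_simps diff_eq_eq)
    then show ?case
      by (simp add: algebra_simps)
  qed
  obtain \<beta> where "ae_eq (\<lambda>x. u x - u' x) (\<lambda>x. \<beta> * outgoing \<kappa> x)" "\<beta> = 0"
    using L_op_eigenfunction[OF less_imp_le[OF \<kappa>] L_op_diff[OF w(1) w'(1)] ae] neq by metis
  then show ?thesis
    by (simp add: ae_eq_def)
qed

lemma resolvent_set_memI: "\<kappa>\<^sup>2 \<in> resolvent_set (L_op \<theta> \<mu>)"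
proof -
  define N where "N = (LINT x|lborel. cmod (outgoing \<kappa> x))\<^sup>2"
  \<comment> \<open>The first summand is Young's bound for the free part; the second bounds the
    coefficient of the outgoing wave by the pointwise estimate \<open>norm_potential_le\<close> at
    the origin.\<close>
  define D where "D = (cmod (1 / of_real delta_mass))\<^sup>2 * (2 * N + 2 * (sqnorm (outgoing \<kappa>) / (cmod (of_real \<mu> - \<i> * \<kappa>))\<^sup>2 * sqnorm (outgoing \<kappa>)))"
  have D: "sqnorm (resolvent_solution \<mu> \<kappa> f) \<le> D * sqnorm f" if f: "f \<in> L2" for f
  proof -
    define c where "c = potential \<kappa> f 0 / (of_real \<mu> - \<i> * \<kappa>)"
    have c: "(cmod c)\<^sup>2 \<le> sqnorm (outgoing \<kappa>) * sqnorm f / (cmod (of_real \<mu> - \<i> * \<kappa>))\<^sup>2"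
      unfolding c_def norm_divide power_divide by (intro divide_right_mono norm_potential_le \<kappa> f) auto
    have eq: "resolvent_solution \<mu> \<kappa> f = (\<lambda>x. 1 / of_real delta_mass * (potential \<kappa> f x + c * outgoing \<kappa> x))"
      by (auto simp: resolvent_solution_def c_def)
    have "sqnorm (resolvent_solution \<mu> \<kappa> f) = (cmod (1 / of_real delta_mass))\<^sup>2 * sqnorm (\<lambda>x. potential \<kappa> f x + c * outgoing \<kappa> x)"
      unfolding eq by (intro sqnorm_cmult L2_add L2_cmult potential_L2 outgoing_L2 \<kappa> f)
    also have "\<dots> \<le> (cmod (1 / of_real delta_mass))\<^sup>2 * (2 * sqnorm (potential \<kappa> f) + 2 * sqnorm (\<lambda>x. c * outgoing \<kappa> x))"
      by (intro mult_left_mono sqnorm_add_le L2_cmult potential_L2 outgoing_L2 \<kappa> f) simp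
    also have "sqnorm (\<lambda>x. c * outgoing \<kappa> x) = (cmod c)\<^sup>2 * sqnorm (outgoing \<kappa>)"
      by (intro sqnorm_cmult outgoing_L2 \<kappa>)
    also have "(cmod (1 / of_real delta_mass))\<^sup>2 * (2 * sqnorm (potential \<kappa> f) + 2 * ((cmod c)\<^sup>2 * sqnorm (outgoing \<kappa>)))
        \<le> (cmod (1 / of_real delta_mass))\<^sup>2 * (2 * (N * sqnorm f) + 2 * (sqnorm (outgoing \<kappa>) * sqnorm f / (cmod (of_real \<mu> - \<i> * \<kappa>))\<^sup>2 * sqnorm (outgoing \<kappa>)))"
      unfolding N_def by (intro mult_left_mono add_mono mult_right_mono c sqnorm_potential_le \<kappa> f sqnorm_nonneg) auto
    also have "\<dots> = D * sqnorm f"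
      by (simp add: D_def algebra_simps)
    finally show ?thesis .
  qed
  have bound: "L2_norm u \<le> sqrt D * L2_norm f" if fu: "(f, u) \<in> inverse_graph (L_op \<theta> \<mu>) (\<kappa>\<^sup>2)" for f u
  proof -
    have f: "f \<in> L2"
      using fu by (simp add: inverse_graph_def)
    have u: "u \<in> L2"
      using fu by (auto simp: inverse_graph_def L_op_def dom_L_def)
    have sol: "resolvent_solution \<mu> \<kappa> f \<in> L2"
      using inverse_graph_solution[OF f] by (auto simp: inverse_graph_def L_op_def dom_L_def)
    note [measurable] = L2D(1)[OF u] L2D(1)[OF sol]
    have "sqnorm u = sqnorm (resolvent_solution \<mu> \<kappa> f)"
      unfolding sqnorm_def
    proof (rule integral_cong_AE)
      show "AE x in lborel. (cmod (u x))\<^sup>2 = (cmod (resolvent_solution \<mu> \<kappa> f x))\<^sup>2"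
        using inverse_graph_unique[OF fu inverse_graph_solution[OF f]] unfolding ae_eq_def by eventually_elim simp
    qed measurable
    then have "sqrt (sqnorm u) \<le> sqrt (D * sqnorm f)"
      using D[OF f] by simp
    then show ?thesis
      by (simp add: L2_norm_def sqnorm_def real_sqrt_mult)
  qed
  show ?thesis
    unfolding resolvent_set_def
  proof (intro CollectI conjI)
    show "\<forall>f\<in>L2. \<exists>u. (f, u) \<in> inverse_graph (L_op \<theta> \<mu>) (\<kappa>\<^sup>2)"
      using inverse_graph_solution by blast
    show "\<forall>f u u'. (f, u) \<in> inverse_graph (L_op \<theta> \<mu>) (\<kappa>\<^sup>2) \<and> (f, u') \<in> inverse_graph (L_op \<theta> \<mu>) (\<kappa>\<^sup>2) \<longrightarrow> ae_eq u u'"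
      using inverse_graph_unique by blast
    show "\<exists>C. \<forall>(f, u)\<in>inverse_graph (L_op \<theta> \<mu>) (\<kappa>\<^sup>2). L2_norm u \<le> C * L2_norm f"
      using bound by blast
  qed
qed

lemma point_kernel_is_resolvent_kernel: "is_resolvent_kernel (L_op \<theta> \<mu>) (\<kappa>\<^sup>2) (point_kernel \<mu> \<kappa>)"
  unfolding is_resolvent_kernel_def
proof (intro conjI ballI)
  have [simp]: "delta_mass \<noteq> 0"
    using delta_mass_pos by simp
  have "continuous_on regular_pairs (\<lambda>p. point_kernel \<mu> \<kappa> (fst p) (snd p))"
    unfolding point_kernel_def outgoing_def using denominator_nonzero
    by (intro continuous_intros) (auto simp: regular_pairs_def)
  then show "continuous_on regular_pairs (\<lambda>(x, y). point_kernel \<mu> \<kappa> x y)"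
    by (simp add: case_prod_beta)
  fix fu assume fu': "fu \<in> inverse_graph (L_op \<theta> \<mu>) (\<kappa>\<^sup>2)"
  obtain f u where [simp]: "fu = (f, u)"
    by (cases fu)
  have fu: "(f, u) \<in> inverse_graph (L_op \<theta> \<mu>) (\<kappa>\<^sup>2)"
    using fu' by simp
  have f: "f \<in> L2"
    using fu by (simp add: inverse_graph_def)
  define m where "m = of_real delta_mass * (of_real \<mu> - \<i> * \<kappa>)"
  have i: "integrable lborel (\<lambda>y. outgoing \<kappa> (x - y) * f y)" "integrable lborel (\<lambda>y. outgoing \<kappa> y * f y)" for x
    using potential_integrable[OF \<kappa> f, of x] L2_mult_integrable(1)[OF outgoing_L2[OF \<kappa>] f] by auto
  have eq: "point_kernel \<mu> \<kappa> x y * f y = 1 / of_real delta_mass * (outgoing \<kappa> (x - y) * f y) + outgoing \<kappa> x / m * (outgoing \<kappa> y * f y)" for x y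
    by (simp add: point_kernel_def m_def algebra_simps)
  have int: "integrable lborel (\<lambda>y. point_kernel \<mu> \<kappa> x y * f y)" for x
    unfolding eq using i by (intro Bochner_Integration.integrable_add integrable_mult_right) auto
  have "(LINT y|lborel. point_kernel \<mu> \<kappa> x y * f y) = resolvent_solution \<mu> \<kappa> f x" for x
  proof -
    have "(LINT y|lborel. point_kernel \<mu> \<kappa> x y * f y)
        = 1 / of_real delta_mass * (LINT y|lborel. outgoing \<kappa> (x - y) * f y) + outgoing \<kappa> x / m * (LINT y|lborel. outgoing \<kappa> y * f y)"
      unfolding eq using i by (subst Bochner_Integration.integral_add) (auto intro: integrable_mult_right)
    also have "(LINT y|lborel. outgoing \<kappa> (x - y) * f y) = potential \<kappa> f x"
      by (simp only: potential_def)
    also have "(LINT y|lborel. outgoing \<kappa> y * f y) = potential \<kappa> f 0"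
      by (simp add: potential_def outgoing_def)
    finally show ?thesis
      by (simp add: resolvent_solution_def m_def add_divide_distrib mult_ac)
  qed
  then have "AE x in lborel. integrable lborel (\<lambda>y. point_kernel \<mu> \<kappa> x y * f y) \<and> u x = (LINT y|lborel. point_kernel \<mu> \<kappa> x y * f y)"
    using inverse_graph_unique[OF fu inverse_graph_solution[OF f]] int by (simp add: ae_eq_def)
  then show "case fu of (f, u) \<Rightarrow> AE x in lborel. integrable lborel (\<lambda>y. point_kernel \<mu> \<kappa> x y * f y) \<and> u x = (LINT y|lborel. point_kernel \<mu> \<kappa> x y * f y)"
    by simp
qed

lemma K_is_resolvent_kernel: "is_resolvent_kernel (L_op \<theta> \<mu>) (\<kappa>\<^sup>2) (K \<theta> \<mu> \<kappa>)"
  unfolding K_def resolvent_kernel_def by (rule someI[where P="is_resolvent_kernel (L_op \<theta> \<mu>) (\<kappa>\<^sup>2)", OF point_kernel_is_resolvent_kernel])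

lemma K_eq_point_kernel: "(x, y) \<in> regular_pairs \<Longrightarrow> K \<theta> \<mu> \<kappa> x y = point_kernel \<mu> \<kappa> x y"
  by (rule resolvent_kernel_unique[OF resolvent_set_memI K_is_resolvent_kernel point_kernel_is_resolvent_kernel])

end

section \<open>Eigenvalues and eigenspaces\<close>

lemma outgoing_eq_v: "outgoing (- \<i> * of_real \<mu>) = v \<mu>"
proof
  fix x :: R3
  have "\<i> * (- \<i> * complex_of_real \<mu>) * of_real (norm x) = of_real (\<mu> * norm x)"
    by (simp flip: mult.assoc)
  then show "outgoing (- \<i> * of_real \<mu>) x = v \<mu> x"
    unfolding outgoing_def v_def by (simp only: exp_of_real of_real_divide)
qed

lemma v_not_ae_zero: "\<not> ae_eq (v \<mu>) (\<lambda>_. 0)"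
proof
  assume "ae_eq (v \<mu>) (\<lambda>_. 0)"
  then have "AE x in lborel. x \<notin> - {0 :: R3}"
    unfolding ae_eq_def by eventually_elim (auto simp: v_def)
  then have "- {0 :: R3} = {}"
    by (intro open_AE_empty) auto
  then have "axis 1 1 = (0 :: R3)"
    by blast
  then show False
    by (simp add: axis_eq_0_iff)
qed

lemma kappa_square: "(- \<i> * complex_of_real \<mu>)\<^sup>2 = of_real (- \<mu>\<^sup>2)"
  by (simp add: power_mult_distrib)

lemma v_in_L_op:
  assumes "\<mu> < 0"
  shows "v \<mu> \<in> L2" and "(v \<mu>, \<lambda>x. of_real (- \<mu>\<^sup>2) * v \<mu> x) \<in> L_op \<theta> \<mu>"
proof -
  have Im: "Im (- \<i> * of_real \<mu>) > 0"
    using assms by simp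
  show "v \<mu> \<in> L2"
    using outgoing_L2[OF Im] unfolding outgoing_eq_v .
  \<comment> \<open>With source 0 and \<open>\<i> * \<kappa> = of_real \<mu>\<close> both sides of
    the condition in \<open>L_op_solution\<close> are zero, for every coefficient.\<close>
  have "potential (- \<i> * of_real \<mu>) (\<lambda>_. 0) x = 0" for x
    by (simp add: potential_def)
  then show "(v \<mu>, \<lambda>x. of_real (- \<mu>\<^sup>2) * v \<mu> x) \<in> L_op \<theta> \<mu>"
    using L_op_solution[OF Im L2_zero, of 1 \<mu>] unfolding kappa_square outgoing_eq_v by (simp flip: mult.assoc)
qed

lemma ae_multiple_of_v_in_L_op:
  assumes \<mu>: "\<mu> < 0" and u: "u \<in> L2" "ae_eq u (\<lambda>x. c * v \<mu> x)"
  shows "(u, \<lambda>x. of_real (- \<mu>\<^sup>2) * u x) \<in> L_op \<theta> \<mu>"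
proof -
  have Im: "Im (- \<i> * of_real \<mu>) > 0"
    using \<mu> by simp
  have "potential (- \<i> * of_real \<mu>) (\<lambda>_. 0) x = 0" for x
    by (simp add: potential_def)
  then have "(\<lambda>x. c * v \<mu> x, \<lambda>x. of_real (- \<mu>\<^sup>2) * (c * v \<mu> x)) \<in> L_op \<theta> \<mu>"
    using L_op_solution[OF Im L2_zero, of c \<mu>] unfolding kappa_square outgoing_eq_v by (simp flip: mult.assoc)
  moreover have "ae_eq (\<lambda>x. of_real (- \<mu>\<^sup>2) * (c * v \<mu> x)) (\<lambda>x. of_real (- \<mu>\<^sup>2) * u x)"
    using u(2) unfolding ae_eq_def by eventually_elim simp
  ultimately show ?thesis
    by (rule L_op_ae_cong[OF _ u(1) ae_eq_sym[OF u(2)] L2_cmult[OF u(1)]])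
qed

lemma complex_square_root_upper: obtains \<kappa> where "z = \<kappa>\<^sup>2" and "Im \<kappa> \<ge> 0"
proof (cases "Im (csqrt z) \<ge> 0")
  case True
  then show ?thesis
    using that[of "csqrt z"] by simp
next
  case False
  then show ?thesis
    using that[of "- csqrt z"] by simp
qed

lemma eigenfunction_eq_v:
  assumes "u \<in> eigenspace (L_op \<theta> \<mu>) z"
  obtains "ae_eq u (\<lambda>_. 0)" | c where "\<mu> < 0" "z = of_real (- \<mu>\<^sup>2)" "ae_eq u (\<lambda>x. c * v \<mu> x)"
proof -
  obtain \<kappa> where z: "z = \<kappa>\<^sup>2" and Im: "Im \<kappa> \<ge> 0"
    using complex_square_root_upper by blast
  obtain \<beta> where \<beta>: "ae_eq u (\<lambda>x. \<beta> * outgoing \<kappa> x)" "\<beta> = 0 \<or> Im \<kappa> > 0 \<and> \<kappa> = - \<i> * of_real \<mu>"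
    using L_op_eigenfunction[OF Im, of u "\<lambda>x. z * u x" \<mu>] assms by (auto simp: eigenspace_def z ae_eq_refl)
  show ?thesis
  proof (cases "\<beta> = 0")
    case True
    then show ?thesis
      using \<beta>(1) that(1) by simp
  next
    case False
    then have \<kappa>: "\<kappa> = - \<i> * of_real \<mu>" "Im \<kappa> > 0"
      using \<beta>(2) by auto
    then have "\<mu> < 0" by simp
    moreover have "z = of_real (- \<mu>\<^sup>2)"
      unfolding z \<kappa>(1) by (rule kappa_square)
    moreover have "ae_eq u (\<lambda>x. \<beta> * v \<mu> x)"
      using \<beta>(1) unfolding \<kappa>(1) outgoing_eq_v .
    ultimately show ?thesis
      using that(2) by blast
  qed
qed

lemma eigenspace_L_op:
  assumes \<mu>: "\<mu> < 0"
  shows "eigenspace (L_op \<theta> \<mu>) (of_real (- \<mu>\<^sup>2)) = {u \<in> L2. \<exists>c. ae_eq u (\<lambda>x. c * v \<mu> x)}"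
proof (intro set_eqI iffI)
  fix u assume u: "u \<in> eigenspace (L_op \<theta> \<mu>) (of_real (- \<mu>\<^sup>2))"
  then have "u \<in> L2"
    by (auto simp: eigenspace_def L_op_def dom_L_def)
  moreover have "\<exists>c. ae_eq u (\<lambda>x. c * v \<mu> x)"
    using u
  proof (cases rule: eigenfunction_eq_v)
    case 1
    then show ?thesis
      by (intro exI[of _ 0]) simp
  qed blast
  ultimately show "u \<in> {u \<in> L2. \<exists>c. ae_eq u (\<lambda>x. c * v \<mu> x)}"
    by blast
next
  fix u assume "u \<in> {u \<in> L2. \<exists>c. ae_eq u (\<lambda>x. c * v \<mu> x)}"
  then show "u \<in> eigenspace (L_op \<theta> \<mu>) (of_real (- \<mu>\<^sup>2))"
    using ae_multiple_of_v_in_L_op[OF \<mu>] by (auto simp: eigenspace_def)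
qed

lemma eigenvalues_L_op:
  "{z. is_eigenvalue (L_op \<theta> \<mu>) z} = (if \<mu> < 0 then {of_real (- \<mu>\<^sup>2)} else {})"
proof (intro set_eqI iffI)
  fix z assume "z \<in> {z. is_eigenvalue (L_op \<theta> \<mu>) z}"
  then obtain u where u: "u \<in> eigenspace (L_op \<theta> \<mu>) z" "\<not> ae_eq u (\<lambda>_. 0)"
    by (auto simp: is_eigenvalue_def)
  show "z \<in> (if \<mu> < 0 then {of_real (- \<mu>\<^sup>2)} else {})"
    using u(1)
  proof (cases rule: eigenfunction_eq_v)
    case 1
    then show ?thesis
      using u(2) by blast
  next
    case (2 c)
    then show ?thesis by simp
  qed
next
  fix z assume "z \<in> (if \<mu> < 0 then {complex_of_real (- \<mu>\<^sup>2)} else {})"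
  then have z: "\<mu> < 0" "z = of_real (- \<mu>\<^sup>2)"
    by (auto split: if_splits)
  have "v \<mu> \<in> eigenspace (L_op \<theta> \<mu>) z"
    unfolding eigenspace_def z(2) using v_in_L_op(2)[OF z(1)] by simp
  then show "z \<in> {z. is_eigenvalue (L_op \<theta> \<mu>) z}"
    unfolding is_eigenvalue_def using v_not_ae_zero by blast
qed

text \<open>At \<open>- \<i> * of_real \<mu>\<close> both 0 and \<open>v \<mu>\<close> solve the
  homogeneous equation. Together with \<open>resolvent_set_memI\<close> this identifies exactly the
  points of the upper half-plane at which a continuation is prescribed.\<close>

lemma resolvent_set_imp_neq:
  assumes Im: "Im \<kappa> > 0" and res: "\<kappa>\<^sup>2 \<in> resolvent_set (L_op \<theta> \<mu>)"
  shows "\<kappa> \<noteq> - \<i> * of_real \<mu>"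
proof
  assume \<kappa>: "\<kappa> = - \<i> * of_real \<mu>"
  then have \<mu>: "\<mu> < 0"
    using Im by simp
  have k2: "\<kappa>\<^sup>2 = of_real (- \<mu>\<^sup>2)"
    unfolding \<kappa> by (rule kappa_square)
  have "(\<lambda>_. 0, v \<mu>) \<in> inverse_graph (L_op \<theta> \<mu>) (\<kappa>\<^sup>2)"
    unfolding inverse_graph_def k2 using v_in_L_op(2)[OF \<mu>] L2_zero
    by (auto intro!: exI[of _ "\<lambda>x. of_real (- \<mu>\<^sup>2) * v \<mu> x"] simp: ae_eq_def)
  moreover have "(\<lambda>_. 0, \<lambda>_. 0) \<in> inverse_graph (L_op \<theta> \<mu>) (\<kappa>\<^sup>2)"
  proof -
    have "(\<lambda>x. v \<mu> x - v \<mu> x, \<lambda>x. of_real (- \<mu>\<^sup>2) * v \<mu> x - of_real (- \<mu>\<^sup>2) * v \<mu> x) \<in> L_op \<theta> \<mu>"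
      by (intro L_op_diff v_in_L_op(2) \<mu>)
    then show ?thesis
      unfolding inverse_graph_def using L2_zero by (auto intro!: exI[of _ "\<lambda>_. 0"] simp: ae_eq_def)
  qed
  ultimately have "ae_eq (v \<mu>) (\<lambda>_. 0)"
    using res unfolding resolvent_set_def by blast
  then show False
    using v_not_ae_zero by blast
qed

section \<open>Meromorphic continuation and resonances\<close>

lemma point_kernel_continuation:
  assumes xy: "(x, y) \<in> regular_pairs"
  shows "K_continuation \<theta> \<mu> x y (\<lambda>\<kappa>. point_kernel \<mu> \<kappa> x y)"
  unfolding K_continuation_def
proof (intro conjI allI impI)
  show "(\<lambda>\<kappa>. point_kernel \<mu> \<kappa> x y) meromorphic_on UNIV"
    unfolding point_kernel_def outgoing_def
    by (intro meromorphic_intros analytic_on_imp_meromorphic_on[of "\<lambda>\<kappa>. exp (\<i> * \<kappa> * c)" for c] analytic_intros)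
  fix \<kappa> assume "Im \<kappa> > 0 \<and> \<kappa>\<^sup>2 \<in> resolvent_set (L_op \<theta> \<mu>)"
  then show "point_kernel \<mu> \<kappa> x y = K \<theta> \<mu> \<kappa> x y"
    using K_eq_point_kernel[OF _ resolvent_set_imp_neq xy] by simp
qed

text \<open>A meromorphic function may take arbitrary values at isolated points, so agreement holds
  only on punctured neighbourhoods, which is enough to compare poles. The difference vanishes on a
  nonempty open set, and the identity theorem spreads this over the plane.\<close>

lemma K_continuation_eventually_eq:
  assumes xy: "(x, y) \<in> regular_pairs" and F: "K_continuation \<theta> \<mu> x y F"
  shows "eventually (\<lambda>\<kappa>. F \<kappa> = point_kernel \<mu> \<kappa> x y) (at \<zeta>)"
proof -
  define D where "D \<kappa> = F \<kappa> - point_kernel \<mu> \<kappa> x y" for \<kappa>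
  have D: "D meromorphic_on UNIV"
    unfolding D_def using F point_kernel_continuation[OF xy] by (intro meromorphic_intros) (auto simp: K_continuation_def)
  define S where "S = {\<kappa>. Im \<kappa> > 0} \<inter> - {- \<i> * complex_of_real \<mu>}"
  have S: "open S"
    unfolding S_def by (intro open_Int open_halfspace_Im_gt) auto
  have D0: "D \<kappa> = 0" if "\<kappa> \<in> S" for \<kappa>
  proof -
    have k: "Im \<kappa> > 0" "\<kappa> \<noteq> - \<i> * of_real \<mu>"
      using that by (auto simp: S_def)
    have "F \<kappa> = K \<theta> \<mu> \<kappa> x y"
      using F resolvent_set_memI[OF k] k(1) by (auto simp: K_continuation_def)
    then show ?thesis
      using K_eq_point_kernel[OF k xy] by (simp add: D_def)
  qed
  \<comment> \<open>A point of \<open>S\<close>: its imaginary part is positive and exceeds that of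
    \<open>- \<i> * of_real \<mu>\<close>.\<close>
  define z where "z = \<i> * complex_of_real (\<bar>\<mu>\<bar> + 1)"
  have z: "z \<in> S"
    by (auto simp: z_def S_def complex_eq_iff)
  \<comment> \<open>Removing singularities fixes the values at isolated points, which is the normal
    form in which the identity theorem is applied.\<close>
  have ev: "eventually (\<lambda>w. remove_sings D w = D w) (at w0)" for w0
    using D by (intro eventually_remove_sings_eq_at meromorphic_on_isolated_singularity) (rule meromorphic_on_subset, auto)
  have "eventually (\<lambda>w. w \<in> S) (at z)"
    using S z by (rule eventually_at_in_open')
  with ev[of z] have "eventually (\<lambda>w. remove_sings D w = 0) (at z)"
    by eventually_elim (simp add: D0)
  then have "frequently (\<lambda>w. remove_sings D w = 0) (at z)"
    by (rule eventually_frequently[rotated]) simp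
  then have "remove_sings D w = 0" for w
    using frequently_eq_meromorphic_imp_constant[OF _ remove_sings_nicely_meromorphic[OF D], of 0 z w] by (simp add: connected_UNIV)
  then show ?thesis
    using ev[of \<zeta>] by (auto elim: eventually_mono simp: D_def)
qed

text \<open>Both \<open>A\<close> and \<open>B\<close> are entire, and \<open>B\<close> is a nonzero
  multiple of a product of exponentials. Having no zeros, it cannot cancel the simple zero of the
  denominator, so the pole occurs at every regular pair.\<close>

lemma point_kernel_pole_iff:
  assumes xy: "(x, y) \<in> regular_pairs"
  shows "is_pole (\<lambda>\<kappa>. point_kernel \<mu> \<kappa> x y) \<zeta> \<longleftrightarrow> \<zeta> = - \<i> * of_real \<mu>"
proof -
  have nz: "x \<noteq> 0" "y \<noteq> 0" "x - y \<noteq> 0" "delta_mass \<noteq> 0"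
    using xy delta_mass_pos by (auto simp: regular_pairs_def)
  define \<kappa>0 where "\<kappa>0 = - \<i> * complex_of_real \<mu>"
  have den: "of_real \<mu> - \<i> * \<kappa> = - \<i> * (\<kappa> - \<kappa>0)" for \<kappa>
    by (simp add: \<kappa>0_def algebra_simps)
  define A where "A \<kappa> = outgoing \<kappa> (x - y) / of_real delta_mass" for \<kappa>
  define B where "B \<kappa> = outgoing \<kappa> x * outgoing \<kappa> y / of_real delta_mass" for \<kappa>
  have pk: "point_kernel \<mu> \<kappa> x y = A \<kappa> + B \<kappa> / (- \<i> * (\<kappa> - \<kappa>0))" for \<kappa>
    by (simp add: point_kernel_def A_def B_def den)
  have an: "A analytic_on UNIV" "B analytic_on UNIV"
    unfolding A_def[abs_def] B_def[abs_def] outgoing_def using nz by (auto intro!: analytic_intros)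
  have cont: "isCont A w" "isCont B w" for w
    using an by (meson UNIV_I analytic_at_imp_isCont analytic_on_analytic_at)+
  have "\<not> is_pole (\<lambda>\<kappa>. point_kernel \<mu> \<kappa> x y) \<zeta>" if "\<zeta> \<noteq> \<kappa>0"
  proof -
    have "isCont (\<lambda>\<kappa>. point_kernel \<mu> \<kappa> x y) \<zeta>"
      unfolding pk using that by (intro continuous_intros cont) auto
    then show ?thesis
      unfolding is_pole_def isCont_def using not_tendsto_and_filterlim_at_infinity[OF trivial_limit_at] by blast
  qed
  moreover have "is_pole (\<lambda>\<kappa>. point_kernel \<mu> \<kappa> x y) \<kappa>0"
  proof -
    have pole: "is_pole (\<lambda>\<kappa>. (A \<kappa> * (- \<i> * (\<kappa> - \<kappa>0)) + B \<kappa>) / (- \<i> * (\<kappa> - \<kappa>0))) \<kappa>0"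
    proof (rule is_pole_divide)
      show "isCont (\<lambda>\<kappa>. A \<kappa> * (- \<i> * (\<kappa> - \<kappa>0)) + B \<kappa>) \<kappa>0"
        by (intro continuous_intros cont)
      show "filterlim (\<lambda>\<kappa>. - \<i> * (\<kappa> - \<kappa>0)) (at 0) (at \<kappa>0)"
      proof (rule filterlim_atI)
        have "((\<lambda>\<kappa>. - \<i> * (\<kappa> - \<kappa>0)) \<longlongrightarrow> - \<i> * (\<kappa>0 - \<kappa>0)) (at \<kappa>0)"
          by (intro tendsto_intros)
        then show "((\<lambda>\<kappa>. - \<i> * (\<kappa> - \<kappa>0)) \<longlongrightarrow> 0) (at \<kappa>0)"
          by simp
        show "\<forall>\<^sub>F \<kappa> in at \<kappa>0. - \<i> * (\<kappa> - \<kappa>0) \<noteq> 0"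
          by (auto simp: eventually_at intro!: exI[of _ 1])
      qed
      show "A \<kappa>0 * (- \<i> * (\<kappa>0 - \<kappa>0)) + B \<kappa>0 \<noteq> 0"
        using nz by (simp add: B_def outgoing_def)
    qed
    have "eventually (\<lambda>\<kappa>. (A \<kappa> * (- \<i> * (\<kappa> - \<kappa>0)) + B \<kappa>) / (- \<i> * (\<kappa> - \<kappa>0)) = point_kernel \<mu> \<kappa> x y) (at \<kappa>0)"
    proof -
      have "(A \<kappa> * (- \<i> * (\<kappa> - \<kappa>0)) + B \<kappa>) / (- \<i> * (\<kappa> - \<kappa>0)) = point_kernel \<mu> \<kappa> x y" if "\<kappa> \<noteq> \<kappa>0" for \<kappa>
      proof -
        have "- \<i> * (\<kappa> - \<kappa>0) \<noteq> 0"
          using that by simp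
        then show ?thesis
          unfolding pk by (simp only: add_divide_distrib nonzero_mult_div_cancel_right not_False_eq_True)
      qed
      then show ?thesis
        by (auto simp: eventually_at intro!: exI[of _ 1])
    qed
    from is_pole_cong[OF this refl] pole show ?thesis
      by (rule iffD1)
  qed
  ultimately show ?thesis
    unfolding \<kappa>0_def by blast
qed

lemma resonances_L_op:
  "{\<kappa>. is_resonance \<theta> \<mu> \<kappa>} = (if \<mu> < 0 then {} else {- \<i> * of_real \<mu>})"
proof -
  have iff: "is_resonance \<theta> \<mu> \<kappa> \<longleftrightarrow> Im \<kappa> \<le> 0 \<and> \<kappa> = - \<i> * of_real \<mu>" for \<kappa>
  proof
    assume "is_resonance \<theta> \<mu> \<kappa>"
    then obtain x y F where Im: "Im \<kappa> \<le> 0" and xy: "(x, y) \<in> regular_pairs" and F: "K_continuation \<theta> \<mu> x y F" "is_pole F \<kappa>"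
      by (auto simp: is_resonance_def)
    have "is_pole (\<lambda>\<kappa>. point_kernel \<mu> \<kappa> x y) \<kappa>"
      using is_pole_cong[OF K_continuation_eventually_eq[OF xy F(1)] refl] F(2) by blast
    then show "Im \<kappa> \<le> 0 \<and> \<kappa> = - \<i> * of_real \<mu>"
      using Im point_kernel_pole_iff[OF xy] by blast
  next
    assume \<kappa>: "Im \<kappa> \<le> 0 \<and> \<kappa> = - \<i> * of_real \<mu>"
    \<comment> \<open>Since every regular pair shows the pole, two distinct unit vectors serve as
      witness.\<close>
    have xy: "(axis 1 1, axis 1 2) \<in> (regular_pairs :: (R3 \<times> R3) set)"
      by (auto simp: regular_pairs_def axis_eq_0_iff axis_eq_axis)
    have "is_pole (\<lambda>\<kappa>. point_kernel \<mu> \<kappa> (axis 1 1) (axis 1 2)) \<kappa>"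
      using point_kernel_pole_iff[OF xy] \<kappa> by blast
    then show "is_resonance \<theta> \<mu> \<kappa>"
      unfolding is_resonance_def using \<kappa> xy point_kernel_continuation[OF xy] by blast
  qed
  show ?thesis
  proof (cases "\<mu> < 0")
    case True
    have "\<not> is_resonance \<theta> \<mu> \<kappa>" for \<kappa>
      unfolding iff using True by auto
    then show ?thesis
      using True by simp
  next
    case False
    have "{\<kappa>. is_resonance \<theta> \<mu> \<kappa>} = {- \<i> * of_real \<mu>}"
      unfolding iff using False by auto
    then show ?thesis
      using False by simp
  qed
qed

end

theorem mainTheorem4:
  fixes \<mu> :: real and \<theta> :: "real ^ 3 \<Rightarrow> complex"
  assumes "\<theta> \<in> test_functions UNIV"
    and "eventually (\<lambda>x. \<theta> x = 1) (nhds 0)"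
  shows "(\<forall>\<kappa>. Im \<kappa> > 0 \<and> \<kappa>\<^sup>2 \<in> resolvent_set (L_op \<theta> \<mu>) \<longrightarrow>
            is_resolvent_kernel (L_op \<theta> \<mu>) (\<kappa>\<^sup>2) (K \<theta> \<mu> \<kappa>)) \<and>
         (\<forall>(x, y)\<in>regular_pairs. \<exists>F. K_continuation \<theta> \<mu> x y F) \<and>
         ((\<exists>!z. is_eigenvalue (L_op \<theta> \<mu>) z) \<noteq> (\<exists>!\<kappa>. is_resonance \<theta> \<mu> \<kappa>)) \<and>
         (\<mu> < 0 \<longrightarrow>
            {z. is_eigenvalue (L_op \<theta> \<mu>) z} = {complex_of_real (- \<mu>\<^sup>2)} \<and>
            eigenspace (L_op \<theta> \<mu>) (complex_of_real (- \<mu>\<^sup>2))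
              = {u \<in> L2. \<exists>c. ae_eq u (\<lambda>x. c * v \<mu> x)} \<and>
            {\<kappa>. is_resonance \<theta> \<mu> \<kappa>} = {}) \<and>
         (\<mu> \<ge> 0 \<longrightarrow>
            {z. is_eigenvalue (L_op \<theta> \<mu>) z} = {} \<and>
            {\<kappa>. is_resonance \<theta> \<mu> \<kappa>} = {- \<i> * complex_of_real \<mu>})"
proof -
  interpret cutoff \<theta>
    using assms by unfold_locales
  have kernel: "is_resolvent_kernel (L_op \<theta> \<mu>) (\<kappa>\<^sup>2) (K \<theta> \<mu> \<kappa>)"
    if "Im \<kappa> > 0 \<and> \<kappa>\<^sup>2 \<in> resolvent_set (L_op \<theta> \<mu>)" for \<kappa>
    using K_is_resolvent_kernel[OF _ resolvent_set_imp_neq] that by blast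
  have continuation: "\<exists>F. K_continuation \<theta> \<mu> x y F" if "(x, y) \<in> regular_pairs" for x y
    using point_kernel_continuation[OF that] by blast
  note eig = eigenvalues_L_op[of \<mu>] and res = resonances_L_op[of \<mu>]
  \<comment> \<open>Unique existence is phrased through singleton sets, so that the two set
    equations can be substituted into the dichotomy.\<close>
  have unique: "(\<exists>!z. P z) \<longleftrightarrow> (\<exists>z. {z. P z} = {z})" for P :: "complex \<Rightarrow> bool"
    by (auto simp: set_eq_iff)
  have "(\<exists>!z. is_eigenvalue (L_op \<theta> \<mu>) z) \<noteq> (\<exists>!\<kappa>. is_resonance \<theta> \<mu> \<kappa>)"
    unfolding unique eig res by simp
  then show ?thesis
    using kernel continuation eig res eigenspace_L_op[of \<mu>] by auto
qed


end
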